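(* Let $\mathcal{C}$ be a monoidal category and let $\mathbb{A}$ be a Hopf algebra in the center $\mathcal{Z}(\mathcal{C})$ of $\mathcal{C}$. The assignment $${}^{\mathbb{A}}_{\mathbb{A}}\mathcal{YD}(\mathcal{Z}(\mathcal{C}))\to\mathcal{Z}({}_{\mathbb{A}}\mathcal{C}),\qquad \bigl((M,\sigma),r,\delta\bigr)\mapsto\bigl((M,r),\gamma\bigr),\quad f\mapsto f,$$ where for every left module $(N,t)$ in ${}_{\mathbb{A}}\mathcal{C}$ $$\gamma_{(N,t)}=(t\otimes\mathrm{id}_M)(\mathrm{id}_A\otimes\sigma_N)(\delta\otimes\mathrm{id}_N)\colon M\otimes N\to N\otimes M,$$ is a braided strict monoidal isomorphism.
   Context: Monoidal categories are treated as strict. A half braiding of $\mathcal{C}$ is a pair $(M,\sigma)$ with $\sigma=\{\sigma_X\colon M\otimes X\to X\otimes M\}_X$ a natural isomorphism such that $\sigma_{X\otimes Y}=(\mathrm{id}_X\otimes\sigma_Y)(\sigma_X\otimes\mathrm{id}_Y)$. The center $\mathcal{Z}(\mathcal{C})$ has half braidings as objects; morphisms $(M,\sigma)\to(M',\sigma')$ are $f\colon M\to M'$ with $(\mathrm{id}_X\otimes f)\sigma_X=\sigma'_X(f\otimes\mathrm{id}_X)$; $(M,\sigma)\otimes(N,\omega)=(M\otimes N,(\sigma\otimes\mathrm{id}_N)(\mathrm{id}_M\otimes\omega))$; braiding $\tau_{(M,\sigma),(N,\omega)}=\sigma_N$. A Hopf algebra in a braided category $(\mathcal{B},\tau)$ is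 a bialgebra $(A,m,u,\Delta,\varepsilon)$ in $\mathcal{B}$ (with $\Delta m=(m\otimes m)(\mathrm{id}\otimes\tau_{A,A}\otimes\mathrm{id})(\Delta\otimes\Delta)$) with an invertible antipode. A (left-left) Yetter–Drinfeld module of a bialgebra $A$ in a braided category $(\mathcal{B},\tau)$ is an object $M$ with a left $A$-action $r\colon A\otimes M\to M$ and a left $A$-coaction $\delta\colon M\to A\otimes M$ such that $$(m\otimes\mathrm{id}_M)(\mathrm{id}_A\otimes\tau_{M,A})(\delta r\otimes\mathrm{id}_A)(\mathrm{id}_A\otimes\tau_{A,M})(\Delta\otimes\mathrm{id}_M)=(m\otimes r)(\mathrm{id}_A\otimes\tau_{A,A}\otimes\mathrm{id}_M)(\Delta\otimes\delta).$$ They form a category ${}^A_A\mathcal{YD}(\mathcal{B})$ whose morphisms are the $A$-linear and $A$-colinear morphisms. It is braided, with $(M,r,\delta)\otimes(M',r',\delta')=(M\otimes M',r'',\delta'')$, $r''=(r\otimes r')(\mathrm{id}_A\otimes\tau_{A,M}\otimes\mathrm{id}_{M'})(\Delta\otimes\mathrm{id}_{M\otimes M'})$, $\delta''=(m\otimes\mathrm{id}_{M\otimes M'})(\mathrm{id}_A\otimes\tau_{M,A}\otimes\mathrm{id}_{M'})(\delta\otimes\delta')$, unit $(\mathbb 1,\varepsilon,u)$, and braiding $c_{(M,r,\delta),(M',r',\delta')}=(r'\otimes\mathrm{id}_M)(\mathrm{id}_A\otimes\tau_{M,M'})(\delta\otimes\mathrm{id}_{M'})$. Here it is applied to $\mathcal{B}=\mathcal{Z}(\mathcal{C})$.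 For a bialgebra $\mathbb{A}=(A,\varsigma)$ in $\mathcal{Z}(\mathcal{C})$, ${}_{\mathbb{A}}\mathcal{C}$ is the category of left $A$-modules $(M,r\colon A\otimes M\to M)$ in $\mathcal{C}$ with monoidal product $(M,r)\otimes(N,s)=\bigl(M\otimes N,(r\otimes s)(\mathrm{id}_A\otimes\varsigma_M\otimes\mathrm{id}_N)(\Delta\otimes\mathrm{id}_{M\otimes N})\bigr)$ and unit $(\mathbb 1,\varepsilon)$. *)

theory Defs
  imports Main "HOL-Library.FuncSet"
begin

(* Categories are presented by hom-sets. Distinct hom-sets may overlap, so one element of 'a can be
   a morphism between several pairs of objects (this is what makes "f goes to f" literally the
   identity on morphisms of the categories built below). A category given by arrows with domain
   and codomain is the special case in which the hom-sets are disjoint. *)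

record ('o, 'a) moncat =
  Obj :: "'o set"
  Hom :: "'o \<Rightarrow> 'o \<Rightarrow> 'a set"
  Ident :: "'o \<Rightarrow> 'a"  ("\<one>\<index>")
  Comp :: "'a \<Rightarrow> 'a \<Rightarrow> 'a"  (infixr "\<cdot>\<index>" 60)
  TensorObj :: "'o \<Rightarrow> 'o \<Rightarrow> 'o"  (infixr "\<odot>\<index>" 70)
  TensorArr :: "'a \<Rightarrow> 'a \<Rightarrow> 'a"  (infixr "\<otimes>\<index>" 70)
  TensorUnit :: "'o"

record ('o, 'a) braided_moncat = "('o, 'a) moncat" +
  Braid :: "'o \<Rightarrow> 'o \<Rightarrow> 'a"  ("\<tau>\<index>")

locale strict_monoidal_category =
  fixes C :: "('o, 'a, 'z) moncat_scheme" (structure)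
  assumes ident_hom: "X \<in> Obj C \<Longrightarrow> \<one> X \<in> Hom C X X"
    and comp_hom: "\<lbrakk>X \<in> Obj C; Y \<in> Obj C; Z \<in> Obj C; f \<in> Hom C X Y; g \<in> Hom C Y Z\<rbrakk>
      \<Longrightarrow> g \<cdot> f \<in> Hom C X Z"
    and comp_ident_left: "\<lbrakk>X \<in> Obj C; Y \<in> Obj C; f \<in> Hom C X Y\<rbrakk> \<Longrightarrow> \<one> Y \<cdot> f = f"
    and comp_ident_right: "\<lbrakk>X \<in> Obj C; Y \<in> Obj C; f \<in> Hom C X Y\<rbrakk> \<Longrightarrow> f \<cdot> \<one> X = f"
    and comp_assoc: "\<lbrakk>W \<in> Obj C; X \<in> Obj C; Y \<in> Obj C; Z \<in> Obj C;
        f \<in> Hom C W X; g \<in> Hom C X Y; h \<in> Hom C Y Z\<rbrakk> \<Longrightarrow> (h \<cdot> g) \<cdot> f = h \<cdot> (g \<cdot> f)"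
    and unit_obj: "TensorUnit C \<in> Obj C"
    and tensor_obj: "\<lbrakk>X \<in> Obj C; Y \<in> Obj C\<rbrakk> \<Longrightarrow> X \<odot> Y \<in> Obj C"
    and tensor_hom: "\<lbrakk>X \<in> Obj C; Y \<in> Obj C; X' \<in> Obj C; Y' \<in> Obj C; f \<in> Hom C X Y; f' \<in> Hom C X' Y'\<rbrakk>
      \<Longrightarrow> f \<otimes> f' \<in> Hom C (X \<odot> X') (Y \<odot> Y')"
    and tensor_ident: "\<lbrakk>X \<in> Obj C; Y \<in> Obj C\<rbrakk> \<Longrightarrow> \<one> X \<otimes> \<one> Y = \<one> (X \<odot> Y)"
    and interchange: "\<lbrakk>X \<in> Obj C; Y \<in> Obj C; Z \<in> Obj C; X' \<in> Obj C; Y' \<in> Obj C; Z' \<in> Obj C;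
        f \<in> Hom C X Y; g \<in> Hom C Y Z; f' \<in> Hom C X' Y'; g' \<in> Hom C Y' Z'\<rbrakk>
      \<Longrightarrow> (g \<otimes> g') \<cdot> (f \<otimes> f') = (g \<cdot> f) \<otimes> (g' \<cdot> f')"
    and tensor_obj_assoc: "\<lbrakk>X \<in> Obj C; Y \<in> Obj C; Z \<in> Obj C\<rbrakk> \<Longrightarrow> (X \<odot> Y) \<odot> Z = X \<odot> (Y \<odot> Z)"
    and tensor_obj_unit_left: "X \<in> Obj C \<Longrightarrow> TensorUnit C \<odot> X = X"
    and tensor_obj_unit_right: "X \<in> Obj C \<Longrightarrow> X \<odot> TensorUnit C = X"
    and tensor_arr_assoc: "\<lbrakk>X \<in> Obj C; Y \<in> Obj C; Z \<in> Obj C; X' \<in> Obj C; Y' \<in> Obj C; Z' \<in> Obj C;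
        f \<in> Hom C X X'; g \<in> Hom C Y Y'; h \<in> Hom C Z Z'\<rbrakk> \<Longrightarrow> (f \<otimes> g) \<otimes> h = f \<otimes> (g \<otimes> h)"
    and tensor_arr_unit_left: "\<lbrakk>X \<in> Obj C; Y \<in> Obj C; f \<in> Hom C X Y\<rbrakk> \<Longrightarrow> \<one> (TensorUnit C) \<otimes> f = f"
    and tensor_arr_unit_right: "\<lbrakk>X \<in> Obj C; Y \<in> Obj C; f \<in> Hom C X Y\<rbrakk> \<Longrightarrow> f \<otimes> \<one> (TensorUnit C) = f"

context fixes C :: "('o, 'a, 'z) moncat_scheme" (structure)
begin

definition is_iso :: "'o \<Rightarrow> 'o \<Rightarrow> 'a \<Rightarrow> bool" where
  "is_iso X Y f \<longleftrightarrow> f \<in> Hom C X Y \<and> (\<exists>g \<in> Hom C Y X. g \<cdot> f = \<one> X \<and> f \<cdot> g = \<one> Y)"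

end

locale braided_monoidal_category = strict_monoidal_category C
  for C :: "('o, 'a, 'z) braided_moncat_scheme" (structure) +
  assumes braid_iso: "\<lbrakk>X \<in> Obj C; Y \<in> Obj C\<rbrakk> \<Longrightarrow> is_iso C (X \<odot> Y) (Y \<odot> X) (\<tau> X Y)"
    and braid_natural: "\<lbrakk>X \<in> Obj C; Y \<in> Obj C; X' \<in> Obj C; Y' \<in> Obj C; f \<in> Hom C X X'; g \<in> Hom C Y Y'\<rbrakk>
      \<Longrightarrow> (g \<otimes> f) \<cdot> \<tau> X Y = \<tau> X' Y' \<cdot> (f \<otimes> g)"
    and braid_tensor_left: "\<lbrakk>X \<in> Obj C; Y \<in> Obj C; Z \<in> Obj C\<rbrakk>
      \<Longrightarrow> \<tau> (X \<odot> Y) Z = (\<tau> X Z \<otimes> \<one> Y) \<cdot> (\<one> X \<otimes> \<tau> Y Z)"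
    and braid_tensor_right: "\<lbrakk>X \<in> Obj C; Y \<in> Obj C; Z \<in> Obj C\<rbrakk>
      \<Longrightarrow> \<tau> X (Y \<odot> Z) = (\<one> Y \<otimes> \<tau> X Z) \<cdot> (\<tau> X Y \<otimes> \<one> Z)"

(* A half braiding is a family indexed by Obj C, encoded as a function with the fixed value
   undefined outside Obj C; this makes equality of functions equality of families. *)

context fixes C :: "('o, 'a) moncat" (structure)
begin

definition half_braiding :: "'o \<Rightarrow> ('o \<Rightarrow> 'a) \<Rightarrow> bool" where
  "half_braiding M \<sigma> \<longleftrightarrow>
     \<sigma> \<in> extensional (Obj C) \<and>
     (\<forall>X\<in>Obj C. is_iso C (M \<odot> X) (X \<odot> M) (\<sigma> X)) \<and>
     (\<forall>X\<in>Obj C. \<forall>Y\<in>Obj C. \<forall>f\<in>Hom C X Y. (f \<otimes> \<one> M) \<cdot> \<sigma> X = \<sigma> Y \<cdot> (\<one> M \<otimes> f)) \<and>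
     (\<forall>X\<in>Obj C. \<forall>Y\<in>Obj C. \<sigma> (X \<odot> Y) = (\<one> X \<otimes> \<sigma> Y) \<cdot> (\<sigma> X \<otimes> \<one> Y))"

definition center :: "('o \<times> ('o \<Rightarrow> 'a), 'a) braided_moncat" where
  "center =
    \<lparr> Obj = {(M, \<sigma>). M \<in> Obj C \<and> half_braiding M \<sigma>},
      Hom = (\<lambda>(M, \<sigma>) (M', \<sigma>').
        {f \<in> Hom C M M'. \<forall>X\<in>Obj C. (\<one> X \<otimes> f) \<cdot> \<sigma> X = \<sigma>' X \<cdot> (f \<otimes> \<one> X)}),
      Ident = (\<lambda>(M, \<sigma>). \<one> M),
      Comp = Comp C,
      TensorObj = (\<lambda>(M, \<sigma>) (N, \<omega>).
        (M \<odot> N, \<lambda>X\<in>Obj C. (\<sigma> X \<otimes> \<one> N) \<cdot> (\<one> M \<otimes> \<omega> X))),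
      TensorArr = TensorArr C,
      TensorUnit = (TensorUnit C, \<lambda>X\<in>Obj C. \<one> X),
      Braid = (\<lambda>(M, \<sigma>) (N, \<omega>). \<sigma> N) \<rparr>"

end

record ('o, 'a) bialg =
  Carrier :: "'o"
  Mult :: "'a"
  Unt :: "'a"
  Comult :: "'a"
  Counit :: "'a"

context fixes B :: "('o, 'a) braided_moncat" (structure)
begin

definition bialgebra :: "('o, 'a) bialg \<Rightarrow> bool" where
  "bialgebra H \<longleftrightarrow>
     (let A = Carrier H; m = Mult H; u = Unt H; \<Delta> = Comult H; \<epsilon> = Counit H; I = TensorUnit B in
        A \<in> Obj B \<and>
        m \<in> Hom B (A \<odot> A) A \<and> u \<in> Hom B I A \<and> \<Delta> \<in> Hom B A (A \<odot> A) \<and> \<epsilon> \<in> Hom B A I \<and>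
        m \<cdot> (m \<otimes> \<one> A) = m \<cdot> (\<one> A \<otimes> m) \<and>
        m \<cdot> (u \<otimes> \<one> A) = \<one> A \<and> m \<cdot> (\<one> A \<otimes> u) = \<one> A \<and>
        (\<Delta> \<otimes> \<one> A) \<cdot> \<Delta> = (\<one> A \<otimes> \<Delta>) \<cdot> \<Delta> \<and>
        (\<epsilon> \<otimes> \<one> A) \<cdot> \<Delta> = \<one> A \<and> (\<one> A \<otimes> \<epsilon>) \<cdot> \<Delta> = \<one> A \<and>
        \<Delta> \<cdot> m = (m \<otimes> m) \<cdot> (\<one> A \<otimes> \<tau> A A \<otimes> \<one> A) \<cdot> (\<Delta> \<otimes> \<Delta>) \<and>
        \<Delta> \<cdot> u = u \<otimes> u \<and> \<epsilon> \<cdot> m = \<epsilon> \<otimes> \<epsilon> \<and> \<epsilon> \<cdot> u = \<one> I)"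

definition hopf_algebra :: "('o, 'a) bialg \<Rightarrow> bool" where
  "hopf_algebra H \<longleftrightarrow> bialgebra H \<and>
     (let A = Carrier H; m = Mult H; u = Unt H; \<Delta> = Comult H; \<epsilon> = Counit H in
        \<exists>S. is_iso B A A S \<and>
            m \<cdot> (S \<otimes> \<one> A) \<cdot> \<Delta> = u \<cdot> \<epsilon> \<and> m \<cdot> (\<one> A \<otimes> S) \<cdot> \<Delta> = u \<cdot> \<epsilon>)"

definition yetter_drinfeld_module :: "('o, 'a) bialg \<Rightarrow> 'o \<Rightarrow> 'a \<Rightarrow> 'a \<Rightarrow> bool" where
  "yetter_drinfeld_module H M r \<delta> \<longleftrightarrow>
     (let A = Carrier H; m = Mult H; u = Unt H; \<Delta> = Comult H; \<epsilon> = Counit H in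
        M \<in> Obj B \<and>
        r \<in> Hom B (A \<odot> M) M \<and> r \<cdot> (m \<otimes> \<one> M) = r \<cdot> (\<one> A \<otimes> r) \<and> r \<cdot> (u \<otimes> \<one> M) = \<one> M \<and>
        \<delta> \<in> Hom B M (A \<odot> M) \<and> (\<Delta> \<otimes> \<one> M) \<cdot> \<delta> = (\<one> A \<otimes> \<delta>) \<cdot> \<delta> \<and> (\<epsilon> \<otimes> \<one> M) \<cdot> \<delta> = \<one> M \<and>
        (m \<otimes> \<one> M) \<cdot> (\<one> A \<otimes> \<tau> M A) \<cdot> ((\<delta> \<cdot> r) \<otimes> \<one> A) \<cdot> (\<one> A \<otimes> \<tau> A M) \<cdot> (\<Delta> \<otimes> \<one> M)
          = (m \<otimes> r) \<cdot> (\<one> A \<otimes> \<tau> A A \<otimes> \<one> M) \<cdot> (\<Delta> \<otimes> \<delta>))"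

definition yetter_drinfeld :: "('o, 'a) bialg \<Rightarrow> ('o \<times> 'a \<times> 'a, 'a) braided_moncat" where
  "yetter_drinfeld H =
    (let A = Carrier H; m = Mult H; u = Unt H; \<Delta> = Comult H; \<epsilon> = Counit H in
    \<lparr> Obj = {(M, r, \<delta>). yetter_drinfeld_module H M r \<delta>},
      Hom = (\<lambda>(M, r, \<delta>) (M', r', \<delta>').
        {f \<in> Hom B M M'. f \<cdot> r = r' \<cdot> (\<one> A \<otimes> f) \<and> \<delta>' \<cdot> f = (\<one> A \<otimes> f) \<cdot> \<delta>}),
      Ident = (\<lambda>(M, r, \<delta>). \<one> M),
      Comp = Comp B,
      TensorObj = (\<lambda>(M, r, \<delta>) (M', r', \<delta>').
        (M \<odot> M',
         (r \<otimes> r') \<cdot> (\<one> A \<otimes> \<tau> A M \<otimes> \<one> M') \<cdot> (\<Delta> \<otimes> \<one> (M \<odot> M')),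
         (m \<otimes> \<one> (M \<odot> M')) \<cdot> (\<one> A \<otimes> \<tau> M A \<otimes> \<one> M') \<cdot> (\<delta> \<otimes> \<delta>'))),
      TensorArr = TensorArr B,
      TensorUnit = (TensorUnit B, \<epsilon>, u),
      Braid = (\<lambda>(M, r, \<delta>) (M', r', \<delta>'). (r' \<otimes> \<one> M) \<cdot> (\<one> A \<otimes> \<tau> M M') \<cdot> (\<delta> \<otimes> \<one> M')) \<rparr>)"

end

context fixes C :: "('o, 'a) moncat" (structure)
begin

definition module_category ::
    "('o \<times> ('o \<Rightarrow> 'a), 'a) bialg \<Rightarrow> ('o \<times> 'a, 'a) moncat" where
  "module_category H =
    (let (A, \<sigma>A) = Carrier H; m = Mult H; u = Unt H; \<Delta> = Comult H; \<epsilon> = Counit H in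
    \<lparr> Obj = {(M, r). M \<in> Obj C \<and> r \<in> Hom C (A \<odot> M) M \<and>
        r \<cdot> (m \<otimes> \<one> M) = r \<cdot> (\<one> A \<otimes> r) \<and> r \<cdot> (u \<otimes> \<one> M) = \<one> M},
      Hom = (\<lambda>(M, r) (N, s). {f \<in> Hom C M N. f \<cdot> r = s \<cdot> (\<one> A \<otimes> f)}),
      Ident = (\<lambda>(M, r). \<one> M),
      Comp = Comp C,
      TensorObj = (\<lambda>(M, r) (N, s).
        (M \<odot> N, (r \<otimes> s) \<cdot> (\<one> A \<otimes> \<sigma>A M \<otimes> \<one> N) \<cdot> (\<Delta> \<otimes> \<one> (M \<odot> N)))),
      TensorArr = TensorArr C,
      TensorUnit = (TensorUnit C, \<epsilon>) \<rparr>)"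

end

(* Because hom-sets may overlap, the action of a functor on a morphism depends on the chosen source
   and target. *)

locale braided_strict_monoidal_functor =
  source: braided_monoidal_category C + target: braided_monoidal_category D
  for C :: "('o, 'a) braided_moncat" and D :: "('p, 'b) braided_moncat" +
  fixes Fo :: "'o \<Rightarrow> 'p" and Fa :: "'o \<Rightarrow> 'o \<Rightarrow> 'a \<Rightarrow> 'b"
  assumes map_obj: "X \<in> Obj C \<Longrightarrow> Fo X \<in> Obj D"
    and map_hom: "\<lbrakk>X \<in> Obj C; Y \<in> Obj C; f \<in> Hom C X Y\<rbrakk> \<Longrightarrow> Fa X Y f \<in> Hom D (Fo X) (Fo Y)"
    and map_ident: "X \<in> Obj C \<Longrightarrow> Fa X X (\<one>\<^bsub>C\<^esub> X) = \<one>\<^bsub>D\<^esub> (Fo X)"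
    and map_comp: "\<lbrakk>X \<in> Obj C; Y \<in> Obj C; Z \<in> Obj C; f \<in> Hom C X Y; g \<in> Hom C Y Z\<rbrakk>
      \<Longrightarrow> Fa X Z (g \<cdot>\<^bsub>C\<^esub> f) = Fa Y Z g \<cdot>\<^bsub>D\<^esub> Fa X Y f"
    and map_unit: "Fo (TensorUnit C) = TensorUnit D"
    and map_tensor_obj: "\<lbrakk>X \<in> Obj C; Y \<in> Obj C\<rbrakk> \<Longrightarrow> Fo (X \<odot>\<^bsub>C\<^esub> Y) = Fo X \<odot>\<^bsub>D\<^esub> Fo Y"
    and map_tensor_arr: "\<lbrakk>X \<in> Obj C; Y \<in> Obj C; X' \<in> Obj C; Y' \<in> Obj C; f \<in> Hom C X Y; f' \<in> Hom C X' Y'\<rbrakk>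
      \<Longrightarrow> Fa (X \<odot>\<^bsub>C\<^esub> X') (Y \<odot>\<^bsub>C\<^esub> Y') (f \<otimes>\<^bsub>C\<^esub> f') = Fa X Y f \<otimes>\<^bsub>D\<^esub> Fa X' Y' f'"
    and map_braid: "\<lbrakk>X \<in> Obj C; Y \<in> Obj C\<rbrakk>
      \<Longrightarrow> Fa (X \<odot>\<^bsub>C\<^esub> Y) (Y \<odot>\<^bsub>C\<^esub> X) (\<tau>\<^bsub>C\<^esub> X Y) = \<tau>\<^bsub>D\<^esub> (Fo X) (Fo Y)"

definition braided_strict_monoidal_isomorphism ::
    "('o, 'a) braided_moncat \<Rightarrow> ('p, 'b) braided_moncat \<Rightarrow>
     ('o \<Rightarrow> 'p) \<Rightarrow> ('o \<Rightarrow> 'o \<Rightarrow> 'a \<Rightarrow> 'b) \<Rightarrow> bool" where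
  "braided_strict_monoidal_isomorphism C D Fo Fa \<longleftrightarrow>
     braided_strict_monoidal_functor C D Fo Fa \<and>
     (\<exists>Go Ga. braided_strict_monoidal_functor D C Go Ga \<and>
        (\<forall>X\<in>Obj C. Go (Fo X) = X) \<and>
        (\<forall>X\<in>Obj C. \<forall>Y\<in>Obj C. \<forall>f\<in>Hom C X Y. Ga (Fo X) (Fo Y) (Fa X Y f) = f) \<and>
        (\<forall>X\<in>Obj D. Fo (Go X) = X) \<and>
        (\<forall>X\<in>Obj D. \<forall>Y\<in>Obj D. \<forall>g\<in>Hom D X Y. Fa (Go X) (Go Y) (Ga X Y g) = g))"

end

theory Submission
  imports Defs
begin

text \<open>
  The inverse of the assignment can be written down. Let \<open>((M, r), \<gamma>)\<close> be a half braiding of the category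
  of \<open>A\<close>-modules. Every object \<open>X\<close> of \<open>C\<close> is a module through the counit, strictly monoidally, so
  \<open>\<sigma> X = \<gamma> (X, \<epsilon> \<otimes> \<one> X)\<close> is a half braiding of \<open>C\<close> on \<open>M\<close>; and \<open>\<delta> = \<gamma> (A, m) \<cdot> (\<one> M \<otimes> u)\<close> is the
  candidate for the coaction. A module \<open>(N, t)\<close> is a quotient of the free module \<open>A \<otimes> N\<close> by the module morphism
  \<open>t\<close>, and \<open>A \<otimes> N\<close> is the tensor product of the regular and a trivial module. Naturality of \<open>\<gamma>\<close> at \<open>t\<close>,
  evaluated at the unit of \<open>A\<close>, therefore gives \<open>\<gamma> (N, t) = (t \<otimes> \<one> M) \<cdot> (\<one> A \<otimes> \<sigma> N) \<cdot> (\<delta> \<otimes> \<one> N)\<close>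
  (\<open>\<gamma>_eq_yd_braid\<close>). All axioms of a Yetter--Drinfeld module are read off in the same way: coassociativity and
  counitality of \<open>\<delta>\<close> from naturality of \<open>\<gamma>\<close> at the module morphisms \<open>\<Delta>\<close> and \<open>\<epsilon>\<close>, centrality of \<open>\<delta>\<close> from
  naturality at the half braiding \<open>\<kappa> X\<close> of \<open>A\<close>, centrality of \<open>r\<close> from linearity of \<open>\<gamma>\<close> at trivial
  modules, and the compatibility of \<open>r\<close> and \<open>\<delta>\<close> from linearity of \<open>\<gamma> (A, m)\<close>.

  In the other direction, the Yetter--Drinfeld condition says exactly that the given formula for \<open>\<gamma>\<close> is linear,
  and coassociativity and centrality of \<open>\<delta>\<close> give the tensor axiom. Only the invertibility of \<open>\<gamma> (N, t)\<close> needs the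
  antipode: up to the isomorphism \<open>\<sigma> N\<close> it is the map that coacts on \<open>M\<close> and lets the coefficient act on
  \<open>N\<close> through \<open>t \<cdot> (\<kappa> N)\<^sup>-\<^sup>1\<close>, which is an action of the algebra with the opposite multiplication
  \<open>m \<cdot> (\<kappa> A)\<^sup>-\<^sup>1\<close>. Its inverse inserts the antipode of that opposite bialgebra, which is \<open>S\<^sup>-\<^sup>1\<close>
  (\<open>opposite_antipode\<close>), because \<open>S\<close> is anti-multiplicative for the braiding (\<open>antipode_mult\<close>).

  The assignment is thus bijective on objects, it does not change the underlying morphisms, and the two conditions
  on a morphism match (\<open>hom_to_center\<close>). The monoidal structure of Yetter--Drinfeld modules is the one of the
  center transported along this bijection; hence the axioms of a braided monoidal category hold on the side of
  Yetter--Drinfeld modules because they hold in the center (\<open>braided_isomorphism_transport\<close>), and they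
  are not verified separately.

  All identities between composites of tensor products are proved by a calculus of string diagrams. A diagram is a
  list of layers acting on a word of objects, a layer being a morphism applied at a position of the word;
  diagrams are rewritten by the simplifier.
\<close>

section \<open>String diagrams in a strict monoidal category\<close>

text \<open>Positions in words are numerals; the simplification rules below keep them in the normal form
  \<open>0, 1, 2, \<dots>\<close>, with sums \<open>n + 1\<close> and \<open>n + 2\<close> for a variable \<open>n\<close>, so that rules match syntactically.\<close>

declare One_nat_def [simp del] add_2_eq_Suc [simp del] add_2_eq_Suc' [simp del]
lemma Suc_0_one [simp]: "Suc 0 = 1" by simp
lemma take_1 [simp]: "take 1 (x # xs) = [x]" by (simp add: One_nat_def del: Suc_0_one)
lemma drop_1 [simp]: "drop 1 (x # xs) = xs" by (simp add: One_nat_def del: Suc_0_one)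

text \<open>A layer \<open>(n, s, f, t)\<close> replaces the subword \<open>s\<close> at position \<open>n\<close> by \<open>t\<close>, using a morphism \<open>f\<close>. A state
  \<open>(S, V, h)\<close> is a partially evaluated diagram: a morphism \<open>h\<close> from the product of the source word \<open>S\<close> to the
  product of the current word \<open>V\<close>. \<open>None\<close> is an ill-typed diagram. Since layers are functions on states, a
  composite of layers needs no associativity law.\<close>

type_synonym ('o, 'a) layer = "nat \<times> 'o list \<times> 'a \<times> 'o list"
type_synonym ('o, 'a) state = "('o list \<times> 'o list \<times> 'a) option"

context strict_monoidal_category
begin

fun ob :: "'o list \<Rightarrow> 'o" where
  "ob [] = TensorUnit C"
| "ob [X] = X"
| "ob (X # Y # Zs) = X \<odot> ob (Y # Zs)"

lemma ob_obj [simp]: "set W \<subseteq> Obj C \<Longrightarrow> ob W \<in> Obj C"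
  by (induction W rule: ob.induct) (auto intro: unit_obj tensor_obj)

lemma ob_Cons: "X \<in> Obj C \<Longrightarrow> ob (X # W) = X \<odot> ob W"
  by (cases W) (auto simp: tensor_obj_unit_right)

lemma ob_append: "set V \<subseteq> Obj C \<Longrightarrow> set W \<subseteq> Obj C \<Longrightarrow> ob (V @ W) = ob V \<odot> ob W"
  by (induction V) (simp_all add: tensor_obj_unit_left ob_Cons tensor_obj_assoc)

definition cell :: "'o list \<times> 'a \<times> 'o list \<Rightarrow> bool" where
  "cell = (\<lambda>(s, f, t). set s \<subseteq> Obj C \<and> set t \<subseteq> Obj C \<and> f \<in> Hom C (ob s) (ob t))"

lemma cell_iff: "cell (s, f, t) \<longleftrightarrow> set s \<subseteq> Obj C \<and> set t \<subseteq> Obj C \<and> f \<in> Hom C (ob s) (ob t)"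
  by (simp add: cell_def)

text \<open>Empty contexts are dropped, so that an evaluated diagram has literally the form in which such a composite is
  written by hand.\<close>

definition whisker :: "'o list \<Rightarrow> 'a \<Rightarrow> 'o list \<Rightarrow> 'a" where
  "whisker L f R = (let g = (if R = [] then f else f \<otimes> \<one> (ob R)) in if L = [] then g else \<one> (ob L) \<otimes> g)"

lemma whisker_simps [simp]:
  "whisker [] f [] = f" 
  "whisker [] f (Y # R) = f \<otimes> \<one> (ob (Y # R))"
  "whisker (X # L) f [] = \<one> (ob (X # L)) \<otimes> f"
  "whisker (X # L) f (Y # R) = \<one> (ob (X # L)) \<otimes> f \<otimes> \<one> (ob (Y # R))"
  by (simp_all add: whisker_def)

lemma whisker_Nil_left:
  assumes "f \<in> Hom C X Y" "X \<in> Obj C" "Y \<in> Obj C"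
  shows "whisker [] f R = f \<otimes> \<one> (ob R)"
  using tensor_arr_unit_right[OF assms(2,3,1)] by (auto simp: whisker_def)

lemma whisker_Nil_right:
  assumes "f \<in> Hom C X Y" "X \<in> Obj C" "Y \<in> Obj C"
  shows "whisker L f [] = \<one> (ob L) \<otimes> f"
  using tensor_arr_unit_left[OF assms(2,3,1)] by (auto simp: whisker_def)

lemma whisker_eq:
  assumes "f \<in> Hom C X Y" "X \<in> Obj C" "Y \<in> Obj C" "set L \<subseteq> Obj C" "set R \<subseteq> Obj C"
  shows "whisker L f R = \<one> (ob L) \<otimes> f \<otimes> \<one> (ob R)"
proof -
  have g: "(if R = [] then f else f \<otimes> \<one> (ob R)) = f \<otimes> \<one> (ob R)"
    using tensor_arr_unit_right[OF assms(2,3,1)] by auto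
  have "f \<otimes> \<one> (ob R) \<in> Hom C (X \<odot> ob R) (Y \<odot> ob R)"
    using assms by (intro tensor_hom ident_hom) auto
  then show ?thesis
    unfolding whisker_def g Let_def
    using assms tensor_arr_unit_left[of "X \<odot> ob R" "Y \<odot> ob R"] by (auto simp: tensor_obj)
qed

lemma whisker_hom:
  assumes "cell (s, f, t)" "set L \<subseteq> Obj C" "set R \<subseteq> Obj C"
  shows "whisker L f R \<in> Hom C (ob (L @ s @ R)) (ob (L @ t @ R))"
proof -
  have "whisker L f R = \<one> (ob L) \<otimes> f \<otimes> \<one> (ob R)"
    by (rule whisker_eq) (use assms in \<open>auto simp: cell_iff\<close>)
  moreover have "\<one> (ob L) \<otimes> f \<otimes> \<one> (ob R) \<in> Hom C (ob L \<odot> (ob s \<odot> ob R)) (ob L \<odot> (ob t \<odot> ob R))"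
    using assms by (intro tensor_hom ident_hom tensor_obj) (auto simp: cell_iff)
  ultimately show ?thesis
    using assms by (simp add: ob_append cell_iff)
qed

lemma whisker_cell:
  assumes "cell (s, f, t)" "set L \<subseteq> Obj C" "set R \<subseteq> Obj C"
  shows "cell (L @ s @ R, whisker L f R, L @ t @ R)"
  using whisker_hom[OF assms] assms by (simp add: cell_iff)

lemma cell_assoc:
  "cell (s, f, t) \<Longrightarrow> cell (t, g, w) \<Longrightarrow> cell (w, h, v) \<Longrightarrow> (h \<cdot> g) \<cdot> f = h \<cdot> g \<cdot> f"
  using comp_assoc[of "ob s" "ob t" "ob w" "ob v" f g h] by (simp add: cell_iff)

lemma whisker_ident:
  assumes "set L \<subseteq> Obj C" "set s \<subseteq> Obj C" "set R \<subseteq> Obj C"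
  shows "whisker L (\<one> (ob s)) R = \<one> (ob (L @ s @ R))"
  using assms by (simp add: whisker_eq[OF ident_hom] tensor_ident ob_append tensor_obj)

lemma whisker_comp:
  assumes "cell (s, f, t)" "cell (t, g, w)" "set L \<subseteq> Obj C" "set R \<subseteq> Obj C"
  shows "whisker L (g \<cdot> f) R = whisker L g R \<cdot> whisker L f R"
proof -
  let ?l = "ob L" and ?r = "ob R" and ?s = "ob s" and ?t = "ob t" and ?w = "ob w"
  have o: "?l \<in> Obj C" "?r \<in> Obj C" "?s \<in> Obj C" "?t \<in> Obj C" "?w \<in> Obj C" 
    and f: "f \<in> Hom C ?s ?t" and g: "g \<in> Hom C ?t ?w"
    using assms by (auto simp: cell_iff)
  have gf: "g \<cdot> f \<in> Hom C ?s ?w" using o f g by (metis comp_hom)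
  have f': "f \<otimes> \<one> ?r \<in> Hom C (?s \<odot> ?r) (?t \<odot> ?r)" and g': "g \<otimes> \<one> ?r \<in> Hom C (?t \<odot> ?r) (?w \<odot> ?r)"
    using o f g by (auto intro!: tensor_hom ident_hom)
  have "whisker L g R \<cdot> whisker L f R = (\<one> ?l \<cdot> \<one> ?l) \<otimes> ((g \<otimes> \<one> ?r) \<cdot> (f \<otimes> \<one> ?r))"
    using interchange[OF o(1) o(1) o(1) _ _ _ ident_hom[OF o(1)] ident_hom[OF o(1)] f' g'] o assms
    by (simp add: whisker_eq[OF f] whisker_eq[OF g] tensor_obj)
  also have "(g \<otimes> \<one> ?r) \<cdot> (f \<otimes> \<one> ?r) = (g \<cdot> f) \<otimes> (\<one> ?r \<cdot> \<one> ?r)"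
    using interchange[OF o(3,4,5) o(2) o(2) o(2) f g ident_hom[OF o(2)] ident_hom[OF o(2)]] .
  finally show ?thesis
    using o assms by (simp add: whisker_eq[OF gf] comp_ident_left[OF _ _ ident_hom])
qed

lemma whisker_whisker:
  assumes "cell (s, f, t)" "set L \<subseteq> Obj C" "set R \<subseteq> Obj C" "set L' \<subseteq> Obj C" "set R' \<subseteq> Obj C"
  shows "whisker L' (whisker L f R) R' = whisker (L' @ L) f (R @ R')"
proof -
  have o: "ob L \<in> Obj C" "ob R \<in> Obj C" "ob L' \<in> Obj C" "ob R' \<in> Obj C" "ob s \<in> Obj C" "ob t \<in> Obj C"
    and f: "f \<in> Hom C (ob s) (ob t)"
    using assms by (auto simp: cell_iff)
  note i = ident_hom[OF o(1)] ident_hom[OF o(2)] ident_hom[OF o(3)] ident_hom[OF o(4)]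
  have fr: "f \<otimes> \<one> (ob R) \<in> Hom C (ob s \<odot> ob R) (ob t \<odot> ob R)"
    using o f i by (auto intro!: tensor_hom)
  have frr: "(f \<otimes> \<one> (ob R)) \<otimes> \<one> (ob R') \<in> Hom C ((ob s \<odot> ob R) \<odot> ob R') ((ob t \<odot> ob R) \<odot> ob R')"
    using o fr i by (auto intro!: tensor_hom tensor_obj)
  have "whisker L' (whisker L f R) R' = \<one> (ob L') \<otimes> (\<one> (ob L) \<otimes> f \<otimes> \<one> (ob R)) \<otimes> \<one> (ob R')"
    using whisker_eq[OF whisker_hom[OF assms(1-3)], of L' R'] whisker_eq[OF f _ _ assms(2,3)] assms o
    by (simp add: cell_iff)
  also have "(\<one> (ob L) \<otimes> f \<otimes> \<one> (ob R)) \<otimes> \<one> (ob R') = \<one> (ob L) \<otimes> ((f \<otimes> \<one> (ob R)) \<otimes> \<one> (ob R'))"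
    using tensor_arr_assoc[OF _ _ _ _ _ _ i(1) fr i(4)] o by (simp add: tensor_obj)
  also have "\<one> (ob L') \<otimes> \<dots> = (\<one> (ob L') \<otimes> \<one> (ob L)) \<otimes> ((f \<otimes> \<one> (ob R)) \<otimes> \<one> (ob R'))"
    using tensor_arr_assoc[OF _ _ _ _ _ _ i(3) i(1) frr] o by (simp add: tensor_obj)
  also have "(f \<otimes> \<one> (ob R)) \<otimes> \<one> (ob R') = f \<otimes> (\<one> (ob R) \<otimes> \<one> (ob R'))"
    using tensor_arr_assoc[OF _ _ _ _ _ _ f i(2) i(4)] o by (simp add: tensor_obj)
  finally show ?thesis
    using o assms by (simp add: whisker_eq[OF f] tensor_ident ob_append)
qed

text \<open>Both sides are \<open>L\<close> tensored with the same square, namely the interchange law for \<open>f\<close> and the whiskered \<open>g\<close>.\<close>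

lemma whisker_interchange:
  assumes f: "cell (s, f, t)" and g: "cell (s', g, t')"
    and w: "set L \<subseteq> Obj C" "set K \<subseteq> Obj C" "set R \<subseteq> Obj C"
  shows "whisker (L @ t @ K) g R \<cdot> whisker L f (K @ s' @ R) = whisker L f (K @ t' @ R) \<cdot> whisker (L @ s @ K) g R"
proof -
  let ?g = "whisker K g R" and ?S' = "ob (K @ s' @ R)" and ?T' = "ob (K @ t' @ R)"
  have ws: "set s \<subseteq> Obj C" "set t \<subseteq> Obj C" "set s' \<subseteq> Obj C" "set t' \<subseteq> Obj C"
    using f g by (auto simp: cell_iff)
  have fh: "f \<in> Hom C (ob s) (ob t)" using f by (simp add: cell_iff)
  have gh: "?g \<in> Hom C ?S' ?T'" using whisker_hom[OF g w(2,3)] .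
  have o: "ob s \<in> Obj C" "ob t \<in> Obj C" "?S' \<in> Obj C" "?T' \<in> Obj C" using ws w by auto
  have gc: "cell (K @ s' @ R, ?g, K @ t' @ R)"
    using gh ws w by (simp add: cell_iff)
  have fc: "cell (s @ K @ s' @ R, f \<otimes> \<one> ?S', t @ K @ s' @ R)" "cell (s @ K @ t' @ R, f \<otimes> \<one> ?T', t @ K @ t' @ R)"
    using fh ws w o by (auto simp: cell_iff ob_append intro!: tensor_hom ident_hom tensor_obj)
  have gc': "cell (s @ K @ s' @ R, \<one> (ob s) \<otimes> ?g, s @ K @ t' @ R)" "cell (t @ K @ s' @ R, \<one> (ob t) \<otimes> ?g, t @ K @ t' @ R)"
    using gh ws w o by (auto simp: cell_iff ob_append tensor_obj intro!: tensor_hom ident_hom tensor_obj)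
  have fp: "whisker [] f (K @ s' @ R) = f \<otimes> \<one> ?S'" "whisker [] f (K @ t' @ R) = f \<otimes> \<one> ?T'"
    by (rule whisker_Nil_left[OF fh o(1,2)])+
  have gp: "whisker s ?g [] = \<one> (ob s) \<otimes> ?g" "whisker t ?g [] = \<one> (ob t) \<otimes> ?g"
    by (rule whisker_Nil_right[OF gh o(3,4)])+
  have sq: "(\<one> (ob t) \<otimes> ?g) \<cdot> (f \<otimes> \<one> ?S') = (f \<otimes> \<one> ?T') \<cdot> (\<one> (ob s) \<otimes> ?g)"
    using interchange[OF o(1,2,2) o(3,3,4) fh ident_hom[OF o(2)] ident_hom[OF o(3)] gh]
      interchange[OF o(1,1,2) o(3,4,4) ident_hom[OF o(1)] fh gh ident_hom[OF o(4)]]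
    by (simp add: comp_ident_left[OF o(1,2) fh] comp_ident_right[OF o(1,2) fh]
        comp_ident_left[OF o(3,4) gh] comp_ident_right[OF o(3,4) gh])
  have "whisker (L @ t @ K) g R \<cdot> whisker L f (K @ s' @ R)
      = whisker L (whisker t ?g []) [] \<cdot> whisker L (whisker [] f (K @ s' @ R)) []"
    using whisker_whisker[OF g w(2,3) ws(2), of "[]"] whisker_whisker[OF g, of "t @ K" R L "[]"]
      whisker_whisker[OF f, of "[]" "K @ s' @ R" L "[]"] w ws by simp
  also have "\<dots> = whisker L ((\<one> (ob t) \<otimes> ?g) \<cdot> (f \<otimes> \<one> ?S')) []"
    unfolding fp gp by (rule whisker_comp[OF fc(1) gc'(2), symmetric]) (use w in auto)
  also have "\<dots> = whisker L (whisker [] f (K @ t' @ R)) [] \<cdot> whisker L (whisker s ?g []) []"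
    unfolding sq fp gp by (rule whisker_comp[OF gc'(1) fc(2)]) (use w in auto)
  also have "\<dots> = whisker L f (K @ t' @ R) \<cdot> whisker (L @ s @ K) g R"
    using whisker_whisker[OF g w(2,3) ws(1), of "[]"] whisker_whisker[OF g, of "s @ K" R L "[]"]
      whisker_whisker[OF f, of "[]" "K @ t' @ R" L "[]"] w ws by simp
  finally show ?thesis .
qed

text \<open>The typing of diagrams: the effect of a layer on the current word, computed independently of the morphisms.\<close>

fun step :: "('o, 'a) layer \<Rightarrow> 'o list \<Rightarrow> 'o list option" where
  "step (n, s, f, t) V = (if cell (s, f, t) \<and> n \<le> length V \<and> take (length s) (drop n V) = s
     then Some (take n V @ t @ drop (n + length s) V) else None)"

lemma step_SomeE:
  assumes "step (n, s, f, t) V = Some V'"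
  obtains L R where "cell (s, f, t)" "V = L @ s @ R" "length L = n" "V' = L @ t @ R"
proof
  have c: "cell (s, f, t)" "n \<le> length V" "take (length s) (drop n V) = s"
    "V' = take n V @ t @ drop (n + length s) V"
    using assms by (auto split: if_splits)
  show "cell (s, f, t)" "length (take n V) = n" using c by auto
  show "V = take n V @ s @ drop (n + length s) V"
    using append_take_drop_id[of n V] append_take_drop_id[of "length s" "drop n V"] c(3)
    by (simp add: add.commute)
  show "V' = take n V @ t @ drop (n + length s) V" using c by simp
qed

fun layer :: "('o, 'a) layer \<Rightarrow> 'o list \<Rightarrow> 'a" where
  "layer (n, s, f, t) V = whisker (take n V) f (drop (n + length s) V)"

definition word :: "('o, 'a) state \<Rightarrow> 'o list option" where
  "word x = Option.bind x (\<lambda>(S, V, h). if cell (S, h, V) then Some V else None)"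

text \<open>All typing conditions are tested here, so that later rules do not have to assume them.\<close>

definition act :: "('o, 'a) layer \<Rightarrow> ('o, 'a) state \<Rightarrow> ('o, 'a) state"  (infixr "\<bullet>" 65) where
  "l \<bullet> x = Option.bind (word x) (\<lambda>V. Option.bind (step l V)
     (\<lambda>V'. Some (fst (the x), V', layer l V \<cdot> snd (snd (the x)))))"

definition init :: "'o list \<Rightarrow> ('o, 'a) state" where
  "init W = Some (W, W, \<one> (ob W))"

text \<open>The side condition of most rewriting rules. For a concrete diagram it is computed by the simplifier from
  \<open>word\<close>.\<close>

definition has :: "nat \<Rightarrow> 'o list \<Rightarrow> ('o, 'a) state \<Rightarrow> bool" where
  "has n s x = (case word x of None \<Rightarrow> False | Some V \<Rightarrow> n \<le> length V \<and> take (length s) (drop n V) = s)"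

lemma word_SomeE:
  assumes "word x = Some V"
  obtains S h where "x = Some (S, V, h)" "cell (S, h, V)"
  using assms by (auto simp: word_def bind_eq_Some_conv split: if_splits)

lemma act_append:
  assumes "cell (S, h, L @ s @ R)" "cell (s, f, t)" "length L = n"
  shows "(n, s, f, t) \<bullet> Some (S, L @ s @ R, h) = Some (S, L @ t @ R, whisker L f R \<cdot> h)"
    and "cell (S, whisker L f R \<cdot> h, L @ t @ R)"
proof -
  show "(n, s, f, t) \<bullet> Some (S, L @ s @ R, h) = Some (S, L @ t @ R, whisker L f R \<cdot> h)"
    using assms unfolding act_def word_def by auto
  have "whisker L f R \<cdot> h \<in> Hom C (ob S) (ob (L @ t @ R))"
    using comp_hom[OF _ _ _ _ whisker_hom[OF assms(2), of L R]] assms by (auto simp: cell_iff)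
  then show "cell (S, whisker L f R \<cdot> h, L @ t @ R)"
    using assms by (simp add: cell_iff)
qed

lemma act_None: "word x = None \<Longrightarrow> l \<bullet> x = None"
  by (simp add: act_def)

lemma word_None [simp]: "word None = None"
  by (simp add: word_def)

lemma word_act [simp]: "word (l \<bullet> x) = Option.bind (word x) (step l)"
proof (cases "word x")
  case None
  then show ?thesis by (simp add: act_None)
next
  case (Some V)
  then obtain S h where x: "x = Some (S, V, h)" "cell (S, h, V)" by (rule word_SomeE)
  obtain n s f t where l: "l = (n, s, f, t)" by (cases l)
  show ?thesis
  proof (cases "step l V")
    case None
    then show ?thesis using Some by (simp add: act_def)
  next
    case (Some V')
    from this[unfolded l] obtain L R where LR: "cell (s, f, t)" "V = L @ s @ R" "length L = n" "V' = L @ t @ R"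
      by (rule step_SomeE)
    show ?thesis
      using act_append[of S h L s R f t n] x LR \<open>word x = Some V\<close>
      unfolding l by (simp add: word_def)
  qed
qed

lemma word_init [simp]: "set W \<subseteq> Obj C \<Longrightarrow> word (init W) = Some W"
  by (simp add: word_def init_def cell_iff ident_hom)

lemma has_SomeE:
  assumes "has n s x"
  obtains S L R h where "x = Some (S, L @ s @ R, h)" "cell (S, h, L @ s @ R)" "length L = n"
proof -
  obtain V where V: "word x = Some V" "n \<le> length V" "take (length s) (drop n V) = s"
    using assms by (auto simp: has_def split: option.splits)
  have "V = take n V @ s @ drop (n + length s) V"
    using append_take_drop_id[of n V] append_take_drop_id[of "length s" "drop n V"] V(3)
    by (simp add: add.commute)
  moreover have "length (take n V) = n" using V(2) by simp
  moreover obtain S h where "x = Some (S, V, h)" "cell (S, h, V)" by (rule word_SomeE[OF V(1)])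
  ultimately show ?thesis using that[of S "take n V" "drop (n + length s) V" h] by simp
qed

lemma has_append: "cell (S, h, L @ s @ R) \<Longrightarrow> length L = n \<Longrightarrow> has n s (Some (S, L @ s @ R, h))"
  by (auto simp: has_def word_def)

lemma act_not_has: "\<not> has n s x \<Longrightarrow> (n, s, f, t) \<bullet> x = None"
  by (auto simp: act_def has_def split: option.splits if_splits)

lemma act_not_cell: "\<not> cell (s, f, t) \<Longrightarrow> (n, s, f, t) \<bullet> x = None"
  by (cases "word x") (auto simp: act_def)

lemma act_NoneD: "(n, s, f, t) \<bullet> None = None"
  by (simp add: act_None)

text \<open>Layers at disjoint positions commute. As a rewriting rule this moves the layer on the right to an earlier
  time; the case of ill-typed diagrams has to be treated because the rule has no typing assumption.\<close>

lemma slide_right_in: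
  assumes k: "n + length t \<le> k"
  shows "(k, s', g, t') \<bullet> (n, s, f, t) \<bullet> x = (n, s, f, t) \<bullet> (k + length s - length t, s', g, t') \<bullet> x"
proof (cases "cell (s, f, t) \<and> cell (s', g, t')")
  case False
  then show ?thesis by (auto simp: act_not_cell act_NoneD)
next
  case True
  then have c: "cell (s, f, t)" "cell (s', g, t')" by auto
  let ?k = "k + length s - length t"
  define d where "d = k - n - length t"
  have kd: "k = n + length t + d" using k by (simp add: d_def)
  have kd': "?k = n + length s + d" by (simp add: kd)
  show ?thesis
  proof (cases "has n s x \<and> has ?k s' x")
    case True
    then obtain S L R h where x: "x = Some (S, L @ s @ R, h)" and h: "cell (S, h, L @ s @ R)" and L: "length L = n"
      by (elim conjE has_SomeE)
    from True have "has ?k s' x" ..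
    then obtain L' R' where LR: "L @ s @ R = L' @ s' @ R'" and L': "length L' = ?k"
      unfolding x by (elim has_SomeE) auto
    define K where "K = drop (n + length s) L'"
    have "L @ s = take (n + length s) (L' @ s' @ R')"
      using arg_cong[OF LR, of "take (n + length s)"] L by simp
    then have "L @ s = take (n + length s) L'"
      using L' kd' by simp
    then have "L' = (L @ s) @ K"
      unfolding K_def by (metis append_take_drop_id)
    then have K: "L' = L @ s @ K" by simp
    have R: "R = K @ s' @ R'" using LR unfolding K by simp
    have Kd: "length K = d" using L' L unfolding K kd' by simp
    have o: "set L \<subseteq> Obj C" "set K \<subseteq> Obj C" "set R' \<subseteq> Obj C" "set s \<subseteq> Obj C" "set t \<subseteq> Obj C" "set s' \<subseteq> Obj C" "set t' \<subseteq> Obj C" "set S \<subseteq> Obj C"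
      and hh: "h \<in> Hom C (ob S) (ob (L @ s @ K @ s' @ R'))"
      using h c unfolding R by (auto simp: cell_iff)
    have 1: "(n, s, f, t) \<bullet> x = Some (S, (L @ t @ K) @ s' @ R', whisker L f (K @ s' @ R') \<cdot> h)"
      and c1: "cell (S, whisker L f (K @ s' @ R') \<cdot> h, (L @ t @ K) @ s' @ R')"
      using act_append[of S h L s R f t n] h c L x unfolding R by auto
    have 2: "(?k, s', g, t') \<bullet> x = Some (S, L @ s @ (K @ t' @ R'), whisker (L @ s @ K) g R' \<cdot> h)"
      and c2: "cell (S, whisker (L @ s @ K) g R' \<cdot> h, L @ s @ (K @ t' @ R'))"
      using act_append[of S h "L @ s @ K" s' R' g t' ?k] h c L x kd' Kd unfolding R by auto
    have 3: "(k, s', g, t') \<bullet> (n, s, f, t) \<bullet> x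
        = Some (S, (L @ t @ K) @ t' @ R', whisker (L @ t @ K) g R' \<cdot> (whisker L f (K @ s' @ R') \<cdot> h))"
      unfolding 1 by (rule act_append[OF c1 c(2)]) (simp add: L Kd kd)
    have 4: "(n, s, f, t) \<bullet> (?k, s', g, t') \<bullet> x
        = Some (S, L @ t @ (K @ t' @ R'), whisker L f (K @ t' @ R') \<cdot> (whisker (L @ s @ K) g R' \<cdot> h))"
      unfolding 2 by (rule act_append[OF c2 c(1)]) (simp add: L)
    have "whisker (L @ t @ K) g R' \<cdot> (whisker L f (K @ s' @ R') \<cdot> h)
        = (whisker (L @ t @ K) g R' \<cdot> whisker L f (K @ s' @ R')) \<cdot> h"
      using cell_assoc[of S h "L @ s @ K @ s' @ R'"] h R whisker_cell[OF c(1), of L "K @ s' @ R'"]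
        whisker_cell[OF c(2), of "L @ t @ K" R'] o by simp
    also have "\<dots> = (whisker L f (K @ t' @ R') \<cdot> whisker (L @ s @ K) g R') \<cdot> h"
      using whisker_interchange[OF c o(1-3)] by simp
    also have "\<dots> = whisker L f (K @ t' @ R') \<cdot> (whisker (L @ s @ K) g R' \<cdot> h)"
      using cell_assoc[of S h "L @ s @ K @ s' @ R'"] h R whisker_cell[OF c(1), of L "K @ t' @ R'"]
        whisker_cell[OF c(2), of "L @ s @ K" R'] o by simp
    finally show ?thesis using 3 4 by simp
  next
    case False
    have l: "(k, s', g, t') \<bullet> (n, s, f, t) \<bullet> x = None"
    proof (cases "has n s x")
      case True
      then obtain S L R h where x: "x = Some (S, L @ s @ R, h)" and h: "cell (S, h, L @ s @ R)" and L: "length L = n"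
        by (elim has_SomeE)
      have nh: "\<not> has ?k s' x" using False True by simp
      have "\<not> has k s' ((n, s, f, t) \<bullet> x)"
      proof
        assume "has k s' ((n, s, f, t) \<bullet> x)"
        then have "k \<le> length (L @ t @ R) \<and> take (length s') (drop k (L @ t @ R)) = s'"
          unfolding x act_append(1)[OF h c(1) L] has_def word_def using act_append(2)[OF h c(1) L] by simp
        then have "d \<le> length R" "take (length s') (drop d R) = s'"
          unfolding kd L[symmetric] by (simp_all add: add.assoc)
        then have "has ?k s' x"
          unfolding x has_def word_def kd' L[symmetric] using h by simp
        then show False using nh by simp
      qed
      then show ?thesis by (rule act_not_has)
    qed (simp add: act_not_has act_NoneD)
    have r: "(n, s, f, t) \<bullet> (?k, s', g, t') \<bullet> x = None"
    proof (cases "has ?k s' x")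
      case True
      then obtain S L R h where x: "x = Some (S, L @ s' @ R, h)" and h: "cell (S, h, L @ s' @ R)" and L: "length L = ?k"
        by (elim has_SomeE)
      have nh: "\<not> has n s x" using False True by simp
      have tk: "take (length s) (drop n (L @ Z)) = take (length s) (drop n L)" for Z
        using L kd' by simp
      have "\<not> has n s ((?k, s', g, t') \<bullet> x)"
        using nh unfolding x act_append(1)[OF h c(2) L] has_def word_def
        using act_append(2)[OF h c(2) L] h tk L kd' by auto
      then show ?thesis by (rule act_not_has)
    qed (simp add: act_not_has act_NoneD)
    show ?thesis using l r by simp
  qed
qed

text \<open>The converse orientation. Together with the previous rule the simplifier would loop, so that each proof
  chooses one of them, or first one and then the other.\<close>

lemma slide_right_out:
  assumes "n + length s \<le> k"
  shows "(n, s, f, t) \<bullet> (k, s', g, t') \<bullet> x = (k + length t - length s, s', g, t') \<bullet> (n, s, f, t) \<bullet> x"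
  using slide_right_in[of n t "k + length t - length s" s' g t' s f x] assms by simp

text \<open>Lists of layers are written as composites, the last layer first. \<open>final\<close> is the target word, \<open>expr\<close> the
  morphism described by the diagram, and \<open>run n\<close> the action of the diagram shifted by \<open>n\<close> positions.\<close>

fun final :: "'o list \<Rightarrow> ('o, 'a) layer list \<Rightarrow> 'o list option" where
  "final W [] = (if set W \<subseteq> Obj C then Some W else None)"
| "final W (l # ds) = Option.bind (final W ds) (step l)"

fun expr :: "'o list \<Rightarrow> ('o, 'a) layer list \<Rightarrow> 'a" where
  "expr W [] = \<one> (ob W)"
| "expr W [l] = layer l W"
| "expr W (l # l' # ds) = layer l (the (final W (l' # ds))) \<cdot> expr W (l' # ds)"

fun run :: "nat \<Rightarrow> ('o, 'a) layer list \<Rightarrow> ('o, 'a) state \<Rightarrow> ('o, 'a) state" where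
  "run n [] x = x"
| "run n ((k, c) # ds) x = (n + k, c) \<bullet> run n ds x"

lemma expr_cell: "final W ds = Some V \<Longrightarrow> cell (W, expr W ds, V)"
proof (induction W ds arbitrary: V rule: expr.induct)
  case (1 W)
  then show ?case by (auto simp: cell_iff ident_hom split: if_splits)
next
  case (2 W l)
  obtain n s f t where l: "l = (n, s, f, t)" by (cases l)
  from 2 have W: "set W \<subseteq> Obj C" "step l W = Some V" by (auto split: if_splits)
  from W(2)[unfolded l] obtain L R where "cell (s, f, t)" "W = L @ s @ R" "length L = n" "V = L @ t @ R"
    by (rule step_SomeE)
  then show ?case
    using W(1) whisker_hom[of s f t L R] unfolding l by (simp add: cell_iff)
next
  case (3 W l l' ds)
  obtain n s f t where l: "l = (n, s, f, t)" by (cases l)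
  from 3 obtain V' where V': "final W (l' # ds) = Some V'" "step l V' = Some V"
    unfolding final.simps(2)[of W l] bind_eq_Some_conv by blast
  have c: "cell (W, expr W (l' # ds), V')" by (rule 3) (use V' in auto)
  from V'(2)[unfolded l] obtain L R where "cell (s, f, t)" "V' = L @ s @ R" "length L = n" "V = L @ t @ R"
    by (rule step_SomeE)
  then show ?case
    using act_append(2)[of W "expr W (l' # ds)" L s R f t] c unfolding l by (simp add: V'(1) del: final.simps)
qed

text \<open>A diagram evaluated inside a larger word is its own value, whiskered. This is what makes an equation of
  morphisms applicable at every position of every diagram.\<close>

lemma run_append:
  assumes "final W ds = Some V" "cell (S, h, L @ W @ R)" "length L = n"
  shows "run n ds (Some (S, L @ W @ R, h)) = Some (S, L @ V @ R, whisker L (expr W ds) R \<cdot> h)"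
  using assms(1,2)
proof (induction W ds arbitrary: V rule: expr.induct)
  case (1 W)
  have "set L \<subseteq> Obj C" "set R \<subseteq> Obj C" "set W \<subseteq> Obj C" "set S \<subseteq> Obj C" and h: "h \<in> Hom C (ob S) (ob (L @ W @ R))"
    using 1(2) by (simp_all add: cell_iff)
  then show ?case
    using 1(1) comp_ident_left[OF _ _ h] by (simp add: whisker_ident split: if_splits)
next
  case (2 W l)
  obtain k s f t where l: "l = (k, s, f, t)" by (cases l)
  from 2(1) have W: "set W \<subseteq> Obj C" "step l W = Some V" by (auto split: if_splits)
  from W(2)[unfolded l] obtain L' R' where c: "cell (s, f, t)" and WV: "W = L' @ s @ R'" "length L' = k" "V = L' @ t @ R'"
    by (rule step_SomeE)
  have o: "set L \<subseteq> Obj C" "set R \<subseteq> Obj C" "set L' \<subseteq> Obj C" "set R' \<subseteq> Obj C"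
    using 2(2) WV by (auto simp: cell_iff)
  show ?case
    using act_append(1)[of S h "L @ L'" s "R' @ R" f t "n + k"] 2(2) assms(3) whisker_whisker[OF c o(3,4,1,2)] c WV
    unfolding l by simp
next
  case (3 W l l' ds)
  obtain k s f t where l: "l = (k, s, f, t)" by (cases l)
  from 3(2) obtain V' where V': "final W (l' # ds) = Some V'" "step l V' = Some V"
    unfolding final.simps(2)[of W l] bind_eq_Some_conv by blast
  let ?e = "expr W (l' # ds)"
  have e: "cell (W, ?e, V')" by (rule expr_cell[OF V'(1)])
  have IH: "run n (l' # ds) (Some (S, L @ W @ R, h)) = Some (S, L @ V' @ R, whisker L ?e R \<cdot> h)"
    by (rule 3(1)) (use V' 3(3) in auto)
  from V'(2)[unfolded l] obtain L' R' where c: "cell (s, f, t)" and WV: "V' = L' @ s @ R'" "length L' = k" "V = L' @ t @ R'"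
    by (rule step_SomeE)
  have o: "set L \<subseteq> Obj C" "set R \<subseteq> Obj C" "set L' \<subseteq> Obj C" "set R' \<subseteq> Obj C" "set W \<subseteq> Obj C"
      "set S \<subseteq> Obj C" "set s \<subseteq> Obj C" "set t \<subseteq> Obj C"
    and h: "h \<in> Hom C (ob S) (ob (L @ W @ R))"
    using 3(3) e c WV by (auto simp: cell_iff)
  have c2: "cell (S, whisker L ?e R \<cdot> h, L @ V' @ R)" 
    using act_append(2)[OF 3(3) e assms(3)] .
  have c3: "cell (V', whisker L' f R', V)"
    using whisker_hom[OF c o(3,4)] o WV by (simp add: cell_iff)
  have "run n (l # l' # ds) (Some (S, L @ W @ R, h)) = Some (S, L @ V @ R, whisker (L @ L') f (R' @ R) \<cdot> whisker L ?e R \<cdot> h)"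
    using act_append(1)[of S "whisker L ?e R \<cdot> h" "L @ L'" s "R' @ R" f t "n + k"] c2 assms(3) c WV IH
    unfolding l by simp
  also have "whisker (L @ L') f (R' @ R) \<cdot> whisker L ?e R \<cdot> h = (whisker L (whisker L' f R') R \<cdot> whisker L ?e R) \<cdot> h"
    using cell_assoc[OF 3(3) whisker_cell[OF e o(1,2)] whisker_cell[OF c3 o(1,2)]] whisker_whisker[OF c o(3,4,1,2)]
    by simp
  also have "whisker L (whisker L' f R') R \<cdot> whisker L ?e R = whisker L (whisker L' f R' \<cdot> ?e) R"
    using whisker_comp[OF e c3 o(1,2)] by simp
  also have "whisker L' f R' \<cdot> ?e = expr W (l # l' # ds)"
    unfolding l using WV V'(1) by (simp del: final.simps)
  finally show ?case .
qed

lemma run_init: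
  assumes "final W ds = Some V" "set W \<subseteq> Obj C"
  shows "run 0 ds (init W) = Some (W, V, expr W ds)"
proof -
  have c: "cell (W, expr W ds, V)" by (rule expr_cell[OF assms(1)])
  have "run 0 ds (init W) = Some (W, V, expr W ds \<cdot> \<one> (ob W))"
    using run_append[OF assms(1), of W "\<one> (ob W)" "[]" "[]" 0] assms(2)
    by (simp add: init_def cell_iff ident_hom)
  then show ?thesis
    using c comp_ident_right[of "ob W" "ob V" "expr W ds"] by (simp add: cell_iff)
qed

text \<open>The rewriting rule that belongs to an equation of morphisms.\<close>

lemma run_law:
  assumes "final W ds = Some V" "final W es = Some V" "expr W ds = expr W es" "has n W x"
  shows "run n ds x = run n es x"
  using has_SomeE[OF assms(4)] run_append assms(1-3) by metis

text \<open>Identities of morphisms are proved by this rule: both sides are read as diagrams and rewritten into each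
  other, starting from the identity of the source word.\<close>

lemma expr_eqI:
  assumes "final W ds = Some V" "final W es = Some V" "set W \<subseteq> Obj C"
    "run 0 ds (init W) = run 0 es (init W)"
  shows "expr W ds = expr W es"
  using run_init[OF assms(1,3)] run_init[OF assms(2,3)] assms(4) by simp

text \<open>A chain of rewriting steps on one concrete word yields a rule for every position.\<close>

lemma run_eqI:
  assumes "run 0 ds (init W) = run 0 es (init W)" "final W ds = Some V" "final W es = Some V" "set W \<subseteq> Obj C" "has n W x"
  shows "run n ds x = run n es x"
  using run_law[OF assms(2,3) expr_eqI[OF assms(2,3,4,1)] assms(5)] .

lemma expr_act:
  assumes "final W ds = Some V" "has n W x"
  shows "(n, W, expr W ds, V) \<bullet> x = run n ds x"
proof -
  have c: "cell (W, expr W ds, V)" using expr_cell[OF assms(1)] .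
  then have f: "final W [(0, W, expr W ds, V)] = Some V" by (auto simp: cell_iff)
  show ?thesis using run_law[OF f assms(1) _ assms(2)] by simp
qed

lemma expr_comp:
  assumes "cell (s, f, t)" "cell (t, g, w)"
  shows "expr s [(0, t, g, w), (0, s, f, t)] = g \<cdot> f"
proof -
  have "set s \<subseteq> Obj C" using assms by (simp add: cell_iff)
  then show ?thesis using assms(1) by simp
qed

lemma cell_comp_act:
  assumes "cell (s, f, t)" "cell (t, g, w)"
  shows "(n, s, g \<cdot> f, w) \<bullet> x = (n, t, g, w) \<bullet> (n, s, f, t) \<bullet> x"
proof (cases "has n s x")
  case True
  have "cell (s, g \<cdot> f, w)" using assms comp_hom[of "ob s" "ob t" "ob w" f g] by (simp add: cell_iff)
  moreover have "set s \<subseteq> Obj C" using assms by (simp add: cell_iff)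
  ultimately show ?thesis
    using run_law[of s "[(0, s, g \<cdot> f, w)]" w "[(0, t, g, w), (0, s, f, t)]", OF _ _ _ True] assms by simp
qed (simp add: act_not_has act_NoneD)

lemma cell_tensor:
  assumes "cell (s, f, t)" "cell (s', g, t')"
  shows "cell (s @ s', f \<otimes> g, t @ t')"
  using assms tensor_hom[of "ob s" "ob t" "ob s'" "ob t'" f g] by (simp add: cell_iff ob_append)

lemma cell_tensor_act:
  assumes f: "cell (s, f, t)" and g: "cell (s', g, t')" and has: "has n (s @ s') x"
  shows "(n, s @ s', f \<otimes> g, t @ t') \<bullet> x = (n, s, f, t) \<bullet> (n + length s, s', g, t') \<bullet> x"
proof -
  have o: "set s \<subseteq> Obj C" "set s' \<subseteq> Obj C" "set t \<subseteq> Obj C" "set t' \<subseteq> Obj C"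
    and h: "f \<in> Hom C (ob s) (ob t)" "g \<in> Hom C (ob s') (ob t')"
    using assms by (auto simp: cell_iff)
  have "whisker [] f t' \<cdot> whisker s g [] = (f \<otimes> \<one> (ob t')) \<cdot> (\<one> (ob s) \<otimes> g)"
    using whisker_Nil_left[OF h(1)] whisker_Nil_right[OF h(2)] o by simp
  also have "\<dots> = (f \<cdot> \<one> (ob s)) \<otimes> (\<one> (ob t') \<cdot> g)"
    by (rule interchange) (use o h in \<open>auto intro: ident_hom\<close>)
  also have "\<dots> = f \<otimes> g"
    using o h comp_ident_left[of "ob s'" "ob t'" g] comp_ident_right[of "ob s" "ob t" f] by simp
  finally have e: "f \<otimes> g = whisker [] f t' \<cdot> whisker s g []" by simp
  show ?thesis
    using run_law[of "s @ s'" "[(0, s @ s', f \<otimes> g, t @ t')]" "t @ t'" "[(0, s, f, t), (length s, s', g, t')]", OF _ _ _ has]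
      f g cell_tensor[OF f g] o e by simp
qed

lemma ident_act:
  assumes "has n s x"
  shows "(n, s, \<one> (ob s), s) \<bullet> x = x"
proof -
  have "set s \<subseteq> Obj C" using has_SomeE[OF assms] by (metis cell_iff le_sup_iff set_append)
  then show ?thesis
    using run_law[of s "[(0, s, \<one> (ob s), s)]" s "[]", OF _ _ _ assms] by (simp add: cell_iff ident_hom)
qed

end

section \<open>Half braidings and the center\<close>

context strict_monoidal_category
begin

lemma is_iso_hom: "is_iso C X Y f \<Longrightarrow> f \<in> Hom C X Y"
  by (simp add: is_iso_def)

lemma is_iso_ident: "X \<in> Obj C \<Longrightarrow> is_iso C X X (\<one> X)"
  unfolding is_iso_def using ident_hom comp_ident_left by blast

lemma is_iso_comp:
  assumes "is_iso C X Y f" "is_iso C Y Z g" "X \<in> Obj C" "Y \<in> Obj C" "Z \<in> Obj C"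
  shows "is_iso C X Z (g \<cdot> f)"
proof -
  obtain f' g' where f: "f \<in> Hom C X Y" "f' \<in> Hom C Y X" "f' \<cdot> f = \<one> X" "f \<cdot> f' = \<one> Y"
    and g: "g \<in> Hom C Y Z" "g' \<in> Hom C Z Y" "g' \<cdot> g = \<one> Y" "g \<cdot> g' = \<one> Z"
    using assms unfolding is_iso_def by blast
  have h: "g \<cdot> f \<in> Hom C X Z" "f' \<cdot> g' \<in> Hom C Z X"
    using comp_hom[OF assms(3-5) f(1) g(1)] comp_hom[OF assms(5,4,3) g(2) f(2)] by auto
  have "(f' \<cdot> g') \<cdot> g \<cdot> f = f' \<cdot> ((g' \<cdot> g) \<cdot> f)"
    using comp_assoc[OF assms(3,5,4,3) h(1) g(2) f(2)] comp_assoc[OF assms(3,4,5,4) f(1) g(1,2)] by simp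
  also have "\<dots> = \<one> X" by (simp add: g f comp_ident_left[OF assms(3,4) f(1)])
  finally have 1: "(f' \<cdot> g') \<cdot> g \<cdot> f = \<one> X" .
  have "(g \<cdot> f) \<cdot> f' \<cdot> g' = g \<cdot> ((f \<cdot> f') \<cdot> g')"
    using comp_assoc[OF assms(5,3,4,5) h(2) f(1) g(1)] comp_assoc[OF assms(5,4,3,4) g(2) f(2,1)] by simp
  also have "\<dots> = \<one> Z" by (simp add: g f comp_ident_left[OF assms(5,4) g(2)])
  finally show ?thesis using 1 h unfolding is_iso_def by blast
qed

lemma is_iso_tensor:
  assumes "is_iso C X Y f" "is_iso C X' Y' f'" "X \<in> Obj C" "Y \<in> Obj C" "X' \<in> Obj C" "Y' \<in> Obj C"
  shows "is_iso C (X \<odot> X') (Y \<odot> Y') (f \<otimes> f')"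
proof -
  obtain g g' where f: "f \<in> Hom C X Y" "g \<in> Hom C Y X" "g \<cdot> f = \<one> X" "f \<cdot> g = \<one> Y"
    and g: "f' \<in> Hom C X' Y'" "g' \<in> Hom C Y' X'" "g' \<cdot> f' = \<one> X'" "f' \<cdot> g' = \<one> Y'"
    using assms unfolding is_iso_def by blast
  have "f \<otimes> f' \<in> Hom C (X \<odot> X') (Y \<odot> Y')" "g \<otimes> g' \<in> Hom C (Y \<odot> Y') (X \<odot> X')"
    using f g assms tensor_hom by auto
  moreover have "(g \<otimes> g') \<cdot> (f \<otimes> f') = \<one> (X \<odot> X')" "(f \<otimes> f') \<cdot> (g \<otimes> g') = \<one> (Y \<odot> Y')"
    using interchange[OF assms(3,4,3,5,6,5) f(1,2) g(1,2)] interchange[OF assms(4,3,4,6,5,6) f(2,1) g(2,1)]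
    by (simp_all add: f g tensor_ident assms)
  ultimately show ?thesis unfolding is_iso_def by blast
qed

end

locale moncat = strict_monoidal_category C for C :: "('o, 'a) moncat" (structure)
begin

text \<open>The strand of \<open>M\<close> crosses the strand of \<open>X\<close> from left to right.\<close>

abbreviation "Cr M \<sigma> X n \<equiv> (n, [M, X], \<sigma> X, [X, M])"

definition half_tensor :: "'o \<Rightarrow> ('o \<Rightarrow> 'a) \<Rightarrow> 'o \<Rightarrow> ('o \<Rightarrow> 'a) \<Rightarrow> 'o \<Rightarrow> 'a" where
  "half_tensor M \<sigma> N \<omega> = (\<lambda>X\<in>Obj C. (\<sigma> X \<otimes> \<one> N) \<cdot> (\<one> M \<otimes> \<omega> X))"

lemma center_simps [simp]:
  "(M, \<sigma>) \<in> Obj (center C) \<longleftrightarrow> M \<in> Obj C \<and> half_braiding C M \<sigma>"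
  "f \<in> Hom (center C) (M, \<sigma>) (N, \<omega>) \<longleftrightarrow>
     f \<in> Hom C M N \<and> (\<forall>X\<in>Obj C. (\<one> X \<otimes> f) \<cdot> \<sigma> X = \<omega> X \<cdot> (f \<otimes> \<one> X))"
  "Ident (center C) (M, \<sigma>) = \<one> M"
  "Comp (center C) = Comp C"
  "TensorObj (center C) (M, \<sigma>) (N, \<omega>) = (M \<odot> N, half_tensor M \<sigma> N \<omega>)"
  "TensorArr (center C) = TensorArr C"
  "TensorUnit (center C) = (TensorUnit C, \<lambda>X\<in>Obj C. \<one> X)"
  "Braid (center C) (M, \<sigma>) (N, \<omega>) = \<sigma> N"
  by (simp_all add: center_def half_tensor_def)

lemma half_braiding_cell: "half_braiding C M \<sigma> \<Longrightarrow> M \<in> Obj C \<Longrightarrow> X \<in> Obj C \<Longrightarrow> cell ([M, X], \<sigma> X, [X, M])"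
  by (simp add: half_braiding_def is_iso_def cell_iff)

lemma hb_natural:
  "half_braiding C M \<sigma> \<Longrightarrow> X \<in> Obj C \<Longrightarrow> Y \<in> Obj C \<Longrightarrow> f \<in> Hom C X Y \<Longrightarrow> (f \<otimes> \<one> M) \<cdot> \<sigma> X = \<sigma> Y \<cdot> (\<one> M \<otimes> f)"
  by (simp add: half_braiding_def)

lemma hb_tensor:
  "half_braiding C M \<sigma> \<Longrightarrow> X \<in> Obj C \<Longrightarrow> Y \<in> Obj C \<Longrightarrow> \<sigma> (X \<odot> Y) = (\<one> X \<otimes> \<sigma> Y) \<cdot> (\<sigma> X \<otimes> \<one> Y)"
  by (simp add: half_braiding_def)

lemma hb_iso: "half_braiding C M \<sigma> \<Longrightarrow> X \<in> Obj C \<Longrightarrow> is_iso C (M \<odot> X) (X \<odot> M) (\<sigma> X)"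
  by (simp add: half_braiding_def)

text \<open>The tensor axiom makes \<open>\<sigma> I\<close> idempotent, and an invertible idempotent is an identity.\<close>

lemma hb_unit:
  assumes "half_braiding C M \<sigma>" "M \<in> Obj C"
  shows "\<sigma> (TensorUnit C) = \<one> M"
proof -
  let ?s = "\<sigma> (TensorUnit C)"
  obtain t where s: "?s \<in> Hom C M M" and t: "t \<in> Hom C M M" "t \<cdot> ?s = \<one> M"
    using hb_iso[OF assms(1) unit_obj] assms(2)
    by (auto simp: is_iso_def tensor_obj_unit_left tensor_obj_unit_right)
  have "?s = ?s \<cdot> ?s"
    using hb_tensor[OF assms(1) unit_obj unit_obj] assms(2) unit_obj
      tensor_arr_unit_left[OF assms(2,2) s] tensor_arr_unit_right[OF assms(2,2) s]
    by (simp add: tensor_obj_unit_left)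
  then have "t \<cdot> ?s = (t \<cdot> ?s) \<cdot> ?s"
    using comp_assoc[OF assms(2,2,2,2) s s t(1)] by simp
  then show ?thesis using t s assms comp_ident_left[OF assms(2,2) s] by simp
qed

text \<open>The tensor axiom of a half braiding lets the strand of \<open>M\<close> cross a word letter by letter. \<open>cross M \<sigma> n s\<close> is
  this sequence of crossings; it replaces the component of \<open>\<sigma>\<close> at the product of the word \<open>s\<close>.\<close>

fun cross :: "'o \<Rightarrow> ('o \<Rightarrow> 'a) \<Rightarrow> nat \<Rightarrow> 'o list \<Rightarrow> ('o, 'a) state \<Rightarrow> ('o, 'a) state" where
  "cross M \<sigma> n [] x = x"
| "cross M \<sigma> n (X # Xs) x = cross M \<sigma> (n + 1) Xs (Cr M \<sigma> X n \<bullet> x)"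

lemma has_act_append:
  assumes "has n (s @ w) x" "cell (s, f, t)"
  shows "has n (t @ w) ((n, s, f, t) \<bullet> x)"
proof -
  obtain S L R h where x: "x = Some (S, L @ (s @ w) @ R, h)" "cell (S, h, L @ (s @ w) @ R)" "length L = n"
    using assms(1) by (rule has_SomeE)
  show ?thesis
    using act_append[of S h L s "w @ R" f t n] x assms(2) has_append[of S _ L "t @ w" R n] by simp
qed

lemma has_appendD2:
  assumes "has n (s @ w) x" shows "has (n + length s) w x"
  using assms
proof (rule has_SomeE)
  fix S L R h
  assume "x = Some (S, L @ (s @ w) @ R, h)" "cell (S, h, L @ (s @ w) @ R)" "length L = n"
  then show ?thesis using has_append[of S h "L @ s" w R "n + length s"] by simp
qed

lemma half_braiding_cell_word:
  assumes "half_braiding C M \<sigma>" "M \<in> Obj C" "set s \<subseteq> Obj C"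
  shows "cell (M # s, \<sigma> (ob s), s @ [M])"
  using half_braiding_cell[OF assms(1,2) ob_obj[OF assms(3)]] assms
  by (simp add: cell_iff ob_append ob_Cons)

lemma cross_eq:
  assumes "half_braiding C M \<sigma>" "M \<in> Obj C" "set s \<subseteq> Obj C" "has n (M # s) x"
  shows "(n, M # s, \<sigma> (ob s), s @ [M]) \<bullet> x = cross M \<sigma> n s x"
  using assms(3,4)
proof (induction s arbitrary: n x)
  case Nil
  then show ?case
    using ident_act[of n "[M]" x] by (simp add: hb_unit[OF assms(1,2)])
next
  case (Cons X s)
  note c = half_braiding_cell[OF assms(1,2)] half_braiding_cell_word[OF assms(1,2)]
  have o: "X \<in> Obj C" "set s \<subseteq> Obj C" "ob s \<in> Obj C" using Cons.prems by auto
  have e: "expr (M # X # s) [(0, M # X # s, \<sigma> (ob (X # s)), X # s @ [M])]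
      = expr (M # X # s) [(1, M # s, \<sigma> (ob s), s @ [M]), Cr M \<sigma> X 0]"
    using c(1)[OF o(1)] c(2)[OF o(2)] o assms(2) hb_tensor[OF assms(1) o(1,3)] ob_Cons[OF o(1), of s] hb_unit[OF assms(1,2)]
      comp_ident_left[of "M \<odot> X" "X \<odot> M" "\<sigma> X"]
    by (cases s) (simp_all add: tensor_obj_unit_right cell_iff tensor_ident tensor_obj)
  have "(n, M # X # s, \<sigma> (ob (X # s)), X # s @ [M]) \<bullet> x
      = (n + 1, M # s, \<sigma> (ob s), s @ [M]) \<bullet> Cr M \<sigma> X n \<bullet> x"
    using run_law[OF _ _ e Cons.prems(2)] c(1)[OF o(1)] c(2)[OF o(2)] c(2)[of "X # s"] Cons.prems assms(2) by simp
  also have "\<dots> = cross M \<sigma> (n + 1) s (Cr M \<sigma> X n \<bullet> x)"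
  proof (rule Cons.IH[OF o(2)])
    have "has n ([X, M] @ s) (Cr M \<sigma> X n \<bullet> x)"
      by (rule has_act_append[OF _ c(1)[OF o(1)]]) (use Cons.prems in simp)
    then show "has (n + 1) (M # s) (Cr M \<sigma> X n \<bullet> x)"
      using has_appendD2[of n "[X]" "M # s"] by simp
  qed
  finally show ?case by simp
qed

text \<open>Naturality at a morphism between products of words: a box may be pulled through the strand of \<open>M\<close>.\<close>

lemma cross_natural:
  assumes "half_braiding C M \<sigma>" "M \<in> Obj C" "cell (s, f, t)" "has n (M # s) x"
  shows "cross M \<sigma> n t ((n + 1, s, f, t) \<bullet> x) = (n, s, f, t) \<bullet> cross M \<sigma> n s x"
proof -
  have o: "set s \<subseteq> Obj C" "set t \<subseteq> Obj C" and f: "f \<in> Hom C (ob s) (ob t)" 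
    using assms(3) by (simp_all add: cell_iff)
  note c = half_braiding_cell_word[OF assms(1,2)]
  have e: "expr (M # s) [(0, M # t, \<sigma> (ob t), t @ [M]), (1, s, f, t)]
     = expr (M # s) [(0, s, f, t), (0, M # s, \<sigma> (ob s), s @ [M])]"
    using hb_natural[OF assms(1) ob_obj[OF o(1)] ob_obj[OF o(2)] f] c[OF o(1)] c[OF o(2)] assms(2,3) o
    by simp
  have "(n, M # t, \<sigma> (ob t), t @ [M]) \<bullet> (n + 1, s, f, t) \<bullet> x = (n, s, f, t) \<bullet> (n, M # s, \<sigma> (ob s), s @ [M]) \<bullet> x"
    using run_law[OF _ _ e assms(4)] c[OF o(1)] c[OF o(2)] assms(2,3) o by simp
  moreover have "has n (M # t) ((n + 1, s, f, t) \<bullet> x)"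
  proof -
    obtain S L R h where x: "x = Some (S, L @ (M # s) @ R, h)" "cell (S, h, L @ (M # s) @ R)" "length L = n"
      using assms(4) by (rule has_SomeE)
    show ?thesis
      using act_append[of S h "L @ [M]" s R f t "n + 1"] x assms(3) has_append[of S _ L "M # t" R n] by simp
  qed
  ultimately show ?thesis
    using cross_eq[OF assms(1,2) o(1) assms(4)] cross_eq[OF assms(1,2) o(2)] by simp
qed

lemma half_tensor_ext: "half_tensor M \<sigma> N \<omega> \<in> extensional (Obj C)"
  by (simp add: half_tensor_def)

lemma half_tensor_expr:
  assumes M: "M \<in> Obj C" "half_braiding C M \<sigma>" and N: "N \<in> Obj C" "half_braiding C N \<omega>" and X: "X \<in> Obj C"
  shows "half_tensor M \<sigma> N \<omega> X = expr [M, N, X] [Cr M \<sigma> X 0, Cr N \<omega> X 1]"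
    and "final [M, N, X] [Cr M \<sigma> X 0, Cr N \<omega> X 1] = Some [X, M, N]"
  using M N X half_braiding_cell[OF M(2,1) X] half_braiding_cell[OF N(2,1) X] by (simp_all add: half_tensor_def)

lemma half_tensor_cell:
  assumes "M \<in> Obj C" "half_braiding C M \<sigma>" "N \<in> Obj C" "half_braiding C N \<omega>" "X \<in> Obj C"
  shows "cell ([M, N, X], half_tensor M \<sigma> N \<omega> X, [X, M, N])"
  unfolding half_tensor_expr(1)[OF assms] by (rule expr_cell[OF half_tensor_expr(2)[OF assms]])

lemma half_tensor_act:
  assumes "M \<in> Obj C" "half_braiding C M \<sigma>" "N \<in> Obj C" "half_braiding C N \<omega>" "X \<in> Obj C"
    and h: "has n [M, N, X] x"
  shows "(n, [M, N, X], half_tensor M \<sigma> N \<omega> X, [X, M, N]) \<bullet> x = Cr M \<sigma> X n \<bullet> Cr N \<omega> X (n + 1) \<bullet> x"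
  unfolding half_tensor_expr(1)[OF assms(1-5)] using expr_act[OF half_tensor_expr(2)[OF assms(1-5)] h] by simp

lemma half_tensor_half_braiding:
  assumes M: "M \<in> Obj C" "half_braiding C M \<sigma>" and N: "N \<in> Obj C" "half_braiding C N \<omega>"
  shows "half_braiding C (M \<odot> N) (half_tensor M \<sigma> N \<omega>)"
proof -
  let ?T = "half_tensor M \<sigma> N \<omega>"
  note c = half_braiding_cell[OF M(2,1)] half_braiding_cell[OF N(2,1)]
  note T = half_tensor_cell[OF M N] and T_act = half_tensor_act[OF M N]
  have iso: "is_iso C ((M \<odot> N) \<odot> X) (X \<odot> M \<odot> N) (?T X)" if X: "X \<in> Obj C" for X
  proof -
    have "is_iso C (M \<odot> (N \<odot> X)) (M \<odot> (X \<odot> N)) (\<one> M \<otimes> \<omega> X)" "is_iso C ((M \<odot> X) \<odot> N) ((X \<odot> M) \<odot> N) (\<sigma> X \<otimes> \<one> N)"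
      using M N X by (auto intro!: is_iso_tensor is_iso_ident hb_iso tensor_obj)
    then show ?thesis
      using is_iso_comp[of "M \<odot> N \<odot> X" "M \<odot> X \<odot> N" "\<one> M \<otimes> \<omega> X" "X \<odot> M \<odot> N" "\<sigma> X \<otimes> \<one> N"] M N X
      by (simp add: half_tensor_def tensor_obj_assoc tensor_obj)
  qed
  have nat: "(f \<otimes> \<one> (M \<odot> N)) \<cdot> ?T X = ?T Y \<cdot> (\<one> (M \<odot> N) \<otimes> f)" if "X \<in> Obj C" "Y \<in> Obj C" "f \<in> Hom C X Y" for X Y f
  proof -
    have f: "cell ([X], f, [Y])" using that by (simp add: cell_iff)
    have "expr [M, N, X] [(0, [X], f, [Y]), (0, [M, N, X], ?T X, [X, M, N])]
      = expr [M, N, X] [(0, [M, N, Y], ?T Y, [Y, M, N]), (2, [X], f, [Y])]"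
      by (rule expr_eqI[where V = "[Y, M, N]"])
        (use that M N T f c in \<open>simp_all add: T_act has_def cross_natural[OF M(2,1) f, simplified, symmetric]
          cross_natural[OF N(2,1) f, where n = 1, simplified, symmetric] slide_right_in\<close>)
    then show ?thesis using that M N T f by simp
  qed
  have ten: "?T (X \<odot> Y) = (\<one> X \<otimes> ?T Y) \<cdot> (?T X \<otimes> \<one> Y)" if "X \<in> Obj C" "Y \<in> Obj C" for X Y
  proof -
    note w = half_braiding_cell_word[OF M(2,1), of "[X, Y]"] half_braiding_cell_word[OF N(2,1), of "[X, Y]"]
    have "expr [M, N, X, Y] [(0, [M, X, Y], \<sigma> (X \<odot> Y), [X, Y, M]), (1, [N, X, Y], \<omega> (X \<odot> Y), [X, Y, N])]
      = expr [M, N, X, Y] [(1, [M, N, Y], ?T Y, [Y, M, N]), (0, [M, N, X], ?T X, [X, M, N])]"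
      by (rule expr_eqI[where V = "[X, Y, M, N]"])
        (use that M N T c w cross_eq[OF M(2,1), where s = "[X, Y]"] cross_eq[OF N(2,1), where s = "[X, Y]"]
          in \<open>simp_all add: T_act has_def slide_right_in\<close>)
    then show ?thesis using that M N T w by (simp add: half_tensor_def tensor_obj)
  qed
  show ?thesis
    unfolding half_braiding_def using M N iso nat ten half_tensor_ext by (auto simp: tensor_obj_assoc)
qed

text \<open>The second kind of naturality: a morphism of the center may be pulled along its own strand through a
  crossing with \<open>X\<close>.\<close>

lemma center_hom_act:
  assumes "M \<in> Obj C" "half_braiding C M \<sigma>" "N \<in> Obj C" "half_braiding C N \<omega>" "X \<in> Obj C"
    and "f \<in> Hom C M N" "(\<one> X \<otimes> f) \<cdot> \<sigma> X = \<omega> X \<cdot> (f \<otimes> \<one> X)" and "has n [M, X] x"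
  shows "(n + 1, [M], f, [N]) \<bullet> Cr M \<sigma> X n \<bullet> x = Cr N \<omega> X n \<bullet> (n, [M], f, [N]) \<bullet> x"
  using run_law[of "[M, X]" "[(1, [M], f, [N]), Cr M \<sigma> X 0]" "[X, N]"
       "[Cr N \<omega> X 0, (0, [M], f, [N])]", OF _ _ _ assms(8)]
    assms half_braiding_cell[OF assms(2,1), of X] half_braiding_cell[OF assms(4,3), of X]
  by (simp add: cell_iff)

lemma center_tensor_hom:
  assumes M: "M \<in> Obj C" "half_braiding C M \<sigma>" and N: "N \<in> Obj C" "half_braiding C N \<omega>" 
    and M': "M' \<in> Obj C" "half_braiding C M' \<sigma>'" and N': "N' \<in> Obj C" "half_braiding C N' \<omega>'" 
    and X: "X \<in> Obj C"
    and f: "f \<in> Hom C M M'" "(\<one> X \<otimes> f) \<cdot> \<sigma> X = \<sigma>' X \<cdot> (f \<otimes> \<one> X)"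
    and g: "g \<in> Hom C N N'" "(\<one> X \<otimes> g) \<cdot> \<omega> X = \<omega>' X \<cdot> (g \<otimes> \<one> X)"
  shows "(\<one> X \<otimes> f \<otimes> g) \<cdot> half_tensor M \<sigma> N \<omega> X = half_tensor M' \<sigma>' N' \<omega>' X \<cdot> ((f \<otimes> g) \<otimes> \<one> X)"
proof -
  have c: "cell ([M], f, [M'])" "cell ([N], g, [N'])" using M N M' N' f g by (simp_all add: cell_iff)
  have ct: "cell ([M, N], f \<otimes> g, [M', N'])" using cell_tensor[OF c] by simp
  note ch = half_braiding_cell[OF M(2,1) X] half_braiding_cell[OF N(2,1) X] half_braiding_cell[OF M'(2,1) X] half_braiding_cell[OF N'(2,1) X] 
    half_tensor_cell[OF M N X] half_tensor_cell[OF M' N' X]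
  have "expr [M, N, X] [(1, [M, N], f \<otimes> g, [M', N']), (0, [M, N, X], half_tensor M \<sigma> N \<omega> X, [X, M, N])]
    = expr [M, N, X] [(0, [M', N', X], half_tensor M' \<sigma>' N' \<omega>' X, [X, M', N']), (0, [M, N], f \<otimes> g, [M', N'])]"
    apply (rule expr_eqI[where V = "[X, M', N']"])
    using M N M' N' X c ct ch
    by (simp_all add: half_tensor_act has_def cell_tensor_act[OF c, simplified]
         center_hom_act[OF M M' X f] center_hom_act[OF N N' X g] 
         center_hom_act[OF M M' X f, where n = 0, simplified] center_hom_act[OF N N' X g, where n = 1, simplified] 
         slide_right_in)
  then show ?thesis using M N M' N' X ct ch by simp
qed
lemma unit_half_braiding: "half_braiding C (TensorUnit C) (\<lambda>X\<in>Obj C. \<one> X)"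
proof -
  have "(f \<otimes> \<one> (TensorUnit C)) \<cdot> \<one> X = \<one> Y \<cdot> (\<one> (TensorUnit C) \<otimes> f)"
    if "X \<in> Obj C" "Y \<in> Obj C" "f \<in> Hom C X Y" for X Y f
    using comp_ident_left[OF that] comp_ident_right[OF that] tensor_arr_unit_left[OF that] tensor_arr_unit_right[OF that]
    by simp
  then show ?thesis
    unfolding half_braiding_def
    using comp_ident_left[OF _ _ ident_hom]
    by (simp add: tensor_obj tensor_obj_unit_left tensor_obj_unit_right is_iso_ident tensor_ident)
qed

lemma half_tensor_assoc:
  assumes M: "M \<in> Obj C" "half_braiding C M \<sigma>" and N: "N \<in> Obj C" "half_braiding C N \<omega>"
    and P: "P \<in> Obj C" "half_braiding C P \<rho>"
  shows "half_tensor (M \<odot> N) (half_tensor M \<sigma> N \<omega>) P \<rho> = half_tensor M \<sigma> (N \<odot> P) (half_tensor N \<omega> P \<rho>)"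
proof (rule extensionalityI[OF half_tensor_ext half_tensor_ext])
  fix X assume X: "X \<in> Obj C"
  note c = half_braiding_cell[OF M(2,1) X] half_braiding_cell[OF N(2,1) X] half_braiding_cell[OF P(2,1) X] half_tensor_cell[OF M N X] half_tensor_cell[OF N P X]
  have "expr [M, N, P, X] [(0, [M, N, X], half_tensor M \<sigma> N \<omega> X, [X, M, N]), Cr P \<rho> X 2]
    = expr [M, N, P, X] [Cr M \<sigma> X 0, (1, [N, P, X], half_tensor N \<omega> P \<rho> X, [X, N, P])]"
    by (rule expr_eqI[where V = "[X, M, N, P]"])
      (use M N P X c in \<open>simp_all add: has_def half_tensor_act\<close>)
  then show "half_tensor (M \<odot> N) (half_tensor M \<sigma> N \<omega>) P \<rho> X = half_tensor M \<sigma> (N \<odot> P) (half_tensor N \<omega> P \<rho>) X"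
    using M N P X c half_tensor_def[of "M \<odot> N" _ P] half_tensor_def[of M _ "N \<odot> P"] by simp
qed

lemma center_obj_fst: "X \<in> Obj (center C) \<Longrightarrow> fst X \<in> Obj C"
  by (cases X) simp

lemma center_hom_fst: "f \<in> Hom (center C) X Y \<Longrightarrow> f \<in> Hom C (fst X) (fst Y)"
  by (cases X; cases Y) simp

text \<open>Morphisms and their laws are inherited from \<open>C\<close>; the content is that tensor products of half braidings and of
  morphisms are again such.\<close>

lemma center_strict_monoidal: "strict_monoidal_category (center C)"
proof
  fix X assume "X \<in> Obj (center C)"
  then obtain M \<sigma> where X: "X = (M, \<sigma>)" and M: "M \<in> Obj C" "half_braiding C M \<sigma>" by (cases X) auto
  have "\<one> (Y \<odot> M) \<cdot> \<sigma> Y = \<sigma> Y \<cdot> \<one> (M \<odot> Y)" if "Y \<in> Obj C" for Y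
    using comp_ident_left[OF _ _ is_iso_hom[OF hb_iso[OF M(2) that]]] comp_ident_right[OF _ _ is_iso_hom[OF hb_iso[OF M(2) that]]]
      M that by (simp add: tensor_obj)
  then show "\<one>\<^bsub>center C\<^esub> X \<in> Hom (center C) X X"
    using M by (simp add: X ident_hom tensor_ident)
next
  fix X Y Z f g assume "X \<in> Obj (center C)" "Y \<in> Obj (center C)" "Z \<in> Obj (center C)"
    "f \<in> Hom (center C) X Y" "g \<in> Hom (center C) Y Z"
  moreover obtain M \<sigma> N \<omega> P \<rho> where XYZ: "X = (M, \<sigma>)" "Y = (N, \<omega>)" "Z = (P, \<rho>)" by (cases X, cases Y, cases Z)
  ultimately have M: "M \<in> Obj C" "half_braiding C M \<sigma>" and N: "N \<in> Obj C" "half_braiding C N \<omega>"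
    and P: "P \<in> Obj C" "half_braiding C P \<rho>" and f: "f \<in> Hom C M N" and g: "g \<in> Hom C N P"
    and fX: "\<And>X. X \<in> Obj C \<Longrightarrow> (\<one> X \<otimes> f) \<cdot> \<sigma> X = \<omega> X \<cdot> (f \<otimes> \<one> X)"
    and gX: "\<And>X. X \<in> Obj C \<Longrightarrow> (\<one> X \<otimes> g) \<cdot> \<omega> X = \<rho> X \<cdot> (g \<otimes> \<one> X)" by auto
  have c: "cell ([M], f, [N])" "cell ([N], g, [P])" using M N P f g by (simp_all add: cell_iff)
  have gf: "g \<cdot> f \<in> Hom C M P" using comp_hom f g M N P by metis
  then have cgf: "cell ([M], g \<cdot> f, [P])" using M P by (simp add: cell_iff)
  have "(\<one> X \<otimes> (g \<cdot> f)) \<cdot> \<sigma> X = \<rho> X \<cdot> ((g \<cdot> f) \<otimes> \<one> X)" if X: "X \<in> Obj C" for X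
  proof -
    note ch = half_braiding_cell[OF M(2,1) X] half_braiding_cell[OF N(2,1) X] half_braiding_cell[OF P(2,1) X]
    have "expr [M, X] [(1, [M], g \<cdot> f, [P]), Cr M \<sigma> X 0] = expr [M, X] [Cr P \<rho> X 0, (0, [M], g \<cdot> f, [P])]"
      by (rule expr_eqI[where V = "[X, P]"])
        (use M N P X c cgf ch in \<open>simp_all add: has_def cell_comp_act[OF c]
           center_hom_act[OF M N X f fX[OF X], where n = 0, simplified]
           center_hom_act[OF N P X g gX[OF X], where n = 0, simplified]\<close>)
    then show ?thesis using M N P X cgf ch by simp
  qed
  with gf show "g \<cdot>\<^bsub>center C\<^esub> f \<in> Hom (center C) X Z" by (simp add: XYZ)
next
  fix X Y f assume "X \<in> Obj (center C)" "Y \<in> Obj (center C)" "f \<in> Hom (center C) X Y"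
  then show "\<one>\<^bsub>center C\<^esub> Y \<cdot>\<^bsub>center C\<^esub> f = f" "f \<cdot>\<^bsub>center C\<^esub> \<one>\<^bsub>center C\<^esub> X = f"
    "\<one>\<^bsub>center C\<^esub> (TensorUnit (center C)) \<otimes>\<^bsub>center C\<^esub> f = f" "f \<otimes>\<^bsub>center C\<^esub> \<one>\<^bsub>center C\<^esub> (TensorUnit (center C)) = f"
    using comp_ident_left[of "fst X" "fst Y" f] comp_ident_right[of "fst X" "fst Y" f]
      tensor_arr_unit_left[of "fst X" "fst Y" f] tensor_arr_unit_right[of "fst X" "fst Y" f]
    by (cases X; cases Y; simp)+
next
  fix W X Y Z f g h assume "W \<in> Obj (center C)" "X \<in> Obj (center C)" "Y \<in> Obj (center C)" "Z \<in> Obj (center C)"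
    "f \<in> Hom (center C) W X" "g \<in> Hom (center C) X Y" "h \<in> Hom (center C) Y Z"
  then show "(h \<cdot>\<^bsub>center C\<^esub> g) \<cdot>\<^bsub>center C\<^esub> f = h \<cdot>\<^bsub>center C\<^esub> (g \<cdot>\<^bsub>center C\<^esub> f)"
    using comp_assoc[of "fst W" "fst X" "fst Y" "fst Z" f g h] by (simp add: center_obj_fst center_hom_fst)
next
  show "TensorUnit (center C) \<in> Obj (center C)" by (simp add: unit_obj unit_half_braiding)
next
  fix X Y assume "X \<in> Obj (center C)" "Y \<in> Obj (center C)"
  then show "X \<odot>\<^bsub>center C\<^esub> Y \<in> Obj (center C)" "\<one>\<^bsub>center C\<^esub> X \<otimes>\<^bsub>center C\<^esub> \<one>\<^bsub>center C\<^esub> Y = \<one>\<^bsub>center C\<^esub> (X \<odot>\<^bsub>center C\<^esub> Y)"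
    by (cases X; cases Y; simp add: tensor_obj half_tensor_half_braiding tensor_ident)+
next
  fix X Y X' Y' f f' assume "X \<in> Obj (center C)" "Y \<in> Obj (center C)" "X' \<in> Obj (center C)" "Y' \<in> Obj (center C)"
    "f \<in> Hom (center C) X Y" "f' \<in> Hom (center C) X' Y'"
  moreover obtain M \<sigma> N \<omega> M' \<sigma>' N' \<omega>' where eq: "X = (M, \<sigma>)" "Y = (N, \<omega>)" "X' = (M', \<sigma>')" "Y' = (N', \<omega>')"
    by (cases X, cases Y, cases X', cases Y')
  ultimately have M: "M \<in> Obj C" "half_braiding C M \<sigma>" and N: "N \<in> Obj C" "half_braiding C N \<omega>" 
    and M': "M' \<in> Obj C" "half_braiding C M' \<sigma>'" and N': "N' \<in> Obj C" "half_braiding C N' \<omega>'"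
    and f: "f \<in> Hom C M N" "\<And>X. X \<in> Obj C \<Longrightarrow> (\<one> X \<otimes> f) \<cdot> \<sigma> X = \<omega> X \<cdot> (f \<otimes> \<one> X)"
    and g: "f' \<in> Hom C M' N'" "\<And>X. X \<in> Obj C \<Longrightarrow> (\<one> X \<otimes> f') \<cdot> \<sigma>' X = \<omega>' X \<cdot> (f' \<otimes> \<one> X)" by auto
  show "f \<otimes>\<^bsub>center C\<^esub> f' \<in> Hom (center C) (X \<odot>\<^bsub>center C\<^esub> X') (Y \<odot>\<^bsub>center C\<^esub> Y')"
    using tensor_hom[OF M(1) N(1) M'(1) N'(1) f(1) g(1)] center_tensor_hom[OF M M' N N' _ f(1) f(2) g(1) g(2)]
    unfolding eq by simp
next
  fix X Y Z X' Y' Z' f g f' g' assume "X \<in> Obj (center C)" "Y \<in> Obj (center C)" "Z \<in> Obj (center C)"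
    "X' \<in> Obj (center C)" "Y' \<in> Obj (center C)" "Z' \<in> Obj (center C)"
    "f \<in> Hom (center C) X Y" "g \<in> Hom (center C) Y Z" "f' \<in> Hom (center C) X' Y'" "g' \<in> Hom (center C) Y' Z'"
  then show "(g \<otimes>\<^bsub>center C\<^esub> g') \<cdot>\<^bsub>center C\<^esub> (f \<otimes>\<^bsub>center C\<^esub> f') = (g \<cdot>\<^bsub>center C\<^esub> f) \<otimes>\<^bsub>center C\<^esub> (g' \<cdot>\<^bsub>center C\<^esub> f')"
    using interchange[of "fst X" "fst Y" "fst Z" "fst X'" "fst Y'" "fst Z'" f g f' g']
    by (simp add: center_obj_fst center_hom_fst)
next
  fix X Y Z assume "X \<in> Obj (center C)" "Y \<in> Obj (center C)" "Z \<in> Obj (center C)"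
  then show "(X \<odot>\<^bsub>center C\<^esub> Y) \<odot>\<^bsub>center C\<^esub> Z = X \<odot>\<^bsub>center C\<^esub> (Y \<odot>\<^bsub>center C\<^esub> Z)"
    by (cases X; cases Y; cases Z; simp add: tensor_obj_assoc half_tensor_assoc)
next
  fix X assume "X \<in> Obj (center C)"
  then obtain M \<sigma> where X: "X = (M, \<sigma>)" and M: "M \<in> Obj C" "half_braiding C M \<sigma>" by (cases X) auto
  have ext: "\<sigma> \<in> extensional (Obj C)" using M by (simp add: half_braiding_def)
  have s: "\<sigma> Y \<in> Hom C (M \<odot> Y) (Y \<odot> M)" if "Y \<in> Obj C" for Y
    using hb_iso[OF M(2) that] by (rule is_iso_hom)
  have "half_tensor (TensorUnit C) (\<lambda>X\<in>Obj C. \<one> X) M \<sigma> = \<sigma>"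
    by (rule extensionalityI[OF half_tensor_ext ext])
      (use M s in \<open>simp add: half_tensor_def tensor_ident tensor_obj tensor_arr_unit_left[OF _ _ s] comp_ident_left[OF _ _ s]\<close>)
  moreover have "half_tensor M \<sigma> (TensorUnit C) (\<lambda>X\<in>Obj C. \<one> X) = \<sigma>"
    by (rule extensionalityI[OF half_tensor_ext ext])
      (use M s in \<open>simp add: half_tensor_def tensor_ident tensor_obj tensor_arr_unit_right[OF _ _ s] comp_ident_right[OF _ _ s]\<close>)
  ultimately show "TensorUnit (center C) \<odot>\<^bsub>center C\<^esub> X = X" "X \<odot>\<^bsub>center C\<^esub> TensorUnit (center C) = X"
    using M by (simp_all add: X tensor_obj_unit_left tensor_obj_unit_right)
next
  fix X Y Z X' Y' Z' f g h assume "X \<in> Obj (center C)" "Y \<in> Obj (center C)" "Z \<in> Obj (center C)"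
    "X' \<in> Obj (center C)" "Y' \<in> Obj (center C)" "Z' \<in> Obj (center C)"
    "f \<in> Hom (center C) X X'" "g \<in> Hom (center C) Y Y'" "h \<in> Hom (center C) Z Z'"
  then show "(f \<otimes>\<^bsub>center C\<^esub> g) \<otimes>\<^bsub>center C\<^esub> h = f \<otimes>\<^bsub>center C\<^esub> (g \<otimes>\<^bsub>center C\<^esub> h)"
    using tensor_arr_assoc[of "fst X" "fst Y" "fst Z" "fst X'" "fst Y'" "fst Z'" f g h]
    by (simp add: center_obj_fst center_hom_fst)
qed

text \<open>That \<open>\<sigma> N\<close> is a morphism of the center is the Yang--Baxter equation, which is naturality of \<open>\<sigma>\<close> at the
  morphism \<open>\<omega> X\<close>.\<close>

lemma center_braid_hom:
  assumes M: "M \<in> Obj C" "half_braiding C M \<sigma>" and N: "N \<in> Obj C" "half_braiding C N \<omega>" and X: "X \<in> Obj C"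
  shows "(\<one> X \<otimes> \<sigma> N) \<cdot> half_tensor M \<sigma> N \<omega> X = half_tensor N \<omega> M \<sigma> X \<cdot> (\<sigma> N \<otimes> \<one> X)"
proof -
  note c = half_braiding_cell[OF M(2,1) X] half_braiding_cell[OF N(2,1) X] half_tensor_cell[OF M N X] half_tensor_cell[OF N M X] half_braiding_cell[OF M(2,1) N(1)]
  have "expr [M, N, X] [Cr M \<sigma> N 1, (0, [M, N, X], half_tensor M \<sigma> N \<omega> X, [X, M, N])]
    = expr [M, N, X] [(0, [N, M, X], half_tensor N \<omega> M \<sigma> X, [X, N, M]), Cr M \<sigma> N 0]"
    by (rule expr_eqI[where V = "[X, N, M]"])
      (use M N X c cross_natural[OF M(2,1) c(2), where n = 0, simplified]
        in \<open>simp_all add: has_def half_tensor_act\<close>)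
  then show ?thesis using M N X c by simp
qed

text \<open>The inverse of a morphism of the center commutes with the crossings: insert \<open>f \<cdot> g\<close> and pull \<open>f\<close> through.\<close>

lemma is_iso_center:
  assumes M: "M \<in> Obj C" "half_braiding C M \<sigma>" and N: "N \<in> Obj C" "half_braiding C N \<omega>"
    and f: "f \<in> Hom (center C) (M, \<sigma>) (N, \<omega>)" "is_iso C M N f"
  shows "is_iso (center C) (M, \<sigma>) (N, \<omega>) f"
proof -
  obtain g where g: "g \<in> Hom C N M" "g \<cdot> f = \<one> M" "f \<cdot> g = \<one> N" and fh: "f \<in> Hom C M N"
    using f(2) unfolding is_iso_def by blast
  have fX: "(\<one> X \<otimes> f) \<cdot> \<sigma> X = \<omega> X \<cdot> (f \<otimes> \<one> X)" if "X \<in> Obj C" for X using f(1) that by simp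
  have c: "cell ([M], f, [N])" "cell ([N], g, [M])" using M N g fh by (auto simp: cell_iff)
  have gf: "(n, [N], g, [M]) \<bullet> (n, [M], f, [N]) \<bullet> x = x" if "has n [M] x" for n x
    using run_law[of "[M]" "[(0, [N], g, [M]), (0, [M], f, [N])]" "[M]" "[]", OF _ _ _ that] c M g by simp
  have fg: "(n, [M], f, [N]) \<bullet> (n, [N], g, [M]) \<bullet> x = x" if "has n [N] x" for n x
    using run_law[of "[N]" "[(0, [M], f, [N]), (0, [N], g, [M])]" "[N]" "[]", OF _ _ _ that] c N g by simp
  have "(\<one> X \<otimes> g) \<cdot> \<omega> X = \<sigma> X \<cdot> (g \<otimes> \<one> X)" if X: "X \<in> Obj C" for X
  proof -
    note ch = half_braiding_cell[OF M(2,1) X] half_braiding_cell[OF N(2,1) X]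
    have "expr [N, X] [(1, [N], g, [M]), Cr N \<omega> X 0] = expr [N, X] [Cr M \<sigma> X 0, (0, [N], g, [M])]"
    proof (rule expr_eqI[where V = "[X, M]"])
      have "(1, [N], g, [M]) \<bullet> Cr N \<omega> X 0 \<bullet> init [N, X]
        = (1, [N], g, [M]) \<bullet> Cr N \<omega> X 0 \<bullet> (0, [M], f, [N]) \<bullet> (0, [N], g, [M]) \<bullet> init [N, X]"
        using N X c by (simp add: fg has_def)
      also have "\<dots> = Cr M \<sigma> X 0 \<bullet> (0, [N], g, [M]) \<bullet> init [N, X]"
        using M N X c ch by (simp add: gf has_def center_hom_act[OF M N X fh fX[OF X], where n = 0, simplified, symmetric])
      finally show "run 0 [(1, [N], g, [M]), Cr N \<omega> X 0] (init [N, X])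
        = run 0 [Cr M \<sigma> X 0, (0, [N], g, [M])] (init [N, X])" by simp
    qed (use M N X c ch in simp_all)
    then show ?thesis using M N X c ch by simp
  qed
  then show ?thesis using g f by (auto simp: is_iso_def[of "center C"])
qed

lemma center_braided: "braided_monoidal_category (center C)"
proof -
  interpret Z: strict_monoidal_category "center C" by (rule center_strict_monoidal)
  show ?thesis
  proof
    fix X Y assume XY: "X \<in> Obj (center C)" "Y \<in> Obj (center C)"
    obtain M \<sigma> N \<omega> where eq: "X = (M, \<sigma>)" "Y = (N, \<omega>)" by (cases X, cases Y)
    have M: "M \<in> Obj C" "half_braiding C M \<sigma>" and N: "N \<in> Obj C" "half_braiding C N \<omega>" using XY eq by auto
    have i: "is_iso C (M \<odot> N) (N \<odot> M) (\<sigma> N)" using hb_iso[OF M(2) N(1)] .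
    show "is_iso (center C) (X \<odot>\<^bsub>center C\<^esub> Y) (Y \<odot>\<^bsub>center C\<^esub> X) (\<tau>\<^bsub>center C\<^esub> X Y)"
      using M N i is_iso_hom[OF i] center_braid_hom[OF M N] unfolding eq
      by (simp add: is_iso_center tensor_obj half_tensor_half_braiding)
  next
    fix X Y X' Y' f g assume "X \<in> Obj (center C)" "Y \<in> Obj (center C)" "X' \<in> Obj (center C)" "Y' \<in> Obj (center C)"
      and fg: "f \<in> Hom (center C) X X'" "g \<in> Hom (center C) Y Y'"
    moreover obtain M \<sigma> N \<omega> M' \<sigma>' N' \<omega>' where eq: "X = (M, \<sigma>)" "Y = (N, \<omega>)" "X' = (M', \<sigma>')" "Y' = (N', \<omega>')"
      by (cases X, cases Y, cases X', cases Y')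
    ultimately have M: "M \<in> Obj C" "half_braiding C M \<sigma>" and N: "N \<in> Obj C" "half_braiding C N \<omega>" 
      and M': "M' \<in> Obj C" "half_braiding C M' \<sigma>'" and N': "N' \<in> Obj C" "half_braiding C N' \<omega>'"
      and f: "f \<in> Hom C M M'" "(\<one> N' \<otimes> f) \<cdot> \<sigma> N' = \<sigma>' N' \<cdot> (f \<otimes> \<one> N')" and g: "g \<in> Hom C N N'" by auto
    have c: "cell ([M], f, [M'])" "cell ([N], g, [N'])" using M N M' N' f g by (simp_all add: cell_iff)
    have ct: "cell ([M, N], f \<otimes> g, [M', N'])" "cell ([N, M], g \<otimes> f, [N', M'])"
      using cell_tensor[OF c] cell_tensor[OF c(2,1)] by simp_all
    note ch = half_braiding_cell[OF M(2,1) N(1)] half_braiding_cell[OF M(2,1) N'(1)] half_braiding_cell[OF M'(2,1) N'(1)]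
    have "expr [M, N] [(0, [N, M], g \<otimes> f, [N', M']), Cr M \<sigma> N 0]
      = expr [M, N] [Cr M' \<sigma>' N' 0, (0, [M, N], f \<otimes> g, [M', N'])]"
      by (rule expr_eqI[where V = "[N', M']"])
        (use M N M' N' c ct ch in \<open>simp_all add: has_def cell_tensor_act[OF c, simplified] cell_tensor_act[OF c(2,1), simplified]
          slide_right_out cross_natural[OF M(2,1) c(2), where n = 0, simplified, symmetric]
          center_hom_act[OF M M' N'(1) f, where n = 0, simplified]\<close>)
    then show "(g \<otimes>\<^bsub>center C\<^esub> f) \<cdot>\<^bsub>center C\<^esub> \<tau>\<^bsub>center C\<^esub> X Y = \<tau>\<^bsub>center C\<^esub> X' Y' \<cdot>\<^bsub>center C\<^esub> (f \<otimes>\<^bsub>center C\<^esub> g)"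
      using M N M' N' ct ch unfolding eq by simp
  next
    fix X Y Z assume "X \<in> Obj (center C)" "Y \<in> Obj (center C)" "Z \<in> Obj (center C)"
    moreover obtain M \<sigma> N \<omega> P \<rho> where eq: "X = (M, \<sigma>)" "Y = (N, \<omega>)" "Z = (P, \<rho>)"
      by (cases X, cases Y, cases Z)
    ultimately show "\<tau>\<^bsub>center C\<^esub> (X \<odot>\<^bsub>center C\<^esub> Y) Z = (\<tau>\<^bsub>center C\<^esub> X Z \<otimes>\<^bsub>center C\<^esub> \<one>\<^bsub>center C\<^esub> Y) \<cdot>\<^bsub>center C\<^esub> (\<one>\<^bsub>center C\<^esub> X \<otimes>\<^bsub>center C\<^esub> \<tau>\<^bsub>center C\<^esub> Y Z)"
      "\<tau>\<^bsub>center C\<^esub> X (Y \<odot>\<^bsub>center C\<^esub> Z) = (\<one>\<^bsub>center C\<^esub> Y \<otimes>\<^bsub>center C\<^esub> \<tau>\<^bsub>center C\<^esub> X Z) \<cdot>\<^bsub>center C\<^esub> (\<tau>\<^bsub>center C\<^esub> X Y \<otimes>\<^bsub>center C\<^esub> \<one>\<^bsub>center C\<^esub> Z)"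
      using hb_tensor[of M \<sigma> N P] unfolding eq by (simp_all add: half_tensor_def)
  qed
qed

section \<open>Pulling boxes through crossings\<close>

text \<open>The two kinds of naturality for boxes with at most two inputs and outputs, which the digits count. They are
  oriented consistently: multiplications, actions and counits that meet a crossing end up after or without it,
  comultiplications, coactions and units before or without it. With this orientation the simplifier terminates.
  The rules \<open>nat_box\<close> pull a box of \<open>C\<close> through the strand of \<open>M\<close>; the rules \<open>ctr_box\<close> pull a morphism of the
  center, along its own strands, through the strand of \<open>X\<close>. The position \<open>k\<close> is a separate variable in those
  left-hand sides where two different positions occur, since \<open>n + 1\<close> does not match a numeral.\<close>

lemma nat_box21:
  assumes "half_braiding C M \<sigma>" "M \<in> Obj C" "cell ([X, Y], f, [Z])" "has n [M, X, Y] x" "k = n + 1"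
  shows "Cr M \<sigma> Z n \<bullet> (k, [X, Y], f, [Z]) \<bullet> x
    = (n, [X, Y], f, [Z]) \<bullet> Cr M \<sigma> Y (n + 1) \<bullet> Cr M \<sigma> X n \<bullet> x"
  using cross_natural[OF assms(1-4)] assms(5) by simp

lemma nat_box12:
  assumes "half_braiding C M \<sigma>" "M \<in> Obj C" "cell ([Z], f, [X, Y])" "has n [M, Z] x"
  shows "(n, [Z], f, [X, Y]) \<bullet> Cr M \<sigma> Z n \<bullet> x
    = Cr M \<sigma> Y (n + 1) \<bullet> Cr M \<sigma> X n \<bullet> (n + 1, [Z], f, [X, Y]) \<bullet> x"
  using cross_natural[OF assms(1-4)] by simp

lemma nat_box01:
  assumes "half_braiding C M \<sigma>" "M \<in> Obj C" "cell ([], f, [Z])" "has n [M] x" "k = n + 1"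
  shows "Cr M \<sigma> Z n \<bullet> (k, [], f, [Z]) \<bullet> x = (n, [], f, [Z]) \<bullet> x"
  using cross_natural[OF assms(1-4)] assms(5) by simp

lemma nat_box10:
  assumes "half_braiding C M \<sigma>" "M \<in> Obj C" "cell ([Z], f, [])" "has n [M, Z] x"
  shows "(n, [Z], f, []) \<bullet> Cr M \<sigma> Z n \<bullet> x = (n + 1, [Z], f, []) \<bullet> x"
  using cross_natural[OF assms(1-4)] by simp

lemma nat_box11:
  assumes "half_braiding C M \<sigma>" "M \<in> Obj C" "cell ([X], f, [Z])" "has n [M, X] x" "k = n + 1"
  shows "Cr M \<sigma> Z n \<bullet> (k, [X], f, [Z]) \<bullet> x = (n, [X], f, [Z]) \<bullet> Cr M \<sigma> X n \<bullet> x"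
  using cross_natural[OF assms(1-4)] assms(5) by simp

lemma ctr_box21:
  assumes M: "M \<in> Obj C" "half_braiding C M \<sigma>" and N: "N \<in> Obj C" "half_braiding C N \<omega>" and P: "P \<in> Obj C" "half_braiding C P \<rho>"
    and f: "f \<in> Hom (center C) (M \<odot> N, half_tensor M \<sigma> N \<omega>) (P, \<rho>)" and X: "X \<in> Obj C" and h: "has n [M, N, X] x"
  shows "Cr P \<rho> X n \<bullet> (n, [M, N], f, [P]) \<bullet> x
    = (n + 1, [M, N], f, [P]) \<bullet> Cr M \<sigma> X n \<bullet> Cr N \<omega> X (n + 1) \<bullet> x"
proof -
  have c: "cell ([M, N], f, [P])" using M N P f by (simp add: cell_iff)
  note ch = half_braiding_cell[OF M(2,1) X] half_braiding_cell[OF N(2,1) X] half_braiding_cell[OF P(2,1) X] half_tensor_cell[OF M N X]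
  have "(n + 1, [M, N], f, [P]) \<bullet> (n, [M, N, X], half_tensor M \<sigma> N \<omega> X, [X, M, N]) \<bullet> x 
    = Cr P \<rho> X n \<bullet> (n, [M, N], f, [P]) \<bullet> x"
    using run_law[of "[M, N, X]" "[(1, [M, N], f, [P]), (0, [M, N, X], half_tensor M \<sigma> N \<omega> X, [X, M, N])]" "[X, P]"
       "[Cr P \<rho> X 0, (0, [M, N], f, [P])]", OF _ _ _ h] M N P X c ch f
    by (simp add: tensor_obj)
  then show ?thesis by (simp add: half_tensor_act[OF M N X h])
qed

lemma ctr_box12:
  assumes M: "M \<in> Obj C" "half_braiding C M \<sigma>" and N: "N \<in> Obj C" "half_braiding C N \<omega>" and P: "P \<in> Obj C" "half_braiding C P \<rho>"
    and f: "f \<in> Hom (center C) (P, \<rho>) (M \<odot> N, half_tensor M \<sigma> N \<omega>)" and X: "X \<in> Obj C" and h: "has n [P, X] x" and k: "k = n + 1"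
  shows "(k, [P], f, [M, N]) \<bullet> Cr P \<rho> X n \<bullet> x
    = Cr M \<sigma> X n \<bullet> Cr N \<omega> X (n + 1) \<bullet> (n, [P], f, [M, N]) \<bullet> x"
proof -
  have c: "cell ([P], f, [M, N])" using M N P f by (simp add: cell_iff)
  note ch = half_braiding_cell[OF M(2,1) X] half_braiding_cell[OF N(2,1) X] half_braiding_cell[OF P(2,1) X] half_tensor_cell[OF M N X]
  have "(n + 1, [P], f, [M, N]) \<bullet> Cr P \<rho> X n \<bullet> x
    = (n, [M, N, X], half_tensor M \<sigma> N \<omega> X, [X, M, N]) \<bullet> (n, [P], f, [M, N]) \<bullet> x"
    using run_law[of "[P, X]" "[(1, [P], f, [M, N]), Cr P \<rho> X 0]" "[X, M, N]"
       "[(0, [M, N, X], half_tensor M \<sigma> N \<omega> X, [X, M, N]), (0, [P], f, [M, N])]", OF _ _ _ h] M N P X c ch f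
    by (simp add: tensor_obj)
  moreover have "has n [M, N, X] ((n, [P], f, [M, N]) \<bullet> x)"
    using has_act_append[of n "[P]" "[X]" x f "[M, N]"] h c by simp
  ultimately show ?thesis by (simp add: half_tensor_act[OF M N X] k)
qed

lemma ctr_box01:
  assumes P: "P \<in> Obj C" "half_braiding C P \<rho>"
    and f: "f \<in> Hom (center C) (TensorUnit (center C)) (P, \<rho>)" and X: "X \<in> Obj C" and h: "has n [X] x"
  shows "Cr P \<rho> X n \<bullet> (n, [], f, [P]) \<bullet> x = (n + 1, [], f, [P]) \<bullet> x"
proof -
  have fh: "f \<in> Hom C (TensorUnit C) P" and e: "(\<one> X \<otimes> f) \<cdot> \<one> X = \<rho> X \<cdot> (f \<otimes> \<one> X)"
    using f X by auto
  have c: "cell ([], f, [P])" using P fh by (simp add: cell_iff)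
  note ch = half_braiding_cell[OF P(2,1) X]
  have "\<one> X \<otimes> f \<in> Hom C X (X \<odot> P)"
    using tensor_hom[OF _ _ _ _ ident_hom[of X] fh] X P by (simp add: unit_obj tensor_obj_unit_right)
  then have "\<one> X \<otimes> f = \<rho> X \<cdot> (f \<otimes> \<one> X)"
    using e comp_ident_right[of X "X \<odot> P" "\<one> X \<otimes> f"] X P by (simp add: tensor_obj)
  then show ?thesis
    using run_law[of "[X]" "[Cr P \<rho> X 0, (0, [], f, [P])]" "[X, P]" "[(1, [], f, [P])]", OF _ _ _ h] P X c ch
    by simp
qed

lemma ctr_box10:
  assumes P: "P \<in> Obj C" "half_braiding C P \<rho>"
    and f: "f \<in> Hom (center C) (P, \<rho>) (TensorUnit (center C))" and X: "X \<in> Obj C" and h: "has n [P, X] x" and k: "k = n + 1"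
  shows "(k, [P], f, []) \<bullet> Cr P \<rho> X n \<bullet> x = (n, [P], f, []) \<bullet> x"
proof -
  have fh: "f \<in> Hom C P (TensorUnit C)" and e: "(\<one> X \<otimes> f) \<cdot> \<rho> X = \<one> X \<cdot> (f \<otimes> \<one> X)"
    using f X by auto
  have c: "cell ([P], f, [])" using P fh by (simp add: cell_iff)
  note ch = half_braiding_cell[OF P(2,1) X]
  have "f \<otimes> \<one> X \<in> Hom C (P \<odot> X) X"
    using tensor_hom[OF _ _ _ _ fh ident_hom[of X]] X P by (simp add: unit_obj tensor_obj_unit_left)
  then have "(\<one> X \<otimes> f) \<cdot> \<rho> X = f \<otimes> \<one> X"
    using e comp_ident_left[of "P \<odot> X" X "f \<otimes> \<one> X"] X P by (simp add: tensor_obj)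
  then show ?thesis
    using run_law[of "[P, X]" "[(1, [P], f, []), Cr P \<rho> X 0]" "[X]" "[(0, [P], f, [])]", OF _ _ _ h] P X c ch k
    by simp
qed

lemma ctr_box11:
  assumes P: "P \<in> Obj C" "half_braiding C P \<rho>" and M: "M \<in> Obj C" "half_braiding C M \<sigma>"
    and f: "f \<in> Hom (center C) (M, \<sigma>) (P, \<rho>)" and X: "X \<in> Obj C" and h: "has n [M, X] x"
  shows "Cr P \<rho> X n \<bullet> (n, [M], f, [P]) \<bullet> x = (n + 1, [M], f, [P]) \<bullet> Cr M \<sigma> X n \<bullet> x"
  using center_hom_act[OF M P X _ _ h] f X by simp

end

section \<open>Bialgebras in the center and their modules\<close>

locale central_bialgebra = moncat C for C :: "('o, 'a) moncat" (structure) +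
  fixes A \<kappa> m u \<Delta> \<epsilon>
  assumes bialg: "bialgebra (center C) \<lparr>Carrier = (A, \<kappa>), Mult = m, Unt = u, Comult = \<Delta>, Counit = \<epsilon>\<rparr>"
begin

text \<open>Layers, named after their boxes: the operations of \<open>A\<close>, the crossing \<open>Si\<close> of \<open>A\<close> with \<open>X\<close>, and an action
  \<open>Ac\<close> or a coaction \<open>Co\<close> on \<open>M\<close>.\<close>

abbreviation "Mu n \<equiv> (n, [A, A], m, [A])"
abbreviation "Eta n \<equiv> (n, [] :: 'o list, u, [A])"
abbreviation "De n \<equiv> (n, [A], \<Delta>, [A, A])"
abbreviation "Ep n \<equiv> (n, [A], \<epsilon>, [] :: 'o list)"
abbreviation "Si X n \<equiv> Cr A \<kappa> X n"
abbreviation "Ac r M n \<equiv> (n, [A, M], r, [M])"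
abbreviation "Co \<delta> M n \<equiv> (n, [M], \<delta>, [A, M])"

lemma A: "A \<in> Obj C" and hbA: "half_braiding C A \<kappa>"
  using bialg by (simp_all add: bialgebra_def)

lemma structure_hom:
  "m \<in> Hom (center C) (A \<odot> A, half_tensor A \<kappa> A \<kappa>) (A, \<kappa>)"
  "u \<in> Hom (center C) (TensorUnit (center C)) (A, \<kappa>)"
  "\<Delta> \<in> Hom (center C) (A, \<kappa>) (A \<odot> A, half_tensor A \<kappa> A \<kappa>)"
  "\<epsilon> \<in> Hom (center C) (A, \<kappa>) (TensorUnit (center C))"
  using bialg unfolding bialgebra_def Let_def bialg.simps center_simps(5) by blast+

lemma structure_cell [simp]:
  "cell ([A, A], m, [A])" "cell ([], u, [A])" "cell ([A], \<Delta>, [A, A])" "cell ([A], \<epsilon>, [])"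
  using structure_hom A by (simp_all add: cell_iff)

lemma Si_cell [simp]: "X \<in> Obj C \<Longrightarrow> cell ([A, X], \<kappa> X, [X, A])"
  using half_braiding_cell[OF hbA A] .

declare A [simp]

text \<open>The axioms in terms of the operations of \<open>C\<close>. The following lemmas turn them into rewriting rules, oriented
  like the rules for crossings.\<close>

lemma bialgebra_eqs:
  "m \<cdot> (m \<otimes> \<one> A) = m \<cdot> (\<one> A \<otimes> m)"
  "m \<cdot> (u \<otimes> \<one> A) = \<one> A" "m \<cdot> (\<one> A \<otimes> u) = \<one> A"
  "(\<Delta> \<otimes> \<one> A) \<cdot> \<Delta> = (\<one> A \<otimes> \<Delta>) \<cdot> \<Delta>"
  "(\<epsilon> \<otimes> \<one> A) \<cdot> \<Delta> = \<one> A" "(\<one> A \<otimes> \<epsilon>) \<cdot> \<Delta> = \<one> A"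
  "\<Delta> \<cdot> m = (m \<otimes> m) \<cdot> (\<one> A \<otimes> \<kappa> A \<otimes> \<one> A) \<cdot> (\<Delta> \<otimes> \<Delta>)"
  "\<Delta> \<cdot> u = u \<otimes> u" "\<epsilon> \<cdot> m = \<epsilon> \<otimes> \<epsilon>" "\<epsilon> \<cdot> u = \<one> (TensorUnit C)"
  using bialg unfolding bialgebra_def Let_def by simp_all

lemma mult_assoc: "has n [A, A, A] x \<Longrightarrow> Mu n \<bullet> Mu n \<bullet> x = Mu n \<bullet> Mu (n + 1) \<bullet> x"
  using run_law[of "[A, A, A]" "[Mu 0, Mu 0]" "[A]" "[Mu 0, Mu 1]"] bialgebra_eqs by simp

lemma mult_unit:
  "has n [A] x \<Longrightarrow> Mu n \<bullet> Eta n \<bullet> x = x"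
  "has n [A] x \<Longrightarrow> k = n + 1 \<Longrightarrow> Mu n \<bullet> Eta k \<bullet> x = x"
  using run_law[of "[A]" "[Mu 0, Eta 0]" "[A]" "[]"] run_law[of "[A]" "[Mu 0, Eta 1]" "[A]" "[]"] bialgebra_eqs by simp_all

lemma comult_coassoc: "has n [A] x \<Longrightarrow> De n \<bullet> De n \<bullet> x = De (n + 1) \<bullet> De n \<bullet> x"
  using run_law[of "[A]" "[De 0, De 0]" "[A, A, A]" "[De 1, De 0]"] bialgebra_eqs by simp

lemma comult_counit:
  "has n [A] x \<Longrightarrow> Ep n \<bullet> De n \<bullet> x = x"
  "has n [A] x \<Longrightarrow> k = n + 1 \<Longrightarrow> Ep k \<bullet> De n \<bullet> x = x"
  using run_law[of "[A]" "[Ep 0, De 0]" "[A]" "[]"] run_law[of "[A]" "[Ep 1, De 0]" "[A]" "[]"] bialgebra_eqs by simp_all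

text \<open>The axiom is stated with tensor products of morphisms, which are boxes on four strands; these are split into
  layers first.\<close>

lemma comult_mult: 
  assumes h: "has n [A, A] x"
  shows "De n \<bullet> Mu n \<bullet> x = Mu n \<bullet> Mu (n + 2) \<bullet> Si A (n + 1) \<bullet> De n \<bullet> De (n + 1) \<bullet> x"
proof -
  note c = cell_tensor[OF structure_cell(1,1), simplified] cell_tensor[OF structure_cell(3,3), simplified]
  have "expr [A, A] [(0, [A, A, A, A], m \<otimes> m, [A, A]), Si A 1, (0, [A, A], \<Delta> \<otimes> \<Delta>, [A, A, A, A])]
    = expr [A, A] [Mu 0, Mu 2, Si A 1, De 0, De 1]"
    by (rule expr_eqI[where V = "[A, A]"])
      (simp_all add: c has_def cell_tensor_act[OF structure_cell(1,1), simplified] cell_tensor_act[OF structure_cell(3,3), simplified])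
  then have "expr [A, A] [De 0, Mu 0] = expr [A, A] [Mu 0, Mu 2, Si A 1, De 0, De 1]"
    using bialgebra_eqs(7) c by simp
  from run_law[OF _ _ this h] show ?thesis by simp
qed

lemma comult_unit: "De n \<bullet> Eta n \<bullet> x = Eta (n + 1) \<bullet> Eta n \<bullet> x" if h: "has n [] x"
proof -
  note c = cell_tensor[OF structure_cell(2,2), simplified]
  have "expr [] [(0, [], u \<otimes> u, [A, A])] = expr [] [Eta 1, Eta 0]"
    by (rule expr_eqI[where V = "[A, A]"])
      (simp_all add: c has_def cell_tensor_act[OF structure_cell(2,2), simplified] slide_right_in)
  then have "expr [] [De 0, Eta 0] = expr [] [Eta 1, Eta 0]"
    using bialgebra_eqs(8) c by simp
  from run_law[OF _ _ this h] show ?thesis by simp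
qed

lemma counit_mult: "Ep n \<bullet> Mu n \<bullet> x = Ep n \<bullet> Ep (n + 1) \<bullet> x" if h: "has n [A, A] x"
proof -
  note c = cell_tensor[OF structure_cell(4,4), simplified]
  have "expr [A, A] [(0, [A, A], \<epsilon> \<otimes> \<epsilon>, [])] = expr [A, A] [Ep 0, Ep 1]"
    by (rule expr_eqI[where V = "[]"])
      (simp_all add: c has_def cell_tensor_act[OF structure_cell(4,4), simplified])
  then have "expr [A, A] [Ep 0, Mu 0] = expr [A, A] [Ep 0, Ep 1]"
    using bialgebra_eqs(9) c by simp
  from run_law[OF _ _ this h] show ?thesis by simp
qed

lemma counit_unit: "has n [] x \<Longrightarrow> Ep n \<bullet> Eta n \<bullet> x = x"
  using run_law[of "[]" "[Ep 0, Eta 0]" "[]" "[]"] bialgebra_eqs by simp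

lemmas central =
  ctr_box21[OF A hbA A hbA A hbA structure_hom(1)]
  ctr_box01[OF A hbA structure_hom(2)]
  ctr_box12[OF A hbA A hbA A hbA structure_hom(3)]
  ctr_box10[OF A hbA structure_hom(4)]

lemmas crossA = nat_box21[OF hbA A] nat_box12[OF hbA A] nat_box01[OF hbA A] nat_box10[OF hbA A] nat_box11[OF hbA A]

text \<open>The rewriting system for diagrams over \<open>A\<close>. Associativity and coassociativity bracket to the right, and
  multiplications move behind comultiplications.\<close>

lemmas bialgebra_moves = has_def central crossA mult_unit comult_coassoc comult_counit comult_mult comult_unit
  counit_mult counit_unit mult_assoc

definition module :: "'o \<Rightarrow> 'a \<Rightarrow> bool" where
  "module M r \<longleftrightarrow> M \<in> Obj C \<and> r \<in> Hom C (A \<odot> M) M \<and> r \<cdot> (m \<otimes> \<one> M) = r \<cdot> (\<one> A \<otimes> r) \<and> r \<cdot> (u \<otimes> \<one> M) = \<one> M"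

lemma module_cell [simp]: "module M r \<Longrightarrow> cell ([A, M], r, [M])"
  and module_obj [simp]: "module M r \<Longrightarrow> M \<in> Obj C"
  by (simp_all add: module_def cell_iff)

lemma act_mult: "module M r \<Longrightarrow> has n [A, A, M] x \<Longrightarrow> Ac r M n \<bullet> Mu n \<bullet> x = Ac r M n \<bullet> Ac r M (n + 1) \<bullet> x"
  using run_law[of "[A, A, M]" "[Ac r M 0, Mu 0]" "[M]" "[Ac r M 0, Ac r M 1]"] module_cell[of M r] by (simp add: module_def)

lemma act_unit: "module M r \<Longrightarrow> has n [M] x \<Longrightarrow> Ac r M n \<bullet> Eta n \<bullet> x = x"
  using run_law[of "[M]" "[Ac r M 0, Eta 0]" "[M]" "[]"] module_cell[of M r] by (simp add: module_def)

text \<open>The action on a tensor product of modules: the algebra strand is doubled and one copy crosses \<open>M\<close>.\<close>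

definition diag_action :: "'o \<Rightarrow> 'a \<Rightarrow> 'o \<Rightarrow> 'a \<Rightarrow> 'a" where
  "diag_action M r N s = (r \<otimes> s) \<cdot> (\<one> A \<otimes> \<kappa> M \<otimes> \<one> N) \<cdot> (\<Delta> \<otimes> \<one> (M \<odot> N))"

lemma diag_action_expr: 
  assumes "cell ([A, M], r, [M])" "cell ([A, N], s, [N])"
  shows "diag_action M r N s = expr [A, M, N] [Ac r M 0, Ac s N 2, Si M 1, De 0]"
proof -
  have o: "M \<in> Obj C" "N \<in> Obj C" using assms by (simp_all add: cell_iff)
  have c: "cell ([A, M, A, N], r \<otimes> s, [M, N])" using cell_tensor[OF assms] by simp
  have "expr [A, M, N] [(0, [A, M, A, N], r \<otimes> s, [M, N]), Si M 1, De 0] = expr [A, M, N] [Ac r M 0, Ac s N 2, Si M 1, De 0]"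
    by (rule expr_eqI[where V = "[M, N]"])
      (use c assms o in \<open>simp_all add: has_def cell_tensor_act[OF assms, simplified]\<close>)
  then show ?thesis using c assms o by (simp add: diag_action_def)
qed

lemma diag_action_cell:
  assumes "cell ([A, M], r, [M])" "cell ([A, N], s, [N])"
  shows "cell ([A, M, N], diag_action M r N s, [M, N])"
  unfolding diag_action_expr[OF assms] by (rule expr_cell) (use assms in \<open>simp add: cell_iff[of _ r] cell_iff[of _ s]\<close>)

lemma diag_action_act:
  assumes "cell ([A, M], r, [M])" "cell ([A, N], s, [N])" "has n [A, M, N] x"
  shows "(n, [A, M, N], diag_action M r N s, [M, N]) \<bullet> x = Ac r M n \<bullet> Ac s N (n + 2) \<bullet> Si M (n + 1) \<bullet> De n \<bullet> x"
  using expr_act[of "[A, M, N]" "[Ac r M 0, Ac s N 2, Si M 1, De 0]" "[M, N]", OF _ assms(3)] assms(1,2)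
  unfolding diag_action_expr[OF assms(1,2), symmetric] by (simp add: cell_iff[of _ r] cell_iff[of _ s])

text \<open>Associativity of the diagonal action on a tensor product: multiplicativity of \<open>\<Delta>\<close> on one side, naturality of
  \<open>\<kappa>\<close> at the action \<open>r\<close> on the other, and centrality of \<open>m\<close> bring both sides to the same normal form.\<close>

lemma diag_action_module:
  assumes M: "module M r" and N: "module N s"
  shows "module (M \<odot> N) (diag_action M r N s)"
proof -
  let ?T = "\<lambda>n. (n, [A, M, N], diag_action M r N s, [M, N])"
  note c = module_cell[OF M] module_cell[OF N] 
  note ct = diag_action_cell[OF c] and ta = diag_action_act[OF c]
  have "expr [A, A, M, N] [?T 0, Mu 0] = expr [A, A, M, N] [?T 0, ?T 1]"
    by (rule expr_eqI[where V = "[M, N]"])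
      (use M N c ct in \<open>simp_all add: bialgebra_moves ta act_mult slide_right_out, simp add: bialgebra_moves act_mult slide_right_in\<close>)
  moreover have "expr [M, N] [?T 0, Eta 0] = expr [M, N] []"
    by (rule expr_eqI[where V = "[M, N]"])
      (use M N c ct in \<open>simp_all add: bialgebra_moves ta act_unit slide_right_out\<close>)
  ultimately have "diag_action M r N s \<cdot> (m \<otimes> \<one> (M \<odot> N)) = diag_action M r N s \<cdot> (\<one> A \<otimes> diag_action M r N s)"
    "diag_action M r N s \<cdot> (u \<otimes> \<one> (M \<odot> N)) = \<one> (M \<odot> N)"
    using M N ct by simp_all
  then show ?thesis
    using M N ct unfolding module_def cell_iff by (simp add: tensor_obj)
qed

lemma module_category_simps:
  defines "H \<equiv> \<lparr>Carrier = (A, \<kappa>), Mult = m, Unt = u, Comult = \<Delta>, Counit = \<epsilon>\<rparr>"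
  shows "(M, r) \<in> Obj (module_category C H) \<longleftrightarrow> module M r"
    "f \<in> Hom (module_category C H) (M, r) (N, s) \<longleftrightarrow> f \<in> Hom C M N \<and> f \<cdot> r = s \<cdot> (\<one> A \<otimes> f)"
    "Ident (module_category C H) (M, r) = \<one> M"
    "Comp (module_category C H) = Comp C"
    "TensorObj (module_category C H) (M, r) (N, s) = (M \<odot> N, diag_action M r N s)"
    "TensorArr (module_category C H) = TensorArr C"
    "TensorUnit (module_category C H) = (TensorUnit C, \<epsilon>)"
  by (simp_all add: module_category_def H_def module_def diag_action_def)

lemma module_unit: "module (TensorUnit C) \<epsilon>"
proof -
  have "expr [A, A] [Ep 0, Mu 0] = expr [A, A] [Ep 0, Ep 1]"
    by (rule expr_eqI[where V = "[]"]) (simp_all add: bialgebra_moves)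
  then show ?thesis
    using structure_hom(4) bialgebra_eqs(10) tensor_arr_unit_right[OF unit_obj A, of u] structure_hom(2)
      tensor_arr_unit_right[OF _ A, of "A \<odot> A" m] structure_hom(1)
    by (simp add: module_def unit_obj tensor_obj tensor_obj_unit_right)
qed

lemma hom_act:
  assumes "cell ([A, M], r, [M])" "cell ([A, N], s, [N])" "cell ([M], f, [N])" "f \<cdot> r = s \<cdot> (\<one> A \<otimes> f)" "has n [A, M] x"
  shows "(n, [M], f, [N]) \<bullet> Ac r M n \<bullet> x = Ac s N n \<bullet> (n + 1, [M], f, [N]) \<bullet> x"
proof -
  have o: "M \<in> Obj C" "N \<in> Obj C" using assms(3) by (simp_all add: cell_iff)
  have e: "expr [A, M] [(0, [M], f, [N]), Ac r M 0] = expr [A, M] [Ac s N 0, (1, [M], f, [N])]"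
    using assms o by simp
  from run_law[OF _ _ e assms(5)] show ?thesis using assms(1-3) o by simp
qed

lemma diag_action_hom:
  assumes c: "cell ([A, M], r, [M])" "cell ([A, N], s, [N])" "cell ([M], f, [N])" 
    and c': "cell ([A, M'], r', [M'])" "cell ([A, N'], s', [N'])" "cell ([M'], f', [N'])" 
    and f: "f \<cdot> r = s \<cdot> (\<one> A \<otimes> f)" "f' \<cdot> r' = s' \<cdot> (\<one> A \<otimes> f')" 
  shows "(f \<otimes> f') \<cdot> diag_action M r M' r' = diag_action N s N' s' \<cdot> (\<one> A \<otimes> (f \<otimes> f'))"
proof -
  note ct = cell_tensor[OF c(3) c'(3), simplified] diag_action_cell[OF c(1) c'(1)] diag_action_cell[OF c(2) c'(2)]
  have o: "M \<in> Obj C" "N \<in> Obj C" "M' \<in> Obj C" "N' \<in> Obj C" using c(3) c'(3) by (simp_all add: cell_iff)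
  have "expr [A, M, M'] [(0, [M, M'], f \<otimes> f', [N, N']), (0, [A, M, M'], diag_action M r M' r', [M, M'])]
     = expr [A, M, M'] [(0, [A, N, N'], diag_action N s N' s', [N, N']), (1, [M, M'], f \<otimes> f', [N, N'])]"
    apply (rule expr_eqI[where V = "[N, N']"])
    using c c' ct o apply (simp_all add: bialgebra_moves cell_tensor_act[OF c(3) c'(3), simplified] diag_action_act[OF c(1) c'(1)] diag_action_act[OF c(2) c'(2)]
       slide_right_out hom_act[OF c f(1)] hom_act[OF c' f(2)] hom_act[OF c' f(2)])
    done
  then show ?thesis using ct o by simp
qed

text \<open>Coassociativity of \<open>\<Delta>\<close> and its centrality, which lets the comultiplication commute with the crossing of \<open>M\<close>.\<close>

lemma diag_action_assoc:
  assumes c: "cell ([A, M], r, [M])" "cell ([A, N], s, [N])" "cell ([A, P], t, [P])" 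
  shows "diag_action (M \<odot> N) (diag_action M r N s) P t = diag_action M r (N \<odot> P) (diag_action N s P t)"
proof -
  have o: "M \<in> Obj C" "N \<in> Obj C" "P \<in> Obj C" using c by (simp_all add: cell_iff)
  let ?l = "diag_action (M \<odot> N) (diag_action M r N s) P t" and ?r = "diag_action M r (N \<odot> P) (diag_action N s P t)"
  let ?MN = "(0, [A, M, N], diag_action M r N s, [M, N])" and ?NP = "(2, [A, N, P], diag_action N s P t, [N, P])"
  note ct = diag_action_cell[OF c(1,2)] diag_action_cell[OF c(2,3)]
  have h: "diag_action M r N s \<in> Hom C (A \<odot> M \<odot> N) (M \<odot> N)" "diag_action N s P t \<in> Hom C (A \<odot> N \<odot> P) (N \<odot> P)"
    and rt: "r \<in> Hom C (A \<odot> M) M" "t \<in> Hom C (A \<odot> P) P"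
    using ct c by (simp_all add: cell_iff)
  have 1: "cell ([A, M, N, A, P], diag_action M r N s \<otimes> t, [M, N, P])" "cell ([A, M, A, N, P], r \<otimes> diag_action N s P t, [M, N, P])"
    using cell_tensor[OF ct(1) c(3)] cell_tensor[OF c(1) ct(2)] by simp_all
  have 2: "cell ([A, M, N], \<kappa> (M \<odot> N), [M, N, A])"
    using half_braiding_cell_word[OF hbA A, of "[M, N]"] o by simp
  have cr: "(n, [A, M, N], \<kappa> (M \<odot> N), [M, N, A]) \<bullet> x = Si N (n + 1) \<bullet> Si M n \<bullet> x" if "has n [A, M, N] x" for n x
    using cross_eq[OF hbA A, of "[M, N]" n x] that o by simp
  have "?l = expr [A, M, N, P] [(0, [A, M, N, A, P], diag_action M r N s \<otimes> t, [M, N, P]), (1, [A, M, N], \<kappa> (M \<odot> N), [M, N, A]), De 0]"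
    using 1 2 o by (simp add: diag_action_def[of "M \<odot> N"] tensor_obj_assoc)
  also have "\<dots> = expr [A, M, N, P] [(0, [A, M, A, N, P], r \<otimes> diag_action N s P t, [M, N, P]), Si M 1, De 0]"
    apply (rule expr_eqI[where V = "[M, N, P]"])
    using 1 2 o c ct apply (simp_all add: bialgebra_moves cr cell_tensor_act[OF ct(1) c(3), simplified] cell_tensor_act[OF c(1) ct(2), simplified]
      diag_action_act[OF c(1,2)] diag_action_act[OF c(2,3)] slide_right_out)
    done
  also have "\<dots> = ?r"
    using 1 2 o by (simp add: diag_action_def[of M _ "N \<odot> P"])
  finally show ?thesis .
qed

abbreviation "alg \<equiv> \<lparr>Carrier = (A, \<kappa>), Mult = m, Unt = u, Comult = \<Delta>, Counit = \<epsilon>\<rparr>"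
abbreviation "AC \<equiv> module_category C alg"

lemmas AC_simps [simp] = module_category_simps

lemma AC_obj_fst: "X \<in> Obj AC \<Longrightarrow> fst X \<in> Obj C"
  by (cases X) simp

lemma AC_hom_fst: "f \<in> Hom AC X Y \<Longrightarrow> f \<in> Hom C (fst X) (fst Y)"
  by (cases X; cases Y) simp

lemma diag_action_unit_left: "diag_action (TensorUnit C) \<epsilon> M r = r" if "cell ([A, M], r, [M])"
proof -
  have o: "M \<in> Obj C" using that by (simp add: cell_iff)
  have s: "\<kappa> (TensorUnit C) = \<one> A" using hb_unit[OF hbA A] .
  have c: "cell ([A, A, M], \<epsilon> \<otimes> r, [M])" using cell_tensor[OF structure_cell(4) that] by simp
  have "diag_action (TensorUnit C) \<epsilon> M r = (\<epsilon> \<otimes> r) \<cdot> (\<one> (A \<odot> A \<odot> M) \<cdot> (\<Delta> \<otimes> \<one> M))"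
    using o by (simp add: diag_action_def s tensor_ident tensor_obj tensor_obj_unit_left)
  also have "\<one> (A \<odot> A \<odot> M) \<cdot> (\<Delta> \<otimes> \<one> M) = \<Delta> \<otimes> \<one> M"
    using expr_cell[of "[A, M]" "[De 0]"] o comp_ident_left[of "A \<odot> M" "A \<odot> A \<odot> M" "\<Delta> \<otimes> \<one> M"] 
    by (simp add: cell_iff[of _ "\<Delta> \<otimes> \<one> M"] tensor_obj)
  also have "(\<epsilon> \<otimes> r) \<cdot> (\<Delta> \<otimes> \<one> M) = expr [A, M] [(0, [A, A, M], \<epsilon> \<otimes> r, [M]), De 0]"
    using c o by simp
  also have "\<dots> = expr [A, M] [Ac r M 0]"
    apply (rule expr_eqI[where V = "[M]"])
    using that c o by (simp_all add: bialgebra_moves cell_tensor_act[OF structure_cell(4) that, simplified] slide_right_out)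
  also have "\<dots> = r" by simp
  finally show ?thesis .
qed

lemma diag_action_unit_right: "diag_action M r (TensorUnit C) \<epsilon> = r" if "cell ([A, M], r, [M])"
proof -
  have o: "M \<in> Obj C" using that by (simp add: cell_iff)
  have k: "\<kappa> M \<in> Hom C (A \<odot> M) (M \<odot> A)" using Si_cell[OF o] by (simp add: cell_iff)
  have c: "cell ([A, M, A], r \<otimes> \<epsilon>, [M])" using cell_tensor[OF that structure_cell(4)] by simp
  have "diag_action M r (TensorUnit C) \<epsilon> = (r \<otimes> \<epsilon>) \<cdot> (\<one> A \<otimes> \<kappa> M) \<cdot> (\<Delta> \<otimes> \<one> M)"
    using o tensor_arr_unit_right[OF _ _ k] by (simp add: diag_action_def tensor_obj tensor_obj_unit_right)
  also have "\<dots> = expr [A, M] [(0, [A, M, A], r \<otimes> \<epsilon>, [M]), Si M 1, De 0]"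
    using c o by simp
  also have "\<dots> = expr [A, M] [Ac r M 0]"
    apply (rule expr_eqI[where V = "[M]"])
    using that c o by (simp_all add: bialgebra_moves cell_tensor_act[OF that structure_cell(4), simplified] slide_right_out)
  also have "\<dots> = r" by simp
  finally show ?thesis .
qed

lemma module_category_strict_monoidal: "strict_monoidal_category AC"
proof
  fix X assume "X \<in> Obj AC"
  then obtain M r where X: "X = (M, r)" and M: "module M r" by (cases X) auto
  have r: "r \<in> Hom C (A \<odot> M) M" using M by (simp add: module_def)
  have "\<one> M \<cdot> r = r \<cdot> (\<one> A \<otimes> \<one> M)"
    using comp_ident_left[OF _ _ r] comp_ident_right[OF _ _ r] M by (simp add: tensor_ident tensor_obj)
  then show "\<one>\<^bsub>AC\<^esub> X \<in> Hom AC X X" using M by (simp add: X ident_hom)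
  have c: "cell ([A, M], r, [M])" using M by simp
  show "TensorUnit AC \<odot>\<^bsub>AC\<^esub> X = X" "X \<odot>\<^bsub>AC\<^esub> TensorUnit AC = X"
    using M by (simp_all add: X diag_action_unit_left[OF c] diag_action_unit_right[OF c] tensor_obj_unit_left tensor_obj_unit_right)
next
  fix X Y Z f g assume XYZ: "X \<in> Obj AC" "Y \<in> Obj AC" "Z \<in> Obj AC" "f \<in> Hom AC X Y" "g \<in> Hom AC Y Z"
  obtain M r N s P t where eq: "X = (M, r)" "Y = (N, s)" "Z = (P, t)" by (cases X, cases Y, cases Z)
  have m: "module M r" "module N s" "module P t" and f: "f \<in> Hom C M N" "f \<cdot> r = s \<cdot> (\<one> A \<otimes> f)"
    and g: "g \<in> Hom C N P" "g \<cdot> s = t \<cdot> (\<one> A \<otimes> g)" using XYZ by (auto simp: eq)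
  note o = m[THEN module_obj] and c = m[THEN module_cell]
  have cf: "cell ([M], f, [N])" "cell ([N], g, [P])" using o f g by (simp_all add: cell_iff)
  have gf: "g \<cdot> f \<in> Hom C M P" using comp_hom[OF o f(1) g(1)] .
  then have cgf: "cell ([M], g \<cdot> f, [P])" using o by (simp add: cell_iff)
  have "expr [A, M] [(0, [M], g \<cdot> f, [P]), Ac r M 0] = expr [A, M] [Ac t P 0, (1, [M], g \<cdot> f, [P])]"
    apply (rule expr_eqI[where V = "[P]"])
    using o c cf cgf by (simp_all add: bialgebra_moves cell_comp_act[OF cf] hom_act[OF c(1,2) cf(1) f(2)] hom_act[OF c(2,3) cf(2) g(2)])
  then have "(g \<cdot> f) \<cdot> r = t \<cdot> (\<one> A \<otimes> (g \<cdot> f))" using o c cgf by simp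
  then show "g \<cdot>\<^bsub>AC\<^esub> f \<in> Hom AC X Z" using gf by (simp add: eq)
next
  fix X Y f assume "X \<in> Obj AC" "Y \<in> Obj AC" "f \<in> Hom AC X Y"
  then show "\<one>\<^bsub>AC\<^esub> Y \<cdot>\<^bsub>AC\<^esub> f = f" "f \<cdot>\<^bsub>AC\<^esub> \<one>\<^bsub>AC\<^esub> X = f"
    "\<one>\<^bsub>AC\<^esub> (TensorUnit AC) \<otimes>\<^bsub>AC\<^esub> f = f" "f \<otimes>\<^bsub>AC\<^esub> \<one>\<^bsub>AC\<^esub> (TensorUnit AC) = f"
    using comp_ident_left[of "fst X" "fst Y" f] comp_ident_right[of "fst X" "fst Y" f]
      tensor_arr_unit_left[of "fst X" "fst Y" f] tensor_arr_unit_right[of "fst X" "fst Y" f]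
    by (cases X; cases Y; simp)+
next
  fix W X Y Z f g h assume "W \<in> Obj AC" "X \<in> Obj AC" "Y \<in> Obj AC" "Z \<in> Obj AC"
    "f \<in> Hom AC W X" "g \<in> Hom AC X Y" "h \<in> Hom AC Y Z"
  then show "(h \<cdot>\<^bsub>AC\<^esub> g) \<cdot>\<^bsub>AC\<^esub> f = h \<cdot>\<^bsub>AC\<^esub> (g \<cdot>\<^bsub>AC\<^esub> f)"
    using comp_assoc[of "fst W" "fst X" "fst Y" "fst Z" f g h] by (simp add: AC_obj_fst AC_hom_fst)
next
  show "TensorUnit AC \<in> Obj AC" by (simp add: module_unit)
next
  fix X Y assume "X \<in> Obj AC" "Y \<in> Obj AC"
  then show "X \<odot>\<^bsub>AC\<^esub> Y \<in> Obj AC" "\<one>\<^bsub>AC\<^esub> X \<otimes>\<^bsub>AC\<^esub> \<one>\<^bsub>AC\<^esub> Y = \<one>\<^bsub>AC\<^esub> (X \<odot>\<^bsub>AC\<^esub> Y)"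
    by (cases X; cases Y; simp add: diag_action_module tensor_ident)+
next
  fix X Y X' Y' f f' assume a: "X \<in> Obj AC" "Y \<in> Obj AC" "X' \<in> Obj AC" "Y' \<in> Obj AC"
    "f \<in> Hom AC X Y" "f' \<in> Hom AC X' Y'"
  obtain M r N s M' r' N' s' where eq: "X = (M, r)" "Y = (N, s)" "X' = (M', r')" "Y' = (N', s')"
    by (cases X, cases Y, cases X', cases Y')
  have m: "module M r" "module N s" "module M' r'" "module N' s'" 
    and f: "f \<in> Hom C M N" "f \<cdot> r = s \<cdot> (\<one> A \<otimes> f)"
    and g: "f' \<in> Hom C M' N'" "f' \<cdot> r' = s' \<cdot> (\<one> A \<otimes> f')" using a by (auto simp: eq)
  have cf: "cell ([M], f, [N])" "cell ([M'], f', [N'])" using m f g by (simp_all add: cell_iff)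
  show "f \<otimes>\<^bsub>AC\<^esub> f' \<in> Hom AC (X \<odot>\<^bsub>AC\<^esub> X') (Y \<odot>\<^bsub>AC\<^esub> Y')"
    using diag_action_hom[OF m(1,2)[THEN module_cell] cf(1) m(3,4)[THEN module_cell] cf(2) f(2) g(2)]
      tensor_hom[OF m[THEN module_obj] f(1) g(1)] by (simp add: eq)
next
  fix X Y Z X' Y' Z' f g f' g' assume "X \<in> Obj AC" "Y \<in> Obj AC" "Z \<in> Obj AC"
    "X' \<in> Obj AC" "Y' \<in> Obj AC" "Z' \<in> Obj AC"
    "f \<in> Hom AC X Y" "g \<in> Hom AC Y Z" "f' \<in> Hom AC X' Y'" "g' \<in> Hom AC Y' Z'"
  then show "(g \<otimes>\<^bsub>AC\<^esub> g') \<cdot>\<^bsub>AC\<^esub> (f \<otimes>\<^bsub>AC\<^esub> f') = (g \<cdot>\<^bsub>AC\<^esub> f) \<otimes>\<^bsub>AC\<^esub> (g' \<cdot>\<^bsub>AC\<^esub> f')"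
    using interchange[of "fst X" "fst Y" "fst Z" "fst X'" "fst Y'" "fst Z'" f g f' g']
    by (simp add: AC_obj_fst AC_hom_fst)
next
  fix X Y Z assume "X \<in> Obj AC" "Y \<in> Obj AC" "Z \<in> Obj AC"
  then show "(X \<odot>\<^bsub>AC\<^esub> Y) \<odot>\<^bsub>AC\<^esub> Z = X \<odot>\<^bsub>AC\<^esub> (Y \<odot>\<^bsub>AC\<^esub> Z)"
    by (cases X; cases Y; cases Z; simp add: tensor_obj_assoc diag_action_assoc)
next
  fix X Y Z X' Y' Z' f g h assume "X \<in> Obj AC" "Y \<in> Obj AC" "Z \<in> Obj AC"
    "X' \<in> Obj AC" "Y' \<in> Obj AC" "Z' \<in> Obj AC"
    "f \<in> Hom AC X X'" "g \<in> Hom AC Y Y'" "h \<in> Hom AC Z Z'"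
  then show "(f \<otimes>\<^bsub>AC\<^esub> g) \<otimes>\<^bsub>AC\<^esub> h = f \<otimes>\<^bsub>AC\<^esub> (g \<otimes>\<^bsub>AC\<^esub> h)"
    using tensor_arr_assoc[of "fst X" "fst Y" "fst Z" "fst X'" "fst Y'" "fst Z'" f g h]
    by (simp add: AC_obj_fst AC_hom_fst)
qed

lemma AC_moncat: "moncat AC"
  using module_category_strict_monoidal by (simp add: moncat_def)

end

section \<open>The antipode\<close>

text \<open>\<open>T\<close> is the inverse of the antipode \<open>S\<close>, and \<open>R\<close> the inverse of the braiding of \<open>A\<close> with itself. They are
  fixed parameters so that they can be used as boxes of diagrams.\<close>

locale central_hopf = central_bialgebra C A \<kappa> m u \<Delta> \<epsilon>
  for C :: "('o, 'a) moncat" (structure) and A \<kappa> m u \<Delta> \<epsilon> +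
  fixes S T R
  assumes S_hom: "S \<in> Hom (center C) (A, \<kappa>) (A, \<kappa>)" and T_hom: "T \<in> Hom (center C) (A, \<kappa>) (A, \<kappa>)"
    and ST: "T \<cdot> S = \<one> A" "S \<cdot> T = \<one> A"
    and antipode: "m \<cdot> (S \<otimes> \<one> A) \<cdot> \<Delta> = u \<cdot> \<epsilon>" "m \<cdot> (\<one> A \<otimes> S) \<cdot> \<Delta> = u \<cdot> \<epsilon>"
    and R: "R \<in> Hom C (A \<odot> A) (A \<odot> A)" "R \<cdot> \<kappa> A = \<one> (A \<odot> A)" "\<kappa> A \<cdot> R = \<one> (A \<odot> A)"
begin

abbreviation "Sl n \<equiv> (n, [A], S, [A])"
abbreviation "Tl n \<equiv> (n, [A], T, [A])"
abbreviation "Ri n \<equiv> (n, [A, A], R, [A, A])"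

lemma ST_cell [simp]: "cell ([A], S, [A])" "cell ([A], T, [A])" "cell ([A, A], R, [A, A])"
  using S_hom T_hom R by (simp_all add: cell_iff)

lemma antipode_act:
  "has n [A] x \<Longrightarrow> Mu n \<bullet> Sl n \<bullet> De n \<bullet> x = Eta n \<bullet> Ep n \<bullet> x"
  "has n [A] x \<Longrightarrow> k = n + 1 \<Longrightarrow> Mu n \<bullet> Sl k \<bullet> De n \<bullet> x = Eta n \<bullet> Ep n \<bullet> x"
  using run_law[of "[A]" "[Mu 0, Sl 0, De 0]" "[A]" "[Eta 0, Ep 0]"] run_law[of "[A]" "[Mu 0, Sl 1, De 0]" "[A]" "[Eta 0, Ep 0]"] antipode by simp_all

lemma ST_act:
  "has n [A] x \<Longrightarrow> Tl n \<bullet> Sl n \<bullet> x = x" "has n [A] x \<Longrightarrow> Sl n \<bullet> Tl n \<bullet> x = x"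
  using run_law[of "[A]" "[Tl 0, Sl 0]" "[A]" "[]"] run_law[of "[A]" "[Sl 0, Tl 0]" "[A]" "[]"] ST by simp_all

lemma R_act:
  "has n [A, A] x \<Longrightarrow> Ri n \<bullet> Si A n \<bullet> x = x" "has n [A, A] x \<Longrightarrow> Si A n \<bullet> Ri n \<bullet> x = x"
  using run_law[of "[A, A]" "[Ri 0, Si A 0]" "[A, A]" "[]"] run_law[of "[A, A]" "[Si A 0, Ri 0]" "[A, A]" "[]"] R by simp_all

lemma antipode_unit: "Sl n \<bullet> Eta n \<bullet> x = Eta n \<bullet> x" if h: "has n [] x"
proof -
  have "Sl 0 \<bullet> Eta 0 \<bullet> init [] = Mu 0 \<bullet> Eta 1 \<bullet> Sl 0 \<bullet> Eta 0 \<bullet> init []"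
    by (simp add: bialgebra_moves)
  also have "\<dots> = Mu 0 \<bullet> Sl 0 \<bullet> De 0 \<bullet> Eta 0 \<bullet> init []"
    by (simp add: bialgebra_moves slide_right_out)
  also have "\<dots> = Eta 0 \<bullet> init []"
    by (simp add: has_def antipode_act counit_unit)
  finally show ?thesis using run_eqI[of "[Sl 0, Eta 0]" "[]" "[Eta 0]" "[A]", OF _ _ _ _ h] by simp
qed

text \<open>Both sides are convolution inverses of \<open>m\<close> among the morphisms from \<open>A \<otimes> A\<close> to \<open>A\<close>: the left-hand side is a left
  inverse because \<open>\<Delta>\<close> is multiplicative, the right-hand side is a right inverse because \<open>\<Delta>\<close> can be pulled through
  the braiding. In the proof, \<open>D\<close> is the comultiplication of \<open>A \<otimes> A\<close> and \<open>Q\<close> the right-hand side; \<open>L1\<close> and \<open>L2\<close>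
  are the two inverse properties, and the final chain evaluates the triple convolution product in two ways.\<close>

lemma antipode_mult: "Sl n \<bullet> Mu n \<bullet> x = Mu n \<bullet> Sl n \<bullet> Sl (n + 1) \<bullet> Si A n \<bullet> x" if h: "has n [A, A] x"
proof -
  define D where "D n y = Si A (n + 1) \<bullet> De n \<bullet> De (n + 1) \<bullet> y" for n y
  define Q where "Q n y = Mu n \<bullet> Sl n \<bullet> Sl (n + 1) \<bullet> Si A n \<bullet> y" for n y
  have L1: "Mu n \<bullet> Sl n \<bullet> Mu n \<bullet> Mu (n + 2) \<bullet> D n y = Eta n \<bullet> Ep n \<bullet> Ep (n + 1) \<bullet> y" if "has n [A, A] y" for n y
  proof -
    have "Mu 0 \<bullet> Sl 0 \<bullet> Mu 0 \<bullet> Mu 2 \<bullet> D 0 (init [A, A]) = Mu 0 \<bullet> Sl 0 \<bullet> De 0 \<bullet> Mu 0 \<bullet> init [A, A]"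
      by (simp add: D_def has_def comult_mult)
    also have "\<dots> = Eta 0 \<bullet> Ep 0 \<bullet> Ep 1 \<bullet> init [A, A]"
      by (simp add: antipode_act has_def counit_mult)
    finally show ?thesis
      using run_eqI[of "[Mu 0, Sl 0, Mu 0, Mu 2, Si A 1, De 0, De 1]" "[A, A]" "[Eta 0, Ep 0, Ep 1]" "[A]", OF _ _ _ _ that]
      by (simp add: D_def)
  qed
  have L2: "Mu n \<bullet> Mu n \<bullet> Q (n + 2) (D n y) = Eta n \<bullet> Ep n \<bullet> Ep (n + 1) \<bullet> y" if "has n [A, A] y" for n y
  proof -
    let ?i = "init [A, A]"
    have "Mu 0 \<bullet> Mu 0 \<bullet> Q 2 (D 0 ?i) = Mu 0 \<bullet> Mu 0 \<bullet> Mu 2 \<bullet> Sl 2 \<bullet> Sl 3 \<bullet> De 1 \<bullet> Si A 1 \<bullet> De 0 \<bullet> ?i"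
      by (simp add: Q_def D_def has_def crossA slide_right_out)
    \<comment> \<open>rebracketing makes the product of a coefficient with its antipode a subdiagram\<close>
    also have "\<dots> = Mu 0 \<bullet> Mu 1 \<bullet> Mu 1 \<bullet> Sl 2 \<bullet> Sl 3 \<bullet> De 1 \<bullet> Si A 1 \<bullet> De 0 \<bullet> ?i"
      by (simp add: has_def mult_assoc)
    also have "\<dots> = Mu 0 \<bullet> Mu 1 \<bullet> Sl 2 \<bullet> Mu 1 \<bullet> Sl 2 \<bullet> De 1 \<bullet> Si A 1 \<bullet> De 0 \<bullet> ?i"
      by (simp add: has_def slide_right_out)
    also have "\<dots> = Mu 0 \<bullet> Mu 1 \<bullet> Sl 2 \<bullet> Eta 1 \<bullet> Ep 1 \<bullet> Si A 1 \<bullet> De 0 \<bullet> ?i"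
      by (simp add: antipode_act has_def)
    also have "\<dots> = Mu 0 \<bullet> Sl 1 \<bullet> De 0 \<bullet> Ep 1 \<bullet> ?i"
      by (simp add: bialgebra_moves slide_right_in)
    also have "\<dots> = Eta 0 \<bullet> Ep 0 \<bullet> Ep 1 \<bullet> ?i"
      by (simp add: antipode_act has_def)
    finally show ?thesis
      using run_eqI[of "[Mu 0, Mu 0, Mu 2, Sl 2, Sl 3, Si A 2, Si A 1, De 0, De 1]" "[A, A]" "[Eta 0, Ep 0, Ep 1]" "[A]", OF _ _ _ _ that]
      by (simp add: D_def Q_def add.commute)
  qed
  let ?i = "init [A, A]"
  have "Sl 0 \<bullet> Mu 0 \<bullet> ?i = Mu 0 \<bullet> Sl 0 \<bullet> Mu 0 \<bullet> Eta 2 \<bullet> Ep 2 \<bullet> Ep 3 \<bullet> D 0 ?i"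
    by (simp add: D_def bialgebra_moves slide_right_out)
  also have "\<dots> = Mu 0 \<bullet> Sl 0 \<bullet> Mu 0 \<bullet> Mu 2 \<bullet> Mu 2 \<bullet> Q 4 (D 2 (D 0 ?i))"
    using L2[of 2 "D 0 ?i"] by (simp add: D_def has_def)
  \<comment> \<open>coassociativity of the comultiplication of \<open>A \<otimes> A\<close>\<close>
  also have "D 2 (D 0 ?i) = D 0 (D 0 ?i)"
    by (simp add: D_def bialgebra_moves slide_right_out)
  also have "Mu 0 \<bullet> Sl 0 \<bullet> Mu 0 \<bullet> Mu 2 \<bullet> Mu 2 \<bullet> Q 4 (D 0 (D 0 ?i))
    = Mu 0 \<bullet> Mu 1 \<bullet> Sl 0 \<bullet> Mu 0 \<bullet> Mu 2 \<bullet> Q 4 (D 0 (D 0 ?i))"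
    by (simp add: D_def Q_def has_def slide_right_out)
  also have "\<dots> = Mu 0 \<bullet> Mu 0 \<bullet> Sl 0 \<bullet> Mu 0 \<bullet> Mu 2 \<bullet> Q 4 (D 0 (D 0 ?i))"
    by (simp add: D_def Q_def has_def mult_assoc)
  also have "\<dots> = Mu 0 \<bullet> Q 1 (Mu 0 \<bullet> Sl 0 \<bullet> Mu 0 \<bullet> Mu 2 \<bullet> D 0 (D 0 ?i))"
    by (simp add: D_def Q_def has_def slide_right_out)
  also have "Mu 0 \<bullet> Sl 0 \<bullet> Mu 0 \<bullet> Mu 2 \<bullet> D 0 (D 0 ?i) = Eta 0 \<bullet> Ep 0 \<bullet> Ep 1 \<bullet> D 0 ?i"
    using L1[of 0 "D 0 ?i"] by (simp add: D_def has_def)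
  also have "Mu 0 \<bullet> Q 1 (Eta 0 \<bullet> Ep 0 \<bullet> Ep 1 \<bullet> D 0 ?i) = Q 0 ?i"
    by (simp add: D_def Q_def bialgebra_moves slide_right_out, simp add: bialgebra_moves slide_right_in)
  finally show ?thesis
    using run_eqI[of "[Sl 0, Mu 0]" "[A, A]" "[Mu 0, Sl 0, Sl 1, Si A 0]" "[A]", OF _ _ _ _ h] by (simp add: Q_def)
qed

text \<open>\<open>T\<close> is an antipode for the multiplication \<open>m \<cdot> R\<close>: after application of \<open>S\<close>, anti-multiplicativity cancels \<open>R\<close>
  against the braiding and \<open>S\<close> against \<open>T\<close>, which leaves the axiom of the antipode.\<close>

lemma opposite_antipode:
  assumes h: "has n [A] x"
  shows "Mu n \<bullet> Ri n \<bullet> Tl n \<bullet> De n \<bullet> x = Eta n \<bullet> Ep n \<bullet> x"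
    and "Mu n \<bullet> Ri n \<bullet> Tl (n + 1) \<bullet> De n \<bullet> x = Eta n \<bullet> Ep n \<bullet> x"
proof -
  let ?i = "init [A]"
  have T_unit: "Eta 0 \<bullet> Ep 0 \<bullet> ?i = Tl 0 \<bullet> Eta 0 \<bullet> Ep 0 \<bullet> ?i"
    using antipode_unit[of 0 "Ep 0 \<bullet> ?i"] ST_act(1)[of 0 "Eta 0 \<bullet> Ep 0 \<bullet> ?i"] by (simp add: has_def)
  have "Mu 0 \<bullet> Ri 0 \<bullet> Tl 0 \<bullet> De 0 \<bullet> ?i = Tl 0 \<bullet> Sl 0 \<bullet> Mu 0 \<bullet> Ri 0 \<bullet> Tl 0 \<bullet> De 0 \<bullet> ?i"
    by (simp add: ST_act has_def)
  also have "\<dots> = Tl 0 \<bullet> Mu 0 \<bullet> Sl 1 \<bullet> De 0 \<bullet> ?i"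
    by (simp add: antipode_mult R_act has_def slide_right_out ST_act)
  also have "\<dots> = Eta 0 \<bullet> Ep 0 \<bullet> ?i"
    by (simp add: antipode_act has_def T_unit[symmetric])
  finally show "Mu n \<bullet> Ri n \<bullet> Tl n \<bullet> De n \<bullet> x = Eta n \<bullet> Ep n \<bullet> x"
    using run_eqI[of "[Mu 0, Ri 0, Tl 0, De 0]" "[A]" "[Eta 0, Ep 0]" "[A]", OF _ _ _ _ h] by simp
  have "Mu 0 \<bullet> Ri 0 \<bullet> Tl 1 \<bullet> De 0 \<bullet> ?i = Tl 0 \<bullet> Sl 0 \<bullet> Mu 0 \<bullet> Ri 0 \<bullet> Tl 1 \<bullet> De 0 \<bullet> ?i"
    by (simp add: ST_act has_def)
  also have "\<dots> = Tl 0 \<bullet> Mu 0 \<bullet> Sl 0 \<bullet> De 0 \<bullet> ?i"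
    by (simp add: antipode_mult R_act has_def ST_act)
  also have "\<dots> = Eta 0 \<bullet> Ep 0 \<bullet> ?i"
    by (simp add: antipode_act has_def T_unit[symmetric])
  finally show "Mu n \<bullet> Ri n \<bullet> Tl (n + 1) \<bullet> De n \<bullet> x = Eta n \<bullet> Ep n \<bullet> x"
    using run_eqI[of "[Mu 0, Ri 0, Tl 1, De 0]" "[A]" "[Eta 0, Ep 0]" "[A]", OF _ _ _ _ h] by simp
qed

end

section \<open>From Yetter--Drinfeld modules to half braidings\<close>

context central_bialgebra
begin

lemma is_iso_module:
  assumes M: "module M r" "module N s" and f: "f \<cdot> r = s \<cdot> (\<one> A \<otimes> f)" "is_iso C M N f"
  shows "is_iso AC (M, r) (N, s) f"
proof -
  obtain g where g: "g \<in> Hom C N M" "g \<cdot> f = \<one> M" "f \<cdot> g = \<one> N" and fh: "f \<in> Hom C M N"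
    using f(2) unfolding is_iso_def by blast
  note o = M[THEN module_obj] and c = M[THEN module_cell]
  have cf: "cell ([M], f, [N])" "cell ([N], g, [M])" using o g fh by (auto simp: cell_iff)
  have gf: "(n, [N], g, [M]) \<bullet> (n, [M], f, [N]) \<bullet> x = x" if "has n [M] x" for n x
    using run_law[of "[M]" "[(0, [N], g, [M]), (0, [M], f, [N])]" "[M]" "[]", OF _ _ _ that] cf o g by simp
  have fg: "(n, [M], f, [N]) \<bullet> (n, [N], g, [M]) \<bullet> x = x" if "has n [N] x" for n x
    using run_law[of "[N]" "[(0, [M], f, [N]), (0, [N], g, [M])]" "[N]" "[]", OF _ _ _ that] cf o g by simp
  have "expr [A, N] [(0, [N], g, [M]), Ac s N 0] = expr [A, N] [Ac r M 0, (1, [N], g, [M])]"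
  proof (rule expr_eqI[where V = "[M]"])
    have "(0, [N], g, [M]) \<bullet> Ac s N 0 \<bullet> init [A, N]
      = (0, [N], g, [M]) \<bullet> Ac s N 0 \<bullet> (1, [M], f, [N]) \<bullet> (1, [N], g, [M]) \<bullet> init [A, N]"
      using o c cf by (simp add: fg has_def)
    also have "\<dots> = (0, [N], g, [M]) \<bullet> (0, [M], f, [N]) \<bullet> Ac r M 0 \<bullet> (1, [N], g, [M]) \<bullet> init [A, N]"
      using hom_act[OF c cf(1) f(1), of 0 "(1, [N], g, [M]) \<bullet> init [A, N]"] o c cf by (simp add: has_def)
    also have "\<dots> = Ac r M 0 \<bullet> (1, [N], g, [M]) \<bullet> init [A, N]"
      using o c cf by (simp add: gf has_def)
    finally show "run 0 [(0, [N], g, [M]), Ac s N 0] (init [A, N]) = run 0 [Ac r M 0, (1, [N], g, [M])] (init [A, N])" by simp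
  qed (use o c cf in simp_all)
  then have "g \<cdot> s = r \<cdot> (\<one> A \<otimes> g)" using o c cf by simp
  then show ?thesis using g f fh by (auto simp: is_iso_def[of AC])
qed

text \<open>A Yetter--Drinfeld module over \<open>A\<close> in the center, spelled out in terms of \<open>C\<close>.\<close>

definition yd :: "'o \<Rightarrow> ('o \<Rightarrow> 'a) \<Rightarrow> 'a \<Rightarrow> 'a \<Rightarrow> bool" where
  "yd M \<sigma> r \<delta> \<longleftrightarrow> M \<in> Obj C \<and> half_braiding C M \<sigma> \<and> module M r \<and>
     r \<in> Hom (center C) (A \<odot> M, half_tensor A \<kappa> M \<sigma>) (M, \<sigma>) \<and>
     \<delta> \<in> Hom (center C) (M, \<sigma>) (A \<odot> M, half_tensor A \<kappa> M \<sigma>) \<and>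
     (\<Delta> \<otimes> \<one> M) \<cdot> \<delta> = (\<one> A \<otimes> \<delta>) \<cdot> \<delta> \<and> (\<epsilon> \<otimes> \<one> M) \<cdot> \<delta> = \<one> M \<and>
     (m \<otimes> \<one> M) \<cdot> (\<one> A \<otimes> \<sigma> A) \<cdot> ((\<delta> \<cdot> r) \<otimes> \<one> A) \<cdot> (\<one> A \<otimes> \<kappa> M) \<cdot> (\<Delta> \<otimes> \<one> M)
          = (m \<otimes> r) \<cdot> (\<one> A \<otimes> \<kappa> A \<otimes> \<one> M) \<cdot> (\<Delta> \<otimes> \<delta>)"

lemma yd_iff: "yetter_drinfeld_module (center C) alg (M, \<sigma>) r \<delta> \<longleftrightarrow> yd M \<sigma> r \<delta>"
  unfolding yetter_drinfeld_module_def Let_def yd_def module_def bialg.simps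
  by (auto simp del: bialg.simps)

text \<open>The two sides of the Yetter--Drinfeld condition as diagrams with one box per layer.\<close>

lemma yd_exprs:
  assumes M: "M \<in> Obj C" "half_braiding C M \<sigma>" and cr: "cell ([A, M], r, [M])" and cd: "cell ([M], \<delta>, [A, M])"
  shows "(m \<otimes> \<one> M) \<cdot> (\<one> A \<otimes> \<sigma> A) \<cdot> ((\<delta> \<cdot> r) \<otimes> \<one> A) \<cdot> (\<one> A \<otimes> \<kappa> M) \<cdot> (\<Delta> \<otimes> \<one> M)
      = expr [A, M] [Mu 0, Cr M \<sigma> A 1, Co \<delta> M 0, Ac r M 0, Si M 1, De 0]"
    and "(m \<otimes> r) \<cdot> (\<one> A \<otimes> \<kappa> A \<otimes> \<one> M) \<cdot> (\<Delta> \<otimes> \<delta>)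
      = expr [A, M] [Mu 0, Ac r M 2, Si A 1, De 0, Co \<delta> M 1]"
proof -
  note cs = half_braiding_cell[OF M(2,1) A]
  have dr: "cell ([A, M], \<delta> \<cdot> r, [A, M])"
    using expr_cell[of "[A, M]" "[Co \<delta> M 0, Ac r M 0]"] cr cd M by simp
  note mr = cell_tensor[OF structure_cell(1) cr, simplified] and dd = cell_tensor[OF structure_cell(3) cd, simplified]
  have "(m \<otimes> \<one> M) \<cdot> (\<one> A \<otimes> \<sigma> A) \<cdot> ((\<delta> \<cdot> r) \<otimes> \<one> A) \<cdot> (\<one> A \<otimes> \<kappa> M) \<cdot> (\<Delta> \<otimes> \<one> M)
    = expr [A, M] [Mu 0, Cr M \<sigma> A 1, (0, [A, M], \<delta> \<cdot> r, [A, M]), Si M 1, De 0]"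
    using cr dr cs M by simp
  also have "\<dots> = expr [A, M] [Mu 0, Cr M \<sigma> A 1, Co \<delta> M 0, Ac r M 0, Si M 1, De 0]"
    by (rule expr_eqI[where V = "[A, M]"]) (use cr cd dr cs M in \<open>simp_all add: cell_comp_act[OF cr cd]\<close>)
  finally show "(m \<otimes> \<one> M) \<cdot> (\<one> A \<otimes> \<sigma> A) \<cdot> ((\<delta> \<cdot> r) \<otimes> \<one> A) \<cdot> (\<one> A \<otimes> \<kappa> M) \<cdot> (\<Delta> \<otimes> \<one> M)
      = expr [A, M] [Mu 0, Cr M \<sigma> A 1, Co \<delta> M 0, Ac r M 0, Si M 1, De 0]" .
  have "(m \<otimes> r) \<cdot> (\<one> A \<otimes> \<kappa> A \<otimes> \<one> M) \<cdot> (\<Delta> \<otimes> \<delta>)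
    = expr [A, M] [(0, [A, A, A, M], m \<otimes> r, [A, M]), Si A 1, (0, [A, M], \<Delta> \<otimes> \<delta>, [A, A, A, M])]"
    using mr dd M by simp
  also have "\<dots> = expr [A, M] [Mu 0, Ac r M 2, Si A 1, De 0, Co \<delta> M 1]"
    by (rule expr_eqI[where V = "[A, M]"]) 
     (use cr cd mr dd M in \<open>simp_all add: has_def cell_tensor_act[OF structure_cell(1) cr, simplified] cell_tensor_act[OF structure_cell(3) cd, simplified]\<close>)
  finally show "(m \<otimes> r) \<cdot> (\<one> A \<otimes> \<kappa> A \<otimes> \<one> M) \<cdot> (\<Delta> \<otimes> \<delta>)
      = expr [A, M] [Mu 0, Ac r M 2, Si A 1, De 0, Co \<delta> M 1]" .
qed

definition yd_braid :: "'o \<Rightarrow> ('o \<Rightarrow> 'a) \<Rightarrow> 'a \<Rightarrow> 'o \<Rightarrow> 'a \<Rightarrow> 'a" where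
  "yd_braid M \<sigma> \<delta> N t = (t \<otimes> \<one> M) \<cdot> (\<one> A \<otimes> \<sigma> N) \<cdot> (\<delta> \<otimes> \<one> N)"

abbreviation "Ga M \<sigma> \<delta> N t n \<equiv> (n, [M, N], yd_braid M \<sigma> \<delta> N t, [N, M])"

lemma yd_braid_expr:
  "M \<in> Obj C \<Longrightarrow> N \<in> Obj C \<Longrightarrow> yd_braid M \<sigma> \<delta> N t = expr [M, N] [Ac t N 0, Cr M \<sigma> N 1, Co \<delta> M 0]"
  if "cell ([M], \<delta>, [A, M])" "cell ([M, N], \<sigma> N, [N, M])"
  using that by (simp add: yd_braid_def)

lemma yd_braid_cell:
  assumes "cell ([M], \<delta>, [A, M])" "half_braiding C M \<sigma>" "cell ([A, N], t, [N])"
  shows "cell ([M, N], yd_braid M \<sigma> \<delta> N t, [N, M])"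
proof -
  have o: "M \<in> Obj C" "N \<in> Obj C" using assms by (simp_all add: cell_iff)
  note ch = half_braiding_cell[OF assms(2) o]
  show ?thesis unfolding yd_braid_expr[where \<sigma> = \<sigma>, OF assms(1) ch o] by (rule expr_cell) (use assms o ch in simp)
qed

lemma yd_braid_act:
  assumes "cell ([M], \<delta>, [A, M])" "half_braiding C M \<sigma>" "cell ([A, N], t, [N])" "has n [M, N] x"
  shows "Ga M \<sigma> \<delta> N t n \<bullet> x = Ac t N n \<bullet> Cr M \<sigma> N (n + 1) \<bullet> Co \<delta> M n \<bullet> x"
proof -
  have o: "M \<in> Obj C" "N \<in> Obj C" using assms by (simp_all add: cell_iff)
  note ch = half_braiding_cell[OF assms(2) o]
  show ?thesis
    using expr_act[of "[M, N]" "[Ac t N 0, Cr M \<sigma> N 1, Co \<delta> M 0]" "[N, M]", OF _ assms(4)] assms o ch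
    unfolding yd_braid_expr[where \<sigma> = \<sigma>, OF assms(1) ch o, symmetric] by simp
qed

end

locale yd_object = central_bialgebra C A \<kappa> m u \<Delta> \<epsilon>
  for C :: "('o, 'a) moncat" (structure) and A \<kappa> m u \<Delta> \<epsilon> +
  fixes M \<sigma> r \<delta>
  assumes yd: "yd M \<sigma> r \<delta>"
begin

lemma M [simp]: "M \<in> Obj C" and hb: "half_braiding C M \<sigma>" and mod [simp]: "module M r"
  and r_hom: "r \<in> Hom (center C) (A \<odot> M, half_tensor A \<kappa> M \<sigma>) (M, \<sigma>)"
  and \<delta>_hom: "\<delta> \<in> Hom (center C) (M, \<sigma>) (A \<odot> M, half_tensor A \<kappa> M \<sigma>)"
  using yd unfolding yd_def by blast+

lemma Co_cell [simp]: "cell ([M], \<delta>, [A, M])"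
  using \<delta>_hom by (simp add: cell_iff)

lemma Cr_cell [simp]: "X \<in> Obj C \<Longrightarrow> cell ([M, X], \<sigma> X, [X, M])"
  using half_braiding_cell[OF hb M] .

lemma coact_coassoc: "has n [M] x \<Longrightarrow> De n \<bullet> Co \<delta> M n \<bullet> x = Co \<delta> M (n + 1) \<bullet> Co \<delta> M n \<bullet> x"
  using run_law[of "[M]" "[De 0, Co \<delta> M 0]" "[A, A, M]" "[Co \<delta> M 1, Co \<delta> M 0]"] yd by (simp add: yd_def)

lemma coact_counit: "has n [M] x \<Longrightarrow> Ep n \<bullet> Co \<delta> M n \<bullet> x = x"
  using run_law[of "[M]" "[Ep 0, Co \<delta> M 0]" "[M]" "[]"] yd by (simp add: yd_def)

lemma yd_act:
  assumes h: "has n [A, M] x"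
  shows "Mu n \<bullet> Cr M \<sigma> A (n + 1) \<bullet> Co \<delta> M n \<bullet> Ac r M n \<bullet> Si M (n + 1) \<bullet> De n \<bullet> x
    = Mu n \<bullet> Ac r M (n + 2) \<bullet> Si A (n + 1) \<bullet> De n \<bullet> Co \<delta> M (n + 1) \<bullet> x"
proof -
  note cr = module_cell[OF mod]
  have "expr [A, M] [Mu 0, Cr M \<sigma> A 1, Co \<delta> M 0, Ac r M 0, Si M 1, De 0] = expr [A, M] [Mu 0, Ac r M 2, Si A 1, De 0, Co \<delta> M 1]"
    using yd_exprs[OF M hb cr Co_cell] yd unfolding yd_def by presburger
  from run_law[OF _ _ this h, of "[A, M]"] show ?thesis using cr by simp
qed

lemmas crossM = nat_box21[OF hb M] nat_box12[OF hb M] nat_box01[OF hb M] nat_box10[OF hb M] nat_box11[OF hb M]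
lemmas centralM = ctr_box21[OF A hbA M hb M hb r_hom] ctr_box12[OF A hbA M hb M hb \<delta>_hom]

lemmas yd_braid_cell' [simp] = yd_braid_cell[OF Co_cell hb]
lemmas yd_braid_act' = yd_braid_act[OF Co_cell hb]

text \<open>The Yetter--Drinfeld condition, tensored with \<open>N\<close> and followed by \<open>\<sigma> N\<close> and the action \<open>t\<close>.\<close>

lemma yd_braid_linear:
  assumes N: "module N t"
  shows "yd_braid M \<sigma> \<delta> N t \<cdot> diag_action M r N t = diag_action N t M r \<cdot> (\<one> A \<otimes> yd_braid M \<sigma> \<delta> N t)"
proof -
  note cr = module_cell[OF mod] and ct = module_cell[OF N]
  note tc = diag_action_cell[OF cr ct] diag_action_cell[OF ct cr]
  let ?i = "init [A, M, N]"
  have "expr [A, M, N] [Ga M \<sigma> \<delta> N t 0, (0, [A, M, N], diag_action M r N t, [M, N])]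
    = expr [A, M, N] [(0, [A, N, M], diag_action N t M r, [N, M]), Ga M \<sigma> \<delta> N t 1]"
  proof (rule expr_eqI[where V = "[N, M]"])
    have "Ga M \<sigma> \<delta> N t 0 \<bullet> (0, [A, M, N], diag_action M r N t, [M, N]) \<bullet> ?i
      = Ac t N 0 \<bullet> Cr M \<sigma> N 1 \<bullet> Ac t N 2 \<bullet> Co \<delta> M 0 \<bullet> Ac r M 0 \<bullet> Si M 1 \<bullet> De 0 \<bullet> ?i"
      using N cr ct tc by (simp add: has_def yd_braid_act' diag_action_act[OF cr ct] slide_right_out)
    \<comment> \<open>naturality of \<open>\<sigma>\<close> at \<open>t\<close> joins the two actions on \<open>N\<close> into one action of a product\<close>
    also have "\<dots> = Ac t N 0 \<bullet> Cr M \<sigma> N 1 \<bullet> (Mu 0 \<bullet> Cr M \<sigma> A 1 \<bullet> Co \<delta> M 0 \<bullet> Ac r M 0 \<bullet> Si M 1 \<bullet> De 0 \<bullet> ?i)"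
      using N cr ct by (simp add: has_def crossM slide_right_out, simp add: has_def act_mult slide_right_in)
    also have "\<dots> = Ac t N 0 \<bullet> Cr M \<sigma> N 1 \<bullet> (Mu 0 \<bullet> Ac r M 2 \<bullet> Si A 1 \<bullet> De 0 \<bullet> Co \<delta> M 1 \<bullet> ?i)"
      using yd_act[of 0 ?i] N by (simp add: has_def)
    also have "\<dots> = (0, [A, N, M], diag_action N t M r, [N, M]) \<bullet> Ga M \<sigma> \<delta> N t 1 \<bullet> ?i"
      using N cr ct tc by (simp add: bialgebra_moves centralM act_mult yd_braid_act' diag_action_act[OF ct cr] slide_right_out,
         simp add: bialgebra_moves act_mult slide_right_in)
    finally show "run 0 [Ga M \<sigma> \<delta> N t 0, (0, [A, M, N], diag_action M r N t, [M, N])] ?i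
      = run 0 [(0, [A, N, M], diag_action N t M r, [N, M]), Ga M \<sigma> \<delta> N t 1] ?i" by simp
  qed (use N cr ct tc in simp_all)
  then show ?thesis using N tc by simp
qed

lemma yd_braid_natural:
  assumes N: "module N t" "module N' t'" and f: "f \<in> Hom C N N'" "f \<cdot> t = t' \<cdot> (\<one> A \<otimes> f)"
  shows "(f \<otimes> \<one> M) \<cdot> yd_braid M \<sigma> \<delta> N t = yd_braid M \<sigma> \<delta> N' t' \<cdot> (\<one> M \<otimes> f)"
proof -
  note c = N[THEN module_cell] and o = N[THEN module_obj]
  have cf: "cell ([N], f, [N'])" using f o by (simp add: cell_iff)
  have "expr [M, N] [(0, [N], f, [N']), Ga M \<sigma> \<delta> N t 0] = expr [M, N] [Ga M \<sigma> \<delta> N' t' 0, (1, [N], f, [N'])]"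
    by (rule expr_eqI[where V = "[N', M]"])
      (use c o cf in \<open>simp_all add: has_def yd_braid_act' hom_act[OF c cf f(2)] crossM slide_right_out\<close>)
  then show ?thesis using o c cf by simp
qed

text \<open>Centrality of \<open>\<delta>\<close> moves the second coaction in front of the crossing with \<open>N\<close>, where coassociativity replaces it
  by a comultiplication.\<close>

lemma yd_braid_tensor:
  assumes N: "module N t" "module N' t'"
  shows "yd_braid M \<sigma> \<delta> (N \<odot> N') (diag_action N t N' t') = (\<one> N \<otimes> yd_braid M \<sigma> \<delta> N' t') \<cdot> (yd_braid M \<sigma> \<delta> N t \<otimes> \<one> N')"
proof -
  note c = N[THEN module_cell] and o = N[THEN module_obj]
  note tc = diag_action_cell[OF c]
  have s: "cell ([M, N, N'], \<sigma> (N \<odot> N'), [N, N', M])" using half_braiding_cell_word[OF hb M, of "[N, N']"] o by simp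
  have cr: "(n, [M, N, N'], \<sigma> (N \<odot> N'), [N, N', M]) \<bullet> x = Cr M \<sigma> N' (n + 1) \<bullet> Cr M \<sigma> N n \<bullet> x"
    if "has n [M, N, N'] x" for n x using cross_eq[OF hb M, of "[N, N']" n x] that o by simp
  have "expr [M, N, N'] [(0, [A, N, N'], diag_action N t N' t', [N, N']), (1, [M, N, N'], \<sigma> (N \<odot> N'), [N, N', M]), Co \<delta> M 0]
    = expr [M, N, N'] [Ga M \<sigma> \<delta> N' t' 1, Ga M \<sigma> \<delta> N t 0]"
    by (rule expr_eqI[where V = "[N, N', M]"])
      (use c o tc s in \<open>simp_all add: bialgebra_moves cr diag_action_act[OF c] yd_braid_act' coact_coassoc centralM slide_right_out,
        simp add: bialgebra_moves coact_coassoc centralM slide_right_in\<close>)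
  then show ?thesis using o c tc s by (simp add: yd_braid_def[of M \<sigma> \<delta> "N \<odot> N'"])
qed

end

locale yd_hopf = central_hopf C A \<kappa> m u \<Delta> \<epsilon> S T R + yd_object C A \<kappa> m u \<Delta> \<epsilon> M \<sigma> r \<delta>
  for C :: "('o, 'a) moncat" (structure) and A \<kappa> m u \<Delta> \<epsilon> S T R M \<sigma> r \<delta>
begin

text \<open>Centrality of \<open>\<delta>\<close> rewrites the candidate as \<open>F \<cdot> \<sigma> N\<close>, where \<open>F\<close> coacts on \<open>M\<close> and then applies the right action
  \<open>t \<cdot> k\<close> of \<open>A\<close> on \<open>N\<close>, with \<open>k\<close> the inverse of \<open>\<kappa> N\<close>. This is an action for the opposite multiplication \<open>m \<cdot> R\<close>
  (fact \<open>tt\<close>), so that the same diagram with \<open>T\<close> inserted after the coaction is inverse to \<open>F\<close>.\<close>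

lemma yd_braid_iso:
  assumes N: "module N t"
  shows "is_iso C (M \<odot> N) (N \<odot> M) (yd_braid M \<sigma> \<delta> N t)"
proof -
  note c = N[THEN module_cell] and o = N[THEN module_obj]
  obtain k where k: "k \<in> Hom C (N \<odot> A) (A \<odot> N)" "k \<cdot> \<kappa> N = \<one> (A \<odot> N)" "\<kappa> N \<cdot> k = \<one> (N \<odot> A)"
    using hb_iso[OF hbA o] unfolding is_iso_def by blast
  let ?K = "\<lambda>n. (n, [N, A], k, [A, N])"
  have kc: "cell ([N, A], k, [A, N])" using k o by (simp add: cell_iff)
  have K1: "?K n \<bullet> Si N n \<bullet> x = x" if "has n [A, N] x" for n x
    using run_law[of "[A, N]" "[?K 0, Si N 0]" "[A, N]" "[]", OF _ _ _ that] kc o k by simp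
  have K2: "Si N n \<bullet> ?K n \<bullet> x = x" if "has n [N, A] x" for n x
    using run_law[of "[N, A]" "[Si N 0, ?K 0]" "[N, A]" "[]", OF _ _ _ that] kc o k by simp
  have K_unit: "?K n \<bullet> Eta (n + 1) \<bullet> x = Eta n \<bullet> x" if h: "has n [N] x" for n x
  proof -
    have "?K 0 \<bullet> Eta 1 \<bullet> init [N] = ?K 0 \<bullet> Si N 0 \<bullet> Eta 0 \<bullet> init [N]"
      using o by (simp add: central has_def)
    also have "\<dots> = Eta 0 \<bullet> init [N]" using o by (simp add: K1 has_def)
    finally show ?thesis using run_eqI[of "[?K 0, Eta 1]" "[N]" "[Eta 0]", OF _ _ _ _ h] o kc by simp
  qed
  have K_mult: "?K n \<bullet> Mu (n + 1) \<bullet> x = Mu n \<bullet> ?K (n + 1) \<bullet> ?K n \<bullet> x" if h: "has n [N, A, A] x" for n x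
  proof -
    let ?i = "init [N, A, A]"
    have "?K 0 \<bullet> Mu 1 \<bullet> ?i = ?K 0 \<bullet> Mu 1 \<bullet> Si N 0 \<bullet> Si N 1 \<bullet> ?K 1 \<bullet> ?K 0 \<bullet> ?i"
      using o kc by (simp add: K2 has_def)
    also have "\<dots> = ?K 0 \<bullet> Si N 0 \<bullet> Mu 0 \<bullet> ?K 1 \<bullet> ?K 0 \<bullet> ?i"
      using o kc by (simp add: central has_def)
    also have "\<dots> = Mu 0 \<bullet> ?K 1 \<bullet> ?K 0 \<bullet> ?i"
      using o kc by (simp add: K1 has_def)
    finally show ?thesis using run_eqI[of "[?K 0, Mu 1]" "[N, A, A]" "[Mu 0, ?K 1, ?K 0]", OF _ _ _ _ h] o kc by simp
  qed
  \<comment> \<open>naturality of \<open>\<kappa>\<close> at \<open>\<kappa> N\<close>\<close>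
  have YB: "Si N n \<bullet> Si N (n + 1) \<bullet> Si A n \<bullet> x = Si A (n + 1) \<bullet> Si N n \<bullet> Si N (n + 1) \<bullet> x" if "has n [A, A, N] x" for n x
    using cross_natural[OF hbA A Si_cell[OF o] that] by simp
  \<comment> \<open>the same identity with all crossings inverted\<close>
  have YB': "Ri n \<bullet> ?K (n + 1) \<bullet> ?K n \<bullet> x = ?K (n + 1) \<bullet> ?K n \<bullet> Ri (n + 1) \<bullet> x" if h: "has n [N, A, A] x" for n x
  proof -
    let ?i = "init [N, A, A]"
    define z where "z = ?K 1 \<bullet> ?K 0 \<bullet> Ri 1 \<bullet> ?i"
    have z: "word z = Some [A, A, N]" using o kc by (simp add: z_def)
    have "Si A 1 \<bullet> Si N 0 \<bullet> Si N 1 \<bullet> z = ?i"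
      using o kc by (simp add: z_def K2 R_act has_def)
    then have i: "?i = Si N 0 \<bullet> Si N 1 \<bullet> Si A 0 \<bullet> z"
      using YB[of 0 z] z by (simp add: has_def)
    have "Ri 0 \<bullet> ?K 1 \<bullet> ?K 0 \<bullet> ?i = z"
      unfolding i using o kc z by (simp add: K1 R_act has_def)
    then show ?thesis unfolding z_def
      using run_eqI[of "[Ri 0, ?K 1, ?K 0]" "[N, A, A]" "[?K 1, ?K 0, Ri 1]", OF _ _ _ _ h] o kc by simp
  qed
  have K_act: "?K n \<bullet> Ac t N n \<bullet> x = Ac t N (n + 1) \<bullet> Ri n \<bullet> ?K (n + 1) \<bullet> x" if h: "has n [A, N, A] x" for n x
  proof -
    let ?i = "init [A, N, A]"
    have "?K 0 \<bullet> Ac t N 0 \<bullet> ?i = ?K 0 \<bullet> Ac t N 0 \<bullet> Si N 1 \<bullet> Si A 0 \<bullet> Ri 0 \<bullet> ?K 1 \<bullet> ?i"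
      using o kc c by (simp add: K2 R_act has_def)
    also have "\<dots> = ?K 0 \<bullet> Si N 0 \<bullet> Ac t N 1 \<bullet> Ri 0 \<bullet> ?K 1 \<bullet> ?i"
      using o kc c by (simp add: crossA has_def)
    also have "\<dots> = Ac t N 1 \<bullet> Ri 0 \<bullet> ?K 1 \<bullet> ?i"
      using o kc c by (simp add: K1 has_def)
    finally show ?thesis using run_eqI[of "[?K 0, Ac t N 0]" "[A, N, A]" "[Ac t N 1, Ri 0, ?K 1]", OF _ _ _ _ h] o kc c by simp
  qed
  have tt: "Ac t N 0 \<bullet> ?K 0 \<bullet> Ac t N 0 \<bullet> ?K 0 \<bullet> x = Ac t N 0 \<bullet> ?K 0 \<bullet> Mu 1 \<bullet> Ri 1 \<bullet> x" if "word x = Some [N, A, A, M]" for x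
    using that N o kc c K_mult[of 0] K_act[of 0] YB'[of 0 x] by (simp add: has_def act_mult)
  let ?phi = "[Ac t N 0, ?K 0, Co \<delta> M 1]" and ?psi = "[Ac t N 0, ?K 0, Tl 1, Co \<delta> M 1]" and ?i = "init [N, M]"
  have fin: "final [N, M] ?phi = Some [N, M]" "final [N, M] ?psi = Some [N, M]"
    using o kc c by simp_all
  note cc = expr_cell[OF fin(1)] expr_cell[OF fin(2)]
  let ?F = "expr [N, M] ?phi" and ?G = "expr [N, M] ?psi"
  have sl: "Co \<delta> M 1 \<bullet> Ac t N 0 \<bullet> ?K 0 \<bullet> x = Ac t N 0 \<bullet> ?K 0 \<bullet> Co \<delta> M 2 \<bullet> x" for x
    by (simp add: slide_right_in)
  have sl': "Tl 1 \<bullet> Ac t N 0 \<bullet> ?K 0 \<bullet> x = Ac t N 0 \<bullet> ?K 0 \<bullet> Tl 2 \<bullet> x" for x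
    by (simp add: slide_right_in)
  have un: "Ac t N 0 \<bullet> ?K 0 \<bullet> Eta 1 \<bullet> Ep 1 \<bullet> Co \<delta> M 1 \<bullet> ?i = ?i"
    using o N c kc K_unit[of 0] by (simp add: coact_counit act_unit has_def)
  have GF: "expr [N, M] [(0, [N, M], ?G, [N, M]), (0, [N, M], ?F, [N, M])] = expr [N, M] []"
  proof (rule expr_eqI[where V = "[N, M]"])
    have "run 0 ?psi (run 0 ?phi ?i) = Ac t N 0 \<bullet> ?K 0 \<bullet> Ac t N 0 \<bullet> ?K 0 \<bullet> Tl 2 \<bullet> Co \<delta> M 2 \<bullet> Co \<delta> M 1 \<bullet> ?i"
      by (simp add: sl sl')
    also have "\<dots> = Ac t N 0 \<bullet> ?K 0 \<bullet> Mu 1 \<bullet> Ri 1 \<bullet> Tl 2 \<bullet> De 1 \<bullet> Co \<delta> M 1 \<bullet> ?i"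
      using o by (simp add: tt coact_coassoc has_def)
    also have "\<dots> = ?i"
      using opposite_antipode(2)[of 1 "Co \<delta> M 1 \<bullet> ?i"] un o by (simp add: has_def)
    finally show "run 0 [(0, [N, M], ?G, [N, M]), (0, [N, M], ?F, [N, M])] ?i = run 0 [] ?i"
      using expr_act[OF fin(1), of 0 ?i] expr_act[OF fin(2), of 0 "run 0 ?phi ?i"] o c kc
      by (simp add: has_def del: expr.simps)
  qed (use cc o in \<open>simp_all del: expr.simps\<close>)
  have FG: "expr [N, M] [(0, [N, M], ?F, [N, M]), (0, [N, M], ?G, [N, M])] = expr [N, M] []"
  proof (rule expr_eqI[where V = "[N, M]"])
    have "run 0 ?phi (run 0 ?psi ?i) = Ac t N 0 \<bullet> ?K 0 \<bullet> Ac t N 0 \<bullet> ?K 0 \<bullet> Co \<delta> M 2 \<bullet> Tl 1 \<bullet> Co \<delta> M 1 \<bullet> ?i"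
      by (simp add: sl)
    also have "\<dots> = Ac t N 0 \<bullet> ?K 0 \<bullet> Ac t N 0 \<bullet> ?K 0 \<bullet> Tl 1 \<bullet> Co \<delta> M 2 \<bullet> Co \<delta> M 1 \<bullet> ?i"
      using slide_right_in[of 1 "[A]" 2 "[M]" \<delta> "[A, M]" "[A]" T] by simp
    also have "\<dots> = Ac t N 0 \<bullet> ?K 0 \<bullet> Mu 1 \<bullet> Ri 1 \<bullet> Tl 1 \<bullet> De 1 \<bullet> Co \<delta> M 1 \<bullet> ?i"
      using o by (simp add: tt coact_coassoc has_def)
    also have "\<dots> = ?i"
      using opposite_antipode(1)[of 1 "Co \<delta> M 1 \<bullet> ?i"] un o by (simp add: has_def)
    finally show "run 0 [(0, [N, M], ?F, [N, M]), (0, [N, M], ?G, [N, M])] ?i = run 0 [] ?i"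
      using expr_act[OF fin(2), of 0 ?i] expr_act[OF fin(1), of 0 "run 0 ?psi ?i"] o c kc
      by (simp add: has_def del: expr.simps)
  qed (use cc o in \<open>simp_all del: expr.simps\<close>)
  have "is_iso C (N \<odot> M) (N \<odot> M) ?F"
    unfolding is_iso_def
    using GF[unfolded expr_comp[OF cc]] FG[unfolded expr_comp[OF cc(2,1)]] cc o by (auto simp: cell_iff simp del: expr.simps(3))
  then have "is_iso C (M \<odot> N) (N \<odot> M) (?F \<cdot> \<sigma> N)"
    using is_iso_comp[OF hb_iso[OF hb o]] o by (simp add: tensor_obj del: expr.simps)
  moreover have "expr [M, N] [(0, [N, M], ?F, [N, M]), Cr M \<sigma> N 0] = expr [M, N] [Ga M \<sigma> \<delta> N t 0]"
  proof (rule expr_eqI[where V = "[N, M]"])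
    have "run 0 ?phi (Cr M \<sigma> N 0 \<bullet> init [M, N]) = Ga M \<sigma> \<delta> N t 0 \<bullet> init [M, N]"
      using o c kc by (simp add: yd_braid_act' centralM K1 has_def)
    then show "run 0 [(0, [N, M], ?F, [N, M]), Cr M \<sigma> N 0] (init [M, N]) = run 0 [Ga M \<sigma> \<delta> N t 0] (init [M, N])"
      using expr_act[OF fin(1), of 0 "Cr M \<sigma> N 0 \<bullet> init [M, N]"] o by (simp add: has_def del: expr.simps)
  qed (use cc o c in \<open>simp_all del: expr.simps\<close>)
  ultimately show ?thesis unfolding expr_comp[OF Cr_cell[OF o] cc(1)] using o by (simp del: expr.simps(3))
qed

definition gamma :: "'o \<times> 'a \<Rightarrow> 'a" where
  "gamma = (\<lambda>(N, t)\<in>Obj AC. yd_braid M \<sigma> \<delta> N t)"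

lemma gamma_half_braiding: "half_braiding AC (M, r) gamma"
  unfolding half_braiding_def
proof (intro conjI ballI)
  show "gamma \<in> extensional (Obj AC)" by (simp add: gamma_def)
next
  fix X assume "X \<in> Obj AC"
  then obtain N t where X: "X = (N, t)" and N: "module N t" by (cases X) auto
  show "is_iso AC ((M, r) \<odot>\<^bsub>AC\<^esub> X) (X \<odot>\<^bsub>AC\<^esub> (M, r)) (gamma X)"
    using is_iso_module[OF diag_action_module[OF mod N] diag_action_module[OF N mod] yd_braid_linear[OF N] yd_braid_iso[OF N]] N
    by (simp add: X gamma_def)
next
  fix X Y f assume a: "X \<in> Obj AC" "Y \<in> Obj AC" "f \<in> Hom AC X Y"
  obtain N t N' t' where X: "X = (N, t)" "Y = (N', t')" by (cases X, cases Y)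
  show "(f \<otimes>\<^bsub>AC\<^esub> \<one>\<^bsub>AC\<^esub> (M, r)) \<cdot>\<^bsub>AC\<^esub> gamma X = gamma Y \<cdot>\<^bsub>AC\<^esub> (\<one>\<^bsub>AC\<^esub> (M, r) \<otimes>\<^bsub>AC\<^esub> f)"
    using a yd_braid_natural[of N t N' t' f] by (simp add: X gamma_def)
next
  fix X Y assume a: "X \<in> Obj AC" "Y \<in> Obj AC"
  obtain N t N' t' where X: "X = (N, t)" "Y = (N', t')" by (cases X, cases Y)
  show "gamma (X \<odot>\<^bsub>AC\<^esub> Y) = (\<one>\<^bsub>AC\<^esub> X \<otimes>\<^bsub>AC\<^esub> gamma Y) \<cdot>\<^bsub>AC\<^esub> (gamma X \<otimes>\<^bsub>AC\<^esub> \<one>\<^bsub>AC\<^esub> Y)"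
    using a yd_braid_tensor[of N t N' t'] diag_action_module[of N t N' t'] by (simp add: X gamma_def)
qed

end

section \<open>From half braidings to Yetter--Drinfeld modules\<close>

context central_bialgebra
begin

lemma regular_module: "module A m"
  using bialgebra_eqs structure_cell(1) by (simp add: module_def cell_iff)

text \<open>The action through the counit. It makes \<open>C\<close> a strict monoidal subcategory of the module category.\<close>

definition trivial :: "'o \<Rightarrow> 'a" where "trivial X = \<epsilon> \<otimes> \<one> X"

lemma trivial_expr: "X \<in> Obj C \<Longrightarrow> trivial X = expr [A, X] [Ep 0]"
  by (simp add: trivial_def)

lemma trivial_cell [simp]: "X \<in> Obj C \<Longrightarrow> cell ([A, X], trivial X, [X])"
  unfolding trivial_expr by (rule expr_cell) simp

lemma trivial_act: "X \<in> Obj C \<Longrightarrow> has n [A, X] x \<Longrightarrow> Ac (trivial X) X n \<bullet> x = Ep n \<bullet> x"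
  using expr_act[of "[A, X]" "[Ep 0]" "[X]" n x] by (simp add: trivial_def)

lemma trivial_module [simp]: "module X (trivial X)" if X: "X \<in> Obj C"
proof -
  have "expr [A, A, X] [Ac (trivial X) X 0, Mu 0] = expr [A, A, X] [Ac (trivial X) X 0, Ac (trivial X) X 1]"
    by (rule expr_eqI[where V = "[X]"]) (use X in \<open>simp_all add: bialgebra_moves trivial_act\<close>)
  moreover have "expr [X] [Ac (trivial X) X 0, Eta 0] = expr [X] []"
    by (rule expr_eqI[where V = "[X]"]) (use X in \<open>simp_all add: bialgebra_moves trivial_act\<close>)
  ultimately have "trivial X \<cdot> (m \<otimes> \<one> X) = trivial X \<cdot> (\<one> A \<otimes> trivial X)" "trivial X \<cdot> (u \<otimes> \<one> X) = \<one> X"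
    using X by simp_all
  then show ?thesis using X trivial_cell[OF X] unfolding module_def cell_iff by simp
qed

lemma trivial_tensor: "diag_action X (trivial X) Y (trivial Y) = trivial (X \<odot> Y)" if o: "X \<in> Obj C" "Y \<in> Obj C"
proof -
  note c = trivial_cell[OF o(1)] trivial_cell[OF o(2)]
  have "expr [A, X, Y] [(0, [A, X, Y], diag_action X (trivial X) Y (trivial Y), [X, Y])] = expr [A, X, Y] [Ep 0]"
    by (rule expr_eqI[where V = "[X, Y]"])
      (use o c diag_action_cell[OF c] in \<open>simp_all add: bialgebra_moves diag_action_act[OF c] trivial_act slide_right_out\<close>)
  then show ?thesis using o by (simp add: trivial_def)
qed

lemma trivial_hom:
  assumes "X \<in> Obj C" "Y \<in> Obj C" "f \<in> Hom C X Y"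
  shows "f \<cdot> trivial X = trivial Y \<cdot> (\<one> A \<otimes> f)"
proof -
  have c: "cell ([X], f, [Y])" using assms by (simp add: cell_iff)
  have "expr [A, X] [(0, [X], f, [Y]), Ac (trivial X) X 0] = expr [A, X] [Ac (trivial Y) Y 0, (1, [X], f, [Y])]"
    by (rule expr_eqI[where V = "[Y]"]) (use assms c in \<open>simp_all add: bialgebra_moves trivial_act slide_right_in\<close>)
  then show ?thesis using assms c by simp
qed

text \<open>This and the next lemma recover \<open>\<sigma>\<close> and \<open>\<delta>\<close> from the half braiding that they define. They are
  stated for a counital \<open>\<delta>\<close>, respectively an arbitrary one, so as to apply to a tensor product before it is known
  to be a Yetter--Drinfeld module.\<close>

lemma yd_braid_trivial:
  assumes "M \<in> Obj C" "half_braiding C M \<sigma>" "cell ([M], \<delta>, [A, M])" "(\<epsilon> \<otimes> \<one> M) \<cdot> \<delta> = \<one> M" "X \<in> Obj C"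
  shows "yd_braid M \<sigma> \<delta> X (trivial X) = \<sigma> X"
proof -
  note c = half_braiding_cell[OF assms(2,1,5)] and gc = yd_braid_cell[OF assms(3,2) trivial_cell[OF assms(5)]]
  have co: "Ep n \<bullet> Co \<delta> M n \<bullet> x = x" if "has n [M] x" for n x
    using run_law[of "[M]" "[Ep 0, Co \<delta> M 0]" "[M]" "[]", OF _ _ _ that] assms by simp
  have "expr [M, X] [Ga M \<sigma> \<delta> X (trivial X) 0] = expr [M, X] [Cr M \<sigma> X 0]"
    by (rule expr_eqI[where V = "[X, M]"])
      (use assms c gc in \<open>simp_all add: bialgebra_moves co yd_braid_act[OF assms(3,2)] trivial_act slide_right_out\<close>)
  then show ?thesis by simp
qed

lemma yd_braid_regular:
  assumes "M \<in> Obj C" "half_braiding C M \<sigma>" "cell ([M], \<delta>, [A, M])"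
  shows "yd_braid M \<sigma> \<delta> A m \<cdot> (\<one> M \<otimes> u) = \<delta>"
proof -
  note c = half_braiding_cell[OF assms(2,1)] and gc = yd_braid_cell[OF assms(3,2) structure_cell(1)]
  have "expr [M] [Ga M \<sigma> \<delta> A m 0, Eta 1] = expr [M] [Co \<delta> M 0]"
    by (rule expr_eqI[where V = "[A, M]"])
      (use assms c gc in \<open>simp_all add: bialgebra_moves yd_braid_act[OF assms(3,2) structure_cell(1)] nat_box01[OF assms(2,1)] slide_right_out\<close>)
  then show ?thesis using assms gc by simp
qed

end

locale hb_module = central_bialgebra C A \<kappa> m u \<Delta> \<epsilon>
  for C :: "('o, 'a) moncat" (structure) and A \<kappa> m u \<Delta> \<epsilon> +
  fixes M r \<gamma>
  assumes mod [simp]: "module M r" and half_braiding_\<gamma>: "half_braiding AC (M, r) \<gamma>"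
begin

abbreviation "Gm t N n \<equiv> (n, [M, N], \<gamma> (N, t), [N, M])"

lemma M [simp]: "M \<in> Obj C" using mod by (rule module_obj)

lemma \<gamma>_iso: "module N t \<Longrightarrow> is_iso AC (M \<odot> N, diag_action M r N t) (N \<odot> M, diag_action N t M r) (\<gamma> (N, t))"
  using moncat.hb_iso[OF AC_moncat half_braiding_\<gamma>, of "(N, t)"] by simp

lemma \<gamma>_iso': "module N t \<Longrightarrow> is_iso C (M \<odot> N) (N \<odot> M) (\<gamma> (N, t))"
  using \<gamma>_iso[of N t] unfolding is_iso_def by auto

lemma \<gamma>_hom: "module N t \<Longrightarrow> \<gamma> (N, t) \<in> Hom C (M \<odot> N) (N \<odot> M)"
  using \<gamma>_iso' by (rule is_iso_hom)

lemma \<gamma>_linear: "module N t \<Longrightarrow> \<gamma> (N, t) \<cdot> diag_action M r N t = diag_action N t M r \<cdot> (\<one> A \<otimes> \<gamma> (N, t))"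
  using \<gamma>_iso[of N t] unfolding is_iso_def by simp

lemma \<gamma>_natural: "module N t \<Longrightarrow> module N' t' \<Longrightarrow> f \<in> Hom C N N' \<Longrightarrow> f \<cdot> t = t' \<cdot> (\<one> A \<otimes> f) \<Longrightarrow>
    (f \<otimes> \<one> M) \<cdot> \<gamma> (N, t) = \<gamma> (N', t') \<cdot> (\<one> M \<otimes> f)"
  using moncat.hb_natural[OF AC_moncat half_braiding_\<gamma>, of "(N, t)" "(N', t')" f] by simp

lemma \<gamma>_tensor: "module N t \<Longrightarrow> module N' t' \<Longrightarrow>
    \<gamma> (N \<odot> N', diag_action N t N' t') = (\<one> N \<otimes> \<gamma> (N', t')) \<cdot> (\<gamma> (N, t) \<otimes> \<one> N')"
  using moncat.hb_tensor[OF AC_moncat half_braiding_\<gamma>, of "(N, t)" "(N', t')"] by simp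

lemma \<gamma>_unit: "\<gamma> (TensorUnit C, \<epsilon>) = \<one> M"
  using moncat.hb_unit[OF AC_moncat half_braiding_\<gamma>] by simp

lemma Gm_cell [simp]: "module N t \<Longrightarrow> cell ([M, N], \<gamma> (N, t), [N, M])"
  using \<gamma>_hom[of N t] by (simp add: cell_iff)

text \<open>The tensor axiom of \<open>\<gamma>\<close> on words of two modules. It turns naturality at module morphisms between such words
  into the three rules that follow.\<close>

lemma Gm_pair:
  assumes "module N t" "module N' t'"
  shows "cell ([M, N, N'], \<gamma> (N \<odot> N', diag_action N t N' t'), [N, N', M])"
    and "has n [M, N, N'] x \<Longrightarrow> (n, [M, N, N'], \<gamma> (N \<odot> N', diag_action N t N' t'), [N, N', M]) \<bullet> x = Gm t' N' (n + 1) \<bullet> Gm t N n \<bullet> x"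
proof -
  have e: "\<gamma> (N \<odot> N', diag_action N t N' t') = expr [M, N, N'] [Gm t' N' 1, Gm t N 0]"
    using assms \<gamma>_tensor[OF assms] by simp
  have f: "final [M, N, N'] [Gm t' N' 1, Gm t N 0] = Some [N, N', M]" using assms by simp
  show "cell ([M, N, N'], \<gamma> (N \<odot> N', diag_action N t N' t'), [N, N', M])" unfolding e by (rule expr_cell[OF f])
  show "has n [M, N, N'] x \<Longrightarrow> (n, [M, N, N'], \<gamma> (N \<odot> N', diag_action N t N' t'), [N, N', M]) \<bullet> x = Gm t' N' (n + 1) \<bullet> Gm t N n \<bullet> x"
    unfolding e using expr_act[OF f] by simp
qed

lemma Gm_box21:
  assumes N: "module N t" "module N' t'" "module P s" and f: "cell ([N, N'], f, [P])" "f \<cdot> diag_action N t N' t' = s \<cdot> (\<one> A \<otimes> f)"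
    and h: "has n [M, N, N'] x"
  shows "(n, [N, N'], f, [P]) \<bullet> Gm t' N' (n + 1) \<bullet> Gm t N n \<bullet> x = Gm s P n \<bullet> (n + 1, [N, N'], f, [P]) \<bullet> x"
proof -
  note p = Gm_pair[OF N(1,2)]
  have o: "N \<in> Obj C" "N' \<in> Obj C" "P \<in> Obj C" using N by simp_all
  have "expr [M, N, N'] [(0, [N, N'], f, [P]), (0, [M, N, N'], \<gamma> (N \<odot> N', diag_action N t N' t'), [N, N', M])]
    = expr [M, N, N'] [Gm s P 0, (1, [N, N'], f, [P])]"
    using \<gamma>_natural[OF diag_action_module[OF N(1,2)] N(3) _ f(2)] p(1) f(1) N o by (simp add: cell_iff[of "[N, N']"])
  from run_law[OF _ _ this h, of "[P, M]"] show ?thesis using p(1) p(2)[OF h] f(1) N o by simp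
qed

lemma Gm_box12:
  assumes N: "module N t" "module N' t'" "module P s" and f: "cell ([P], f, [N, N'])" "f \<cdot> s = diag_action N t N' t' \<cdot> (\<one> A \<otimes> f)"
    and h: "has n [M, P] x"
  shows "(n, [P], f, [N, N']) \<bullet> Gm s P n \<bullet> x = Gm t' N' (n + 1) \<bullet> Gm t N n \<bullet> (n + 1, [P], f, [N, N']) \<bullet> x"
proof -
  note p = Gm_pair[OF N(1,2)]
  have o: "N \<in> Obj C" "N' \<in> Obj C" "P \<in> Obj C" using N by simp_all
  have "expr [M, P] [(0, [P], f, [N, N']), Gm s P 0] = expr [M, P] [Gm t' N' 1, Gm t N 0, (1, [P], f, [N, N'])]"
  proof -
    have "expr [M, P] [(0, [P], f, [N, N']), Gm s P 0]
      = expr [M, P] [(0, [M, N, N'], \<gamma> (N \<odot> N', diag_action N t N' t'), [N, N', M]), (1, [P], f, [N, N'])]"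
      using \<gamma>_natural[OF N(3) diag_action_module[OF N(1,2)] _ f(2)] p(1) f(1) N o by (simp add: cell_iff[of "[P]"])
    also have "\<dots> = expr [M, P] [Gm t' N' 1, Gm t N 0, (1, [P], f, [N, N'])]"
      by (rule expr_eqI[where V = "[N, N', M]"]) (use p f N o in \<open>simp_all add: has_def\<close>)
    finally show ?thesis .
  qed
  from run_law[OF _ _ this h, of "[N, N', M]"] show ?thesis using p(1) f(1) N o by simp
qed

lemma Gm_box22:
  assumes N: "module N t" "module N' t'" "module P s" "module P' s'" and f: "cell ([N, N'], f, [P, P'])"
    "f \<cdot> diag_action N t N' t' = diag_action P s P' s' \<cdot> (\<one> A \<otimes> f)"
    and h: "has n [M, N, N'] x"
  shows "(n, [N, N'], f, [P, P']) \<bullet> Gm t' N' (n + 1) \<bullet> Gm t N n \<bullet> x = Gm s' P' (n + 1) \<bullet> Gm s P n \<bullet> (n + 1, [N, N'], f, [P, P']) \<bullet> x"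
proof -
  note p = Gm_pair[OF N(1,2)] and q = Gm_pair[OF N(3,4)]
  have o: "N \<in> Obj C" "N' \<in> Obj C" "P \<in> Obj C" "P' \<in> Obj C" using N by simp_all
  have "expr [M, N, N'] [(0, [N, N'], f, [P, P']), Gm t' N' 1, Gm t N 0] = expr [M, N, N'] [Gm s' P' 1, Gm s P 0, (1, [N, N'], f, [P, P'])]"
  proof -
    have "expr [M, N, N'] [(0, [N, N'], f, [P, P']), Gm t' N' 1, Gm t N 0]
      = expr [M, N, N'] [(0, [N, N'], f, [P, P']), (0, [M, N, N'], \<gamma> (N \<odot> N', diag_action N t N' t'), [N, N', M])]"
      by (rule expr_eqI[where V = "[P, P', M]"]) (use p q f N o in \<open>simp_all add: has_def\<close>)
    also have "\<dots> = expr [M, N, N'] [(0, [M, P, P'], \<gamma> (P \<odot> P', diag_action P s P' s'), [P, P', M]), (1, [N, N'], f, [P, P'])]"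
      using \<gamma>_natural[OF diag_action_module[OF N(1,2)] diag_action_module[OF N(3,4)] _ f(2)] p(1) q(1) f(1) N o by (simp add: cell_iff[of "[N, N']"])
    also have "\<dots> = expr [M, N, N'] [Gm s' P' 1, Gm s P 0, (1, [N, N'], f, [P, P'])]"
      by (rule expr_eqI[where V = "[P, P', M]"]) (use p q f N o in \<open>simp_all add: has_def\<close>)
    finally show ?thesis .
  qed
  from run_law[OF _ _ this h, of "[P, P', M]"] show ?thesis using f(1) N o by simp
qed

text \<open>The half braiding of \<open>C\<close> and the coaction that \<open>\<gamma>\<close> determines.\<close>

definition "sig = (\<lambda>X\<in>Obj C. \<gamma> (X, trivial X))"
definition "del = \<gamma> (A, m) \<cdot> (\<one> M \<otimes> u)"

lemma del_expr: "del = expr [M] [Gm m A 0, Eta 1]"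
  using regular_module by (simp add: del_def)

lemma del_cell [simp]: "cell ([M], del, [A, M])"
  unfolding del_expr by (rule expr_cell) (use regular_module in simp)

lemma del_act: "has n [M] x \<Longrightarrow> Co del M n \<bullet> x = Gm m A n \<bullet> Eta (n + 1) \<bullet> x"
  using expr_act[of "[M]" "[Gm m A 0, Eta 1]" "[A, M]" n x] regular_module by (simp add: del_def)

lemma sig_half_braiding: "half_braiding C M sig"
  unfolding half_braiding_def sig_def
  using \<gamma>_iso'[OF trivial_module] \<gamma>_natural[OF trivial_module trivial_module _ trivial_hom] \<gamma>_tensor[OF trivial_module trivial_module]
  by (auto simp: tensor_obj trivial_tensor)

lemma sig_cell [simp]: "X \<in> Obj C \<Longrightarrow> cell ([M, X], sig X, [X, M])"
  using half_braiding_cell[OF sig_half_braiding] by simp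

lemma sig_\<gamma>: "X \<in> Obj C \<Longrightarrow> \<gamma> (X, trivial X) = sig X"
  by (simp add: sig_def)

text \<open>The action \<open>t\<close> is a module morphism from the free module on \<open>N\<close>.\<close>

lemma free_act:
  assumes "module N t"
  shows "t \<cdot> diag_action A m N (trivial N) = t \<cdot> (\<one> A \<otimes> t)"
proof -
  have o: "N \<in> Obj C" using assms by simp
  note c = structure_cell(1) trivial_cell[OF o]
  have "expr [A, A, N] [Ac t N 0, (0, [A, A, N], diag_action A m N (trivial N), [A, N])] = expr [A, A, N] [Ac t N 0, Ac t N 1]"
    by (rule expr_eqI[where V = "[N]"])
      (use o assms diag_action_cell[OF c] in \<open>simp_all add: bialgebra_moves diag_action_act[OF c] trivial_act act_mult slide_right_out\<close>)
  then show ?thesis using o assms diag_action_cell[OF c] by simp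
qed

text \<open>Naturality of \<open>\<gamma>\<close> at this morphism, evaluated at the unit of \<open>A\<close>.\<close>

lemma \<gamma>_eq_yd_braid:
  assumes N: "module N t" shows "\<gamma> (N, t) = yd_braid M sig del N t"
proof -
  have o: "N \<in> Obj C" using N by simp
  note gc = yd_braid_cell[OF del_cell sig_half_braiding module_cell[OF N]]
  have "expr [M, N] [Gm t N 0] = expr [M, N] [Ga M sig del N t 0]"
    by (rule expr_eqI[where V = "[N, M]"])
     (use N o gc Gm_box21[OF regular_module trivial_module[OF o] N module_cell[OF N] free_act[OF N], of 0]
       in \<open>simp_all add: has_def yd_braid_act[OF del_cell sig_half_braiding] del_act sig_\<gamma> act_unit\<close>)
  then show ?thesis by simp
qed

text \<open>On a trivial module \<open>X\<close>, both diagonal actions lose one of the two copies of \<open>A\<close>, and linearity of \<open>\<gamma>\<close> becomes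
  centrality of \<open>r\<close>.\<close>

lemma r_central: "r \<in> Hom (center C) (A \<odot> M, half_tensor A \<kappa> M sig) (M, sig)"
proof -
  have c: "cell ([A, M], r, [M])" by simp
  have "(\<one> X \<otimes> r) \<cdot> half_tensor A \<kappa> M sig X = sig X \<cdot> (r \<otimes> \<one> X)" if X: "X \<in> Obj C" for X
  proof -
    note ct = trivial_cell[OF X] and cr = module_cell[OF mod]
    note tc = diag_action_cell[OF ct cr] diag_action_cell[OF cr ct] and ht = half_tensor_cell[OF A hbA M sig_half_braiding X]
    have "expr [A, M, X] [Cr M sig X 0, (0, [A, M, X], diag_action M r X (trivial X), [M, X])]
      = expr [A, M, X] [(0, [A, X, M], diag_action X (trivial X) M r, [X, M]), Cr M sig X 1]"
      using \<gamma>_linear[OF trivial_module[OF X]] X tc by (simp add: sig_\<gamma>)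
    from run_law[OF _ _ this, of "[X, M]" 0 "init [A, M, X]"]
    have eq: "Cr M sig X 0 \<bullet> (0, [A, M, X], diag_action M r X (trivial X), [M, X]) \<bullet> init [A, M, X]
      = (0, [A, X, M], diag_action X (trivial X) M r, [X, M]) \<bullet> Cr M sig X 1 \<bullet> init [A, M, X]"
      using X tc by (simp add: has_def)
    have "expr [A, M, X] [(1, [A, M], r, [M]), (0, [A, M, X], half_tensor A \<kappa> M sig X, [X, A, M])]
      = expr [A, M, X] [Cr M sig X 0, (0, [A, M], r, [M])]"
    proof (rule expr_eqI[where V = "[X, M]"])
      have "Cr M sig X 0 \<bullet> Ac r M 0 \<bullet> init [A, M, X] = Cr M sig X 0 \<bullet> (0, [A, M, X], diag_action M r X (trivial X), [M, X]) \<bullet> init [A, M, X]"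
        using X tc ct by (simp add: bialgebra_moves diag_action_act[OF cr ct] trivial_act slide_right_out)
      also have "\<dots> = Ac r M 1 \<bullet> Si X 0 \<bullet> Cr M sig X 1 \<bullet> init [A, M, X]"
        unfolding eq using X tc ct by (simp add: bialgebra_moves diag_action_act[OF ct cr] trivial_act slide_right_out)
      finally show "run 0 [(1, [A, M], r, [M]), (0, [A, M, X], half_tensor A \<kappa> M sig X, [X, A, M])] (init [A, M, X])
        = run 0 [Cr M sig X 0, (0, [A, M], r, [M])] (init [A, M, X])"
        using X half_tensor_act[OF A hbA M sig_half_braiding X, of 0 "init [A, M, X]"] by (simp add: has_def)
    qed (use X ht in simp_all)
    then show ?thesis using X ht by simp
  qed
  then show ?thesis using c by (simp add: cell_iff)
qed

text \<open>The half braiding of \<open>A\<close> is a module morphism between the two tensor products of the regular module with a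
  trivial module, since \<open>m\<close> is central.\<close>

lemma \<kappa>_free_hom:
  assumes X: "X \<in> Obj C"
  shows "\<kappa> X \<cdot> diag_action A m X (trivial X) = diag_action X (trivial X) A m \<cdot> (\<one> A \<otimes> \<kappa> X)"
proof -
  note ct = trivial_cell[OF X] and cm = structure_cell(1)
  note tc = diag_action_cell[OF ct cm] diag_action_cell[OF cm ct]
  have "expr [A, A, X] [Si X 0, (0, [A, A, X], diag_action A m X (trivial X), [A, X])]
    = expr [A, A, X] [(0, [A, X, A], diag_action X (trivial X) A m, [X, A]), Si X 1]"
    by (rule expr_eqI[where V = "[X, A]"])
     (use X tc ct in \<open>simp_all add: bialgebra_moves diag_action_act[OF ct cm] diag_action_act[OF cm ct] trivial_act slide_right_out\<close>)
  then show ?thesis using X tc by simp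
qed

text \<open>Naturality of \<open>\<gamma>\<close> at the morphism \<open>\<kappa> X\<close>, evaluated at the unit of \<open>A\<close>.\<close>

lemma del_central: "del \<in> Hom (center C) (M, sig) (A \<odot> M, half_tensor A \<kappa> M sig)"
proof -
  have "(\<one> X \<otimes> del) \<cdot> sig X = half_tensor A \<kappa> M sig X \<cdot> (del \<otimes> \<one> X)" if X: "X \<in> Obj C" for X
  proof -
    note ht = half_tensor_cell[OF A hbA M sig_half_braiding X]
    let ?i = "init [M, X]"
    have "expr [M, X] [Co del M 1, Cr M sig X 0]
      = expr [M, X] [(0, [A, M, X], half_tensor A \<kappa> M sig X, [X, A, M]), Co del M 0]"
    proof (rule expr_eqI[where V = "[X, A, M]"])
      have "Co del M 1 \<bullet> Cr M sig X 0 \<bullet> ?i = Gm m A 1 \<bullet> Cr M sig X 0 \<bullet> Eta 2 \<bullet> ?i"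
        using X regular_module by (simp add: del_act has_def slide_right_in)
      also have "\<dots> = Gm m A 1 \<bullet> Gm (trivial X) X 0 \<bullet> Si X 1 \<bullet> Eta 1 \<bullet> ?i"
        using X by (simp add: bialgebra_moves sig_\<gamma>)
      also have "\<dots> = Si X 0 \<bullet> Gm (trivial X) X 1 \<bullet> Gm m A 0 \<bullet> Eta 1 \<bullet> ?i"
        using X Gm_box22[OF regular_module trivial_module[OF X] trivial_module[OF X] regular_module Si_cell[OF X] \<kappa>_free_hom[OF X], of 0 "Eta 1 \<bullet> ?i"]
        by (simp add: has_def)
      also have "\<dots> = Si X 0 \<bullet> Cr M sig X 1 \<bullet> Co del M 0 \<bullet> ?i"
        using X by (simp add: has_def del_act sig_\<gamma>)
      finally show "run 0 [Co del M 1, Cr M sig X 0] ?i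
        = run 0 [(0, [A, M, X], half_tensor A \<kappa> M sig X, [X, A, M]), Co del M 0] ?i"
        using X half_tensor_act[OF A hbA M sig_half_braiding X, of 0 "Co del M 0 \<bullet> ?i"] by (simp add: has_def)
    qed (use X ht in simp_all)
    then show ?thesis using X ht by simp
  qed
  then show ?thesis using del_cell by (simp add: cell_iff)
qed

text \<open>\<open>\<Delta>\<close> is a module morphism from the regular module to its tensor square, because it is multiplicative.\<close>

lemma del_coassoc: "(\<Delta> \<otimes> \<one> M) \<cdot> del = (\<one> A \<otimes> del) \<cdot> del"
proof -
  note c = structure_cell(1) and tc = diag_action_cell[OF structure_cell(1,1)]
  have "expr [A, A] [De 0, Mu 0] = expr [A, A] [(0, [A, A, A], diag_action A m A m, [A, A]), De 1]"
    by (rule expr_eqI[where V = "[A, A]"]) (use tc in \<open>simp_all add: has_def comult_mult diag_action_act[OF c c]\<close>)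
  then have h: "\<Delta> \<cdot> m = diag_action A m A m \<cdot> (\<one> A \<otimes> \<Delta>)" using tc by simp
  note nat = Gm_box12[OF regular_module regular_module regular_module structure_cell(3) h]
  have "expr [M] [De 0, Co del M 0] = expr [M] [Co del M 1, Co del M 0]"
    by (rule expr_eqI[where V = "[A, A, M]"])
      (use regular_module in \<open>simp_all add: has_def del_act nat comult_unit slide_right_out\<close>)
  then show ?thesis by simp
qed

lemma del_counit: "(\<epsilon> \<otimes> \<one> M) \<cdot> del = \<one> M"
proof -
  have "(\<epsilon> \<otimes> \<one> M) \<cdot> \<gamma> (A, m) = \<gamma> (TensorUnit C, \<epsilon>) \<cdot> (\<one> M \<otimes> \<epsilon>)"
  proof (rule \<gamma>_natural[OF regular_module module_unit])
    have "expr [A, A] [Ep 0, Mu 0] = expr [A, A] [Ep 0, Ep 1]"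
      by (rule expr_eqI[where V = "[]"]) (simp_all add: bialgebra_moves)
    then show "\<epsilon> \<cdot> m = \<epsilon> \<cdot> (\<one> A \<otimes> \<epsilon>)" by simp
  qed (use structure_cell(4) in \<open>simp add: cell_iff\<close>)
  then have e: "expr [M, A] [Ep 0, Gm m A 0] = \<one> M \<cdot> expr [M, A] [Ep 1]"
    using regular_module by (simp add: \<gamma>_unit)
  also have "\<dots> = expr [M, A] [Ep 1]"
    using expr_cell[of "[M, A]" "[Ep 1]" "[M]"] comp_ident_left[of "M \<odot> A" M] 
    by (simp add: cell_iff[of _ "\<one> M \<otimes> \<epsilon>"] tensor_obj)
  finally have e: "expr [M, A] [Ep 0, Gm m A 0] = expr [M, A] [Ep 1]" .
  have nat: "Ep n \<bullet> Gm m A n \<bullet> x = Ep (n + 1) \<bullet> x" if "has n [M, A] x" for n x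
    using run_law[OF _ _ e that, of "[M]"] regular_module by simp
  have "expr [M] [Ep 0, Co del M 0] = expr [M] []"
    by (rule expr_eqI[where V = "[M]"]) (use regular_module in \<open>simp_all add: has_def del_act nat counit_unit\<close>)
  then show ?thesis by simp
qed

text \<open>The compatibility of \<open>r\<close> and \<open>\<delta>\<close> is linearity of \<open>\<gamma> (A, m)\<close>, evaluated at the unit in the last factor.\<close>

lemma yd: "yd M sig r del"
proof -
  note cr = module_cell[OF mod] and tc = diag_action_cell[OF module_cell[OF mod] structure_cell(1)] diag_action_cell[OF structure_cell(1) module_cell[OF mod]]
  let ?i = "init [A, M]"
  have "expr [A, M, A] [Gm m A 0, (0, [A, M, A], diag_action M r A m, [M, A])] = expr [A, M, A] [(0, [A, A, M], diag_action A m M r, [A, M]), Gm m A 1]"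
    using \<gamma>_linear[OF regular_module] tc regular_module by simp
  from run_law[OF _ _ this, of "[A, M]" 0 "Eta 2 \<bullet> ?i"]
  have eq: "Gm m A 0 \<bullet> (0, [A, M, A], diag_action M r A m, [M, A]) \<bullet> Eta 2 \<bullet> ?i
    = (0, [A, A, M], diag_action A m M r, [A, M]) \<bullet> Gm m A 1 \<bullet> Eta 2 \<bullet> ?i"
    using tc regular_module by (simp add: has_def)
  have "expr [A, M] [Mu 0, Cr M sig A 1, Co del M 0, Ac r M 0, Si M 1, De 0]
    = expr [A, M] [Mu 0, Ac r M 2, Si A 1, De 0, Co del M 1]"
  proof (rule expr_eqI[where V = "[A, M]"])
    have "Mu 0 \<bullet> Cr M sig A 1 \<bullet> Co del M 0 \<bullet> Ac r M 0 \<bullet> Si M 1 \<bullet> De 0 \<bullet> ?i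
      = Gm m A 0 \<bullet> Ac r M 0 \<bullet> Si M 1 \<bullet> De 0 \<bullet> ?i"
      using cr by (simp add: \<gamma>_eq_yd_braid[OF regular_module] has_def yd_braid_act[OF del_cell sig_half_braiding structure_cell(1)])
    also have "\<dots> = Gm m A 0 \<bullet> (0, [A, M, A], diag_action M r A m, [M, A]) \<bullet> Eta 2 \<bullet> ?i"
      using cr tc regular_module by (simp add: has_def diag_action_act[OF cr structure_cell(1)] slide_right_out mult_unit)
    also have "\<dots> = Mu 0 \<bullet> Ac r M 2 \<bullet> Si A 1 \<bullet> De 0 \<bullet> Co del M 1 \<bullet> ?i"
      unfolding eq using cr tc regular_module by (simp add: has_def diag_action_act[OF structure_cell(1) cr] del_act)
    finally show "run 0 [Mu 0, Cr M sig A 1, Co del M 0, Ac r M 0, Si M 1, De 0] ?i = run 0 [Mu 0, Ac r M 2, Si A 1, De 0, Co del M 1] ?i"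
      by simp
  qed (use cr in simp_all)
  then show ?thesis
    using yd_exprs[OF M sig_half_braiding cr del_cell] sig_half_braiding r_central del_central del_coassoc del_counit
    unfolding yd_def by simp
qed

end

section \<open>The bijection on objects, morphisms and tensor products\<close>

context central_bialgebra
begin

abbreviation "YD \<equiv> yetter_drinfeld (center C) alg"

definition to_center :: "('o \<times> ('o \<Rightarrow> 'a)) \<times> 'a \<times> 'a \<Rightarrow> ('o \<times> 'a) \<times> ('o \<times> 'a \<Rightarrow> 'a)" where
  "to_center = (\<lambda>((M, \<sigma>), r, \<delta>). ((M, r), \<lambda>(N, t)\<in>Obj AC. yd_braid M \<sigma> \<delta> N t))"

definition from_center :: "('o \<times> 'a) \<times> ('o \<times> 'a \<Rightarrow> 'a) \<Rightarrow> ('o \<times> ('o \<Rightarrow> 'a)) \<times> 'a \<times> 'a" where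
  "from_center = (\<lambda>((M, r), \<gamma>). ((M, \<lambda>X\<in>Obj C. \<gamma> (X, trivial X)), r, \<gamma> (A, m) \<cdot> (\<one> M \<otimes> u)))"

definition diag_coaction :: "'o \<Rightarrow> ('o \<Rightarrow> 'a) \<Rightarrow> 'a \<Rightarrow> 'o \<Rightarrow> 'a \<Rightarrow> 'a" where
  "diag_coaction M \<sigma> \<delta> N \<delta>' = (m \<otimes> \<one> (M \<odot> N)) \<cdot> (\<one> A \<otimes> \<sigma> A \<otimes> \<one> N) \<cdot> (\<delta> \<otimes> \<delta>')"

lemma YD_simps [simp]:
  "((M, \<sigma>), r, \<delta>) \<in> Obj YD \<longleftrightarrow> yd M \<sigma> r \<delta>"
  "f \<in> Hom YD ((M, \<sigma>), r, \<delta>) ((M', \<sigma>'), r', \<delta>') \<longleftrightarrow> f \<in> Hom (center C) (M, \<sigma>) (M', \<sigma>') \<and>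
     f \<cdot> r = r' \<cdot> (\<one> A \<otimes> f) \<and> \<delta>' \<cdot> f = (\<one> A \<otimes> f) \<cdot> \<delta>"
  "Ident YD ((M, \<sigma>), r, \<delta>) = \<one> M"
  "Comp YD = Comp C" "TensorArr YD = TensorArr C"
  "TensorUnit YD = ((TensorUnit C, \<lambda>X\<in>Obj C. \<one> X), \<epsilon>, u)"
  "TensorObj YD ((M, \<sigma>), r, \<delta>) ((M', \<sigma>'), r', \<delta>') =
     ((M \<odot> M', half_tensor M \<sigma> M' \<sigma>'), diag_action M r M' r', diag_coaction M \<sigma> \<delta> M' \<delta>')"
  "Braid YD ((M, \<sigma>), r, \<delta>) ((M', \<sigma>'), r', \<delta>') = yd_braid M \<sigma> \<delta> M' r'"
  by (simp_all add: yetter_drinfeld_def yd_iff Let_def diag_action_def diag_coaction_def yd_braid_def del: center_simps(2))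

lemma yd_counit: "yd M \<sigma> r \<delta> \<Longrightarrow> (\<epsilon> \<otimes> \<one> M) \<cdot> \<delta> = \<one> M"
  by (simp add: yd_def)

lemma ydD:
  assumes "yd M \<sigma> r \<delta>"
  shows "M \<in> Obj C" "half_braiding C M \<sigma>" "module M r" "cell ([M], \<delta>, [A, M])"
proof -
  interpret yd_object C A \<kappa> m u \<Delta> \<epsilon> M \<sigma> r \<delta> by unfold_locales (rule assms)
  show "M \<in> Obj C" "half_braiding C M \<sigma>" "module M r" "cell ([M], \<delta>, [A, M])" using hb by simp_all
qed

lemma from_to_center:
  assumes "M \<in> Obj C" "half_braiding C M \<sigma>" "cell ([M], \<delta>, [A, M])" "(\<epsilon> \<otimes> \<one> M) \<cdot> \<delta> = \<one> M"
  shows "from_center (to_center ((M, \<sigma>), r, \<delta>)) = ((M, \<sigma>), r, \<delta>)"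
proof -
  have "\<sigma> \<in> extensional (Obj C)" using assms(2) by (simp add: half_braiding_def)
  then have "(\<lambda>X\<in>Obj C. (\<lambda>(N, t)\<in>Obj AC. yd_braid M \<sigma> \<delta> N t) (X, trivial X)) = \<sigma>"
    by (intro extensionalityI[of _ "Obj C"]) (use yd_braid_trivial[OF assms] in auto)
  then show ?thesis
    using yd_braid_regular[OF assms(1-3)] regular_module by (simp add: from_center_def to_center_def)
qed

lemma from_center:
  assumes "Y \<in> Obj (center AC)"
  shows "from_center Y \<in> Obj YD" "to_center (from_center Y) = Y"
proof -
  obtain M r \<gamma> where Y: "Y = ((M, r), \<gamma>)" by (metis surj_pair)
  have mr: "module M r" "half_braiding AC (M, r) \<gamma>"
    using assms moncat.center_simps(1)[OF AC_moncat, of "(M, r)" \<gamma>] by (simp_all add: Y)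
  interpret hb_module C A \<kappa> m u \<Delta> \<epsilon> M r \<gamma> by unfold_locales (fact mr)+
  have fc: "from_center Y = ((M, sig), r, del)" by (simp add: Y from_center_def sig_def del_def)
  show "from_center Y \<in> Obj YD" using yd by (simp add: fc)
  have "\<gamma> \<in> extensional (Obj AC)" using mr(2) by (simp add: half_braiding_def)
  then have "(\<lambda>(N, t)\<in>Obj AC. yd_braid M sig del N t) = \<gamma>"
    by (intro extensionalityI[of _ "Obj AC"]) (use \<gamma>_eq_yd_braid in auto)
  then show "to_center (from_center Y) = Y" unfolding fc by (simp add: to_center_def Y)
qed

lemma AC_ball: "(\<forall>X\<in>Obj AC. P X) \<longleftrightarrow> (\<forall>N t. module N t \<longrightarrow> P (N, t))"
  by (metis AC_simps(1) surj_pair)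

text \<open>A morphism of Yetter--Drinfeld modules commutes with each constituent of \<open>\<gamma>\<close>. Conversely, compatibility with
  \<open>\<gamma>\<close> at trivial modules is compatibility with \<open>\<sigma>\<close>, and compatibility with \<open>\<gamma> (A, m)\<close>, evaluated at the unit, is
  colinearity.\<close>

lemma hom_to_center:
  assumes X: "X \<in> Obj YD" and Y: "Y \<in> Obj YD"
  shows "Hom YD X Y = Hom (center AC) (to_center X) (to_center Y)"
proof -
  obtain M \<sigma> r \<delta> M' \<sigma>' r' \<delta>' where eq: "X = ((M, \<sigma>), r, \<delta>)" "Y = ((M', \<sigma>'), r', \<delta>')" by (metis surj_pair)
  have yd: "yd M \<sigma> r \<delta>" "yd M' \<sigma>' r' \<delta>'" using X Y by (simp_all add: eq)
  note D = ydD[OF yd(1)] and D' = ydD[OF yd(2)]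
  have rhs: "f \<in> Hom (center AC) (to_center X) (to_center Y) \<longleftrightarrow> f \<in> Hom C M M' \<and> f \<cdot> r = r' \<cdot> (\<one> A \<otimes> f) \<and>
    (\<forall>N t. module N t \<longrightarrow> (\<one> N \<otimes> f) \<cdot> yd_braid M \<sigma> \<delta> N t = yd_braid M' \<sigma>' \<delta>' N t \<cdot> (f \<otimes> \<one> N))" for f
    by (simp add: eq to_center_def moncat.center_simps(2)[OF AC_moncat] AC_ball)
  have lr: "(\<one> N \<otimes> f) \<cdot> yd_braid M \<sigma> \<delta> N t = yd_braid M' \<sigma>' \<delta>' N t \<cdot> (f \<otimes> \<one> N)"
    if f: "f \<in> Hom (center C) (M, \<sigma>) (M', \<sigma>')" "\<delta>' \<cdot> f = (\<one> A \<otimes> f) \<cdot> \<delta>" and N: "module N t" for f N t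
  proof -
    note c = module_cell[OF N] and o = module_obj[OF N]
    note gc = yd_braid_cell[OF D(4,2) c] yd_braid_cell[OF D'(4,2) c] and cr = half_braiding_cell[OF D(2,1) o] half_braiding_cell[OF D'(2,1) o]
    have cf: "cell ([M], f, [M'])" using f D D' by (simp add: cell_iff)
    have e: "expr [M] [(1, [M], f, [M']), Co \<delta> M 0] = expr [M] [Co \<delta>' M' 0, (0, [M], f, [M'])]"
      using f(2) D D' cf by simp
    have co: "(k, [M], f, [M']) \<bullet> Co \<delta> M n \<bullet> x = Co \<delta>' M' n \<bullet> (n, [M], f, [M']) \<bullet> x" if "has n [M] x" "k = n + 1" for n k x
      using run_law[OF _ _ e that(1), of "[A, M']"] D D' cf that(2) by simp
    have "expr [M, N] [(1, [M], f, [M']), Ga M \<sigma> \<delta> N t 0] = expr [M, N] [Ga M' \<sigma>' \<delta>' N t 0, (0, [M], f, [M'])]"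
    proof (rule expr_eqI[where V = "[N, M']"])
      let ?i = "init [M, N]"
      have "(1, [M], f, [M']) \<bullet> Ga M \<sigma> \<delta> N t 0 \<bullet> ?i = Ac t N 0 \<bullet> (2, [M], f, [M']) \<bullet> Cr M \<sigma> N 1 \<bullet> Co \<delta> M 0 \<bullet> ?i"
        using c o D by (simp add: has_def yd_braid_act[OF D(4,2)] slide_right_in)
      also have "\<dots> = Ac t N 0 \<bullet> Cr M' \<sigma>' N 1 \<bullet> (1, [M], f, [M']) \<bullet> Co \<delta> M 0 \<bullet> ?i"
        using ctr_box11[OF D'(1,2) D(1,2) f(1) o, of 1 "Co \<delta> M 0 \<bullet> ?i"] D o by (simp add: has_def)
      also have "\<dots> = Ga M' \<sigma>' \<delta>' N t 0 \<bullet> (0, [M], f, [M']) \<bullet> ?i"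
        using c o D D' cf by (simp add: has_def co yd_braid_act[OF D'(4,2)])
      finally show "run 0 [(1, [M], f, [M']), Ga M \<sigma> \<delta> N t 0] ?i = run 0 [Ga M' \<sigma>' \<delta>' N t 0, (0, [M], f, [M'])] ?i" by simp
    qed (use c o D D' cf gc in simp_all)
    then show ?thesis using c o D D' cf gc by simp
  qed
  have rl: "(\<forall>X\<in>Obj C. (\<one> X \<otimes> f) \<cdot> \<sigma> X = \<sigma>' X \<cdot> (f \<otimes> \<one> X))" "\<delta>' \<cdot> f = (\<one> A \<otimes> f) \<cdot> \<delta>"
    if f: "f \<in> Hom C M M'" and g: "\<And>N t. module N t \<Longrightarrow> (\<one> N \<otimes> f) \<cdot> yd_braid M \<sigma> \<delta> N t = yd_braid M' \<sigma>' \<delta>' N t \<cdot> (f \<otimes> \<one> N)" for f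
  proof -
    have cf: "cell ([M], f, [M'])" using f D D' by (simp add: cell_iff)
    show "\<forall>X\<in>Obj C. (\<one> X \<otimes> f) \<cdot> \<sigma> X = \<sigma>' X \<cdot> (f \<otimes> \<one> X)"
      using g[OF trivial_module] yd_braid_trivial[OF D(1,2,4) yd_counit[OF yd(1)]] yd_braid_trivial[OF D'(1,2,4) yd_counit[OF yd(2)]] by simp
    note gc = yd_braid_cell[OF D(4,2) structure_cell(1)] yd_braid_cell[OF D'(4,2) structure_cell(1)]
    note e = yd_braid_regular[OF D(1,2,4)] yd_braid_regular[OF D'(1,2,4)]
    have r: "Ga M \<sigma> \<delta> A m 0 \<bullet> Eta 1 \<bullet> init [M] = Co \<delta> M 0 \<bullet> init [M]"
      using run_law[of "[M]" "[Ga M \<sigma> \<delta> A m 0, Eta 1]" "[A, M]" "[Co \<delta> M 0]" 0 "init [M]"] e(1) gc D by (simp add: has_def)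
    have r': "Ga M' \<sigma>' \<delta>' A m 0 \<bullet> Eta 1 \<bullet> (0, [M], f, [M']) \<bullet> init [M] = Co \<delta>' M' 0 \<bullet> (0, [M], f, [M']) \<bullet> init [M]"
      using run_law[of "[M']" "[Ga M' \<sigma>' \<delta>' A m 0, Eta 1]" "[A, M']" "[Co \<delta>' M' 0]" 0 "(0, [M], f, [M']) \<bullet> init [M]"] e(2) gc D D' cf by (simp add: has_def)
    have "expr [M, A] [(1, [M], f, [M']), Ga M \<sigma> \<delta> A m 0] = expr [M, A] [Ga M' \<sigma>' \<delta>' A m 0, (0, [M], f, [M'])]"
      using g[OF regular_module] cf gc D D' by simp
    from run_law[OF _ _ this, of "[A, M']" 0 "Eta 1 \<bullet> init [M]"]
    have "(1, [M], f, [M']) \<bullet> Ga M \<sigma> \<delta> A m 0 \<bullet> Eta 1 \<bullet> init [M] = Ga M' \<sigma>' \<delta>' A m 0 \<bullet> (0, [M], f, [M']) \<bullet> Eta 1 \<bullet> init [M]"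
      using cf gc D D' by (simp add: has_def)
    also have "(0, [M], f, [M']) \<bullet> Eta 1 \<bullet> init [M] = Eta 1 \<bullet> (0, [M], f, [M']) \<bullet> init [M]"
      by (simp add: slide_right_out)
    finally have "expr [M] [(1, [M], f, [M']), Co \<delta> M 0] = expr [M] [Co \<delta>' M' 0, (0, [M], f, [M'])]"
      by (intro expr_eqI[where V = "[A, M']"]) (use r r' cf D D' in simp_all)
    then show "\<delta>' \<cdot> f = (\<one> A \<otimes> f) \<cdot> \<delta>" using cf D D' by simp
  qed
  show ?thesis
  proof (rule set_eqI)
    fix f
    have "f \<in> Hom YD X Y \<longleftrightarrow> f \<in> Hom (center C) (M, \<sigma>) (M', \<sigma>') \<and> f \<cdot> r = r' \<cdot> (\<one> A \<otimes> f) \<and> \<delta>' \<cdot> f = (\<one> A \<otimes> f) \<cdot> \<delta>"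
      by (simp only: eq YD_simps)
    then show "f \<in> Hom YD X Y \<longleftrightarrow> f \<in> Hom (center AC) (to_center X) (to_center Y)"
      unfolding rhs using lr[of f] rl[of f] by auto
  qed
qed

lemma diag_coaction_expr:
  assumes "cell ([M], \<delta>, [A, M])" "cell ([N], \<delta>', [A, N])" "half_braiding C M \<sigma>"
  shows "diag_coaction M \<sigma> \<delta> N \<delta>' = expr [M, N] [Mu 0, Cr M \<sigma> A 1, Co \<delta> M 0, Co \<delta>' N 1]"
proof -
  have o: "M \<in> Obj C" "N \<in> Obj C" using assms by (simp_all add: cell_iff)
  note cs = half_braiding_cell[OF assms(3) o(1) A] and ct = cell_tensor[OF assms(1,2), simplified]
  have "diag_coaction M \<sigma> \<delta> N \<delta>' = expr [M, N] [Mu 0, Cr M \<sigma> A 1, (0, [M, N], \<delta> \<otimes> \<delta>', [A, M, A, N])]"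
    using o cs ct by (simp add: diag_coaction_def)
  also have "\<dots> = expr [M, N] [Mu 0, Cr M \<sigma> A 1, Co \<delta> M 0, Co \<delta>' N 1]"
    by (rule expr_eqI[where V = "[A, M, N]"])
      (use assms o cs ct in \<open>simp_all add: has_def cell_tensor_act[OF assms(1,2), simplified]\<close>)
  finally show ?thesis .
qed

text \<open>The second statement is what shows that the tensor product is a Yetter--Drinfeld module at all: by the first
  one its image lies in the center, and the inverse assignment sends this image back to it. Only the counit axiom
  of the diagonal coaction is verified directly.\<close>

lemma tensor_to_center:
  assumes X: "X \<in> Obj YD" and Y: "Y \<in> Obj YD"
  shows "to_center (X \<odot>\<^bsub>YD\<^esub> Y) = to_center X \<odot>\<^bsub>center AC\<^esub> to_center Y"
    and "from_center (to_center (X \<odot>\<^bsub>YD\<^esub> Y)) = X \<odot>\<^bsub>YD\<^esub> Y"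
proof -
  obtain M \<sigma> r \<delta> M' \<sigma>' r' \<delta>' where eq: "X = ((M, \<sigma>), r, \<delta>)" "Y = ((M', \<sigma>'), r', \<delta>')" by (metis surj_pair)
  have yd: "yd M \<sigma> r \<delta>" "yd M' \<sigma>' r' \<delta>'" using X Y by (simp_all add: eq)
  note D = ydD[OF yd(1)] and D' = ydD[OF yd(2)]
  interpret M: yd_object C A \<kappa> m u \<Delta> \<epsilon> M \<sigma> r \<delta> by unfold_locales (rule yd)
  interpret M': yd_object C A \<kappa> m u \<Delta> \<epsilon> M' \<sigma>' r' \<delta>' by unfold_locales (rule yd)
  let ?s = "half_tensor M \<sigma> M' \<sigma>'" and ?d = "diag_coaction M \<sigma> \<delta> M' \<delta>'"
  have fin: "final [M, M'] [Mu 0, Cr M \<sigma> A 1, Co \<delta> M 0, Co \<delta>' M' 1] = Some [A, M, M']" by simp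
  note de = diag_coaction_expr[OF D(4) D'(4) D(2)]
  have dc: "cell ([M, M'], ?d, [A, M, M'])" unfolding de by (rule expr_cell[OF fin])
  have da: "(n, [M, M'], ?d, [A, M, M']) \<bullet> x = Mu n \<bullet> Cr M \<sigma> A (n + 1) \<bullet> Co \<delta> M n \<bullet> Co \<delta>' M' (n + 1) \<bullet> x" if "has n [M, M'] x" for n x
    unfolding de using expr_act[OF fin that] by simp
  have hb: "half_braiding C (M \<odot> M') ?s" using half_tensor_half_braiding D D' by blast
  have dc': "cell ([M \<odot> M'], ?d, [A, M \<odot> M'])" using dc by (simp add: cell_iff tensor_obj)
  have "expr [M, M'] [Ep 0, (0, [M, M'], ?d, [A, M, M'])] = expr [M, M'] []"
    by (rule expr_eqI[where V = "[M, M']"])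
      (use dc in \<open>simp_all add: bialgebra_moves da M.crossM M.coact_counit M'.coact_counit slide_right_out\<close>)
  then have "(\<epsilon> \<otimes> \<one> (M \<odot> M')) \<cdot> ?d = \<one> (M \<odot> M')" using dc by simp
  then show "from_center (to_center (X \<odot>\<^bsub>YD\<^esub> Y)) = X \<odot>\<^bsub>YD\<^esub> Y"
    using from_to_center[OF _ hb dc'] by (simp add: eq tensor_obj)
  have "yd_braid (M \<odot> M') ?s ?d N t = (yd_braid M \<sigma> \<delta> N t \<otimes> \<one> M') \<cdot> (\<one> M \<otimes> yd_braid M' \<sigma>' \<delta>' N t)" if N: "module N t" for N t
  proof -
    note c = module_cell[OF N] and o = module_obj[OF N]
    note hc = half_tensor_cell[OF D(1,2) D'(1,2) o] and ha = half_tensor_act[OF D(1,2) D'(1,2) o]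
    note gc = yd_braid_cell[OF D(4,2) c] yd_braid_cell[OF D'(4,2) c] and ga = yd_braid_act[OF D(4,2) c] yd_braid_act[OF D'(4,2) c]
    have "expr [M, M', N] [Ac t N 0, (1, [M, M', N], ?s N, [N, M, M']), (0, [M, M'], ?d, [A, M, M'])]
      = expr [M, M', N] [Ga M \<sigma> \<delta> N t 0, Ga M' \<sigma>' \<delta>' N t 1]"
      by (rule expr_eqI[where V = "[N, M, M']"])
        (use c o hc gc dc N in \<open>simp_all add: has_def ha da ga M.crossM slide_right_out,
           simp add: has_def act_mult M.crossM slide_right_in\<close>)
    then show ?thesis using c o hc gc dc N by (simp add: yd_braid_def[of "M \<odot> M'"])
  qed
  then have "(\<lambda>(N, t)\<in>Obj AC. yd_braid (M \<odot> M') ?s ?d N t) = (\<lambda>X\<in>Obj AC. ((\<lambda>(N, t)\<in>Obj AC. yd_braid M \<sigma> \<delta> N t) X \<otimes>\<^bsub>AC\<^esub> \<one>\<^bsub>AC\<^esub> (M', r')) \<cdot>\<^bsub>AC\<^esub> (\<one>\<^bsub>AC\<^esub> (M, r) \<otimes>\<^bsub>AC\<^esub> (\<lambda>(N, t)\<in>Obj AC. yd_braid M' \<sigma>' \<delta>' N t) X))"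
    by (intro restrict_ext) auto
  then show "to_center (X \<odot>\<^bsub>YD\<^esub> Y) = to_center X \<odot>\<^bsub>center AC\<^esub> to_center Y"
    by (simp add: eq to_center_def moncat.center_simps(5)[OF AC_moncat] moncat.half_tensor_def[OF AC_moncat])
qed

end

section \<open>Transport of the braided structure\<close>

text \<open>A bijection on objects that identifies hom-sets and preserves all operations carries the axioms of a braided
  monoidal category from \<open>D\<close> back to \<open>C\<close>. Equations between objects of \<open>C\<close> hold by injectivity.\<close>

lemma braided_isomorphism_transport:
  fixes C :: "('o, 'a) braided_moncat" and D :: "('p, 'a) braided_moncat"
  assumes D: "braided_monoidal_category D"
    and F: "\<And>X. X \<in> Obj C \<Longrightarrow> F X \<in> Obj D" "\<And>X. X \<in> Obj C \<Longrightarrow> G (F X) = X"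
    and G: "\<And>Y. Y \<in> Obj D \<Longrightarrow> G Y \<in> Obj C" "\<And>Y. Y \<in> Obj D \<Longrightarrow> F (G Y) = Y"
    and hom: "\<And>X Y. X \<in> Obj C \<Longrightarrow> Y \<in> Obj C \<Longrightarrow> Hom C X Y = Hom D (F X) (F Y)"
    and ident: "\<And>X. X \<in> Obj C \<Longrightarrow> \<one>\<^bsub>C\<^esub> X = \<one>\<^bsub>D\<^esub> (F X)"
    and comp: "Comp C = Comp D" and tensor: "TensorArr C = TensorArr D"
    and unit: "TensorUnit C \<in> Obj C" "F (TensorUnit C) = TensorUnit D"
    and tensor_obj: "\<And>X Y. X \<in> Obj C \<Longrightarrow> Y \<in> Obj C \<Longrightarrow> X \<odot>\<^bsub>C\<^esub> Y \<in> Obj C"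
      "\<And>X Y. X \<in> Obj C \<Longrightarrow> Y \<in> Obj C \<Longrightarrow> F (X \<odot>\<^bsub>C\<^esub> Y) = F X \<odot>\<^bsub>D\<^esub> F Y"
    and braid: "\<And>X Y. X \<in> Obj C \<Longrightarrow> Y \<in> Obj C \<Longrightarrow> \<tau>\<^bsub>C\<^esub> X Y = \<tau>\<^bsub>D\<^esub> (F X) (F Y)"
  shows "braided_strict_monoidal_isomorphism C D F (\<lambda>X Y f. f)"
proof -
  interpret D: braided_monoidal_category D by (rule D)
  have inj: "X = Y" if "F X = F Y" "X \<in> Obj C" "Y \<in> Obj C" for X Y
    using that F(2) by metis
  note t = F(1) hom ident comp tensor unit tensor_obj braid
  interpret C: strict_monoidal_category C
  proof
    fix X Y Z f assume "X \<in> Obj C" "Y \<in> Obj C" "Z \<in> Obj C"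
    then show "(X \<odot>\<^bsub>C\<^esub> Y) \<odot>\<^bsub>C\<^esub> Z = X \<odot>\<^bsub>C\<^esub> (Y \<odot>\<^bsub>C\<^esub> Z)"
      by (intro inj) (simp_all add: t D.tensor_obj_assoc)
  next
    fix X assume X: "X \<in> Obj C"
    then show "TensorUnit C \<odot>\<^bsub>C\<^esub> X = X" by (intro inj) (simp_all add: t D.tensor_obj_unit_left)
    show "X \<odot>\<^bsub>C\<^esub> TensorUnit C = X" using X by (intro inj) (simp_all add: t D.tensor_obj_unit_right)
  next
    fix X Y f assume a: "X \<in> Obj C" "Y \<in> Obj C" "f \<in> Hom C X Y"
    then show "\<one>\<^bsub>C\<^esub> Y \<cdot>\<^bsub>C\<^esub> f = f" using D.comp_ident_left[of "F X" "F Y" f] by (simp add: t)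
    show "f \<cdot>\<^bsub>C\<^esub> \<one>\<^bsub>C\<^esub> X = f" using a D.comp_ident_right[of "F X" "F Y" f] by (simp add: t)
    show "\<one>\<^bsub>C\<^esub> (TensorUnit C) \<otimes>\<^bsub>C\<^esub> f = f" using a D.tensor_arr_unit_left[of "F X" "F Y" f] by (simp add: t)
    show "f \<otimes>\<^bsub>C\<^esub> \<one>\<^bsub>C\<^esub> (TensorUnit C) = f" using a D.tensor_arr_unit_right[of "F X" "F Y" f] by (simp add: t)
  next
    fix X Y Z f g assume "X \<in> Obj C" "Y \<in> Obj C" "Z \<in> Obj C" "f \<in> Hom C X Y" "g \<in> Hom C Y Z"
    then show "g \<cdot>\<^bsub>C\<^esub> f \<in> Hom C X Z" using D.comp_hom[of "F X" "F Y" "F Z" f g] by (simp add: t)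
  next
    fix W X Y Z f g h assume "W \<in> Obj C" "X \<in> Obj C" "Y \<in> Obj C" "Z \<in> Obj C" "f \<in> Hom C W X" "g \<in> Hom C X Y" "h \<in> Hom C Y Z"
    then show "(h \<cdot>\<^bsub>C\<^esub> g) \<cdot>\<^bsub>C\<^esub> f = h \<cdot>\<^bsub>C\<^esub> g \<cdot>\<^bsub>C\<^esub> f" using D.comp_assoc[of "F W" "F X" "F Y" "F Z" f g h] by (simp add: t)
  next
    fix X Y X' Y' f f' assume "X \<in> Obj C" "Y \<in> Obj C" "X' \<in> Obj C" "Y' \<in> Obj C" "f \<in> Hom C X Y" "f' \<in> Hom C X' Y'"
    then show "f \<otimes>\<^bsub>C\<^esub> f' \<in> Hom C (X \<odot>\<^bsub>C\<^esub> X') (Y \<odot>\<^bsub>C\<^esub> Y')"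
      using D.tensor_hom[of "F X" "F Y" "F X'" "F Y'" f f'] by (simp add: t)
  next
    fix X Y Z X' Y' Z' f g f' g' assume "X \<in> Obj C" "Y \<in> Obj C" "Z \<in> Obj C" "X' \<in> Obj C" "Y' \<in> Obj C" "Z' \<in> Obj C"
      "f \<in> Hom C X Y" "g \<in> Hom C Y Z" "f' \<in> Hom C X' Y'" "g' \<in> Hom C Y' Z'"
    then show "(g \<otimes>\<^bsub>C\<^esub> g') \<cdot>\<^bsub>C\<^esub> (f \<otimes>\<^bsub>C\<^esub> f') = (g \<cdot>\<^bsub>C\<^esub> f) \<otimes>\<^bsub>C\<^esub> (g' \<cdot>\<^bsub>C\<^esub> f')"
      using D.interchange[of "F X" "F Y" "F Z" "F X'" "F Y'" "F Z'" f g f' g'] by (simp add: t)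
  next
    fix X Y Z X' Y' Z' f g h assume "X \<in> Obj C" "Y \<in> Obj C" "Z \<in> Obj C" "X' \<in> Obj C" "Y' \<in> Obj C" "Z' \<in> Obj C"
      "f \<in> Hom C X X'" "g \<in> Hom C Y Y'" "h \<in> Hom C Z Z'"
    then show "(f \<otimes>\<^bsub>C\<^esub> g) \<otimes>\<^bsub>C\<^esub> h = f \<otimes>\<^bsub>C\<^esub> g \<otimes>\<^bsub>C\<^esub> h"
      using D.tensor_arr_assoc[of "F X" "F Y" "F Z" "F X'" "F Y'" "F Z'" f g h] by (simp add: t)
  qed (simp_all add: t D.ident_hom D.tensor_ident)
  interpret C: braided_monoidal_category C
  proof
    fix X Y assume "X \<in> Obj C" "Y \<in> Obj C"
    then show "is_iso C (X \<odot>\<^bsub>C\<^esub> Y) (Y \<odot>\<^bsub>C\<^esub> X) (\<tau>\<^bsub>C\<^esub> X Y)"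
      using D.braid_iso[of "F X" "F Y"] by (simp add: is_iso_def t)
  next
    fix X Y X' Y' f g assume "X \<in> Obj C" "Y \<in> Obj C" "X' \<in> Obj C" "Y' \<in> Obj C" "f \<in> Hom C X X'" "g \<in> Hom C Y Y'"
    then show "(g \<otimes>\<^bsub>C\<^esub> f) \<cdot>\<^bsub>C\<^esub> \<tau>\<^bsub>C\<^esub> X Y = \<tau>\<^bsub>C\<^esub> X' Y' \<cdot>\<^bsub>C\<^esub> (f \<otimes>\<^bsub>C\<^esub> g)"
      using D.braid_natural[of "F X" "F Y" "F X'" "F Y'" f g] by (simp add: t)
  next
    fix X Y Z assume a: "X \<in> Obj C" "Y \<in> Obj C" "Z \<in> Obj C"
    then show "\<tau>\<^bsub>C\<^esub> (X \<odot>\<^bsub>C\<^esub> Y) Z = (\<tau>\<^bsub>C\<^esub> X Z \<otimes>\<^bsub>C\<^esub> \<one>\<^bsub>C\<^esub> Y) \<cdot>\<^bsub>C\<^esub> (\<one>\<^bsub>C\<^esub> X \<otimes>\<^bsub>C\<^esub> \<tau>\<^bsub>C\<^esub> Y Z)"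
      using D.braid_tensor_left[of "F X" "F Y" "F Z"] by (simp add: t)
    show "\<tau>\<^bsub>C\<^esub> X (Y \<odot>\<^bsub>C\<^esub> Z) = (\<one>\<^bsub>C\<^esub> Y \<otimes>\<^bsub>C\<^esub> \<tau>\<^bsub>C\<^esub> X Z) \<cdot>\<^bsub>C\<^esub> (\<tau>\<^bsub>C\<^esub> X Y \<otimes>\<^bsub>C\<^esub> \<one>\<^bsub>C\<^esub> Z)"
      using a D.braid_tensor_right[of "F X" "F Y" "F Z"] by (simp add: t)
  qed
  have "braided_strict_monoidal_functor C D F (\<lambda>X Y f. f)"
    by unfold_locales (simp_all add: t)
  moreover have "braided_strict_monoidal_functor D C G (\<lambda>X Y f. f)"
  proof unfold_locales
    show "G (TensorUnit D) = TensorUnit C" using F(2)[OF unit(1)] by (simp add: unit)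
  next
    fix X Y assume "X \<in> Obj D" "Y \<in> Obj D"
    then show "G (X \<odot>\<^bsub>D\<^esub> Y) = G X \<odot>\<^bsub>C\<^esub> G Y"
      using F(2)[of "G X \<odot>\<^bsub>C\<^esub> G Y"] by (simp add: t G)
  qed (simp_all add: t G)
  ultimately show ?thesis
    unfolding braided_strict_monoidal_isomorphism_def using F G
    by (intro conjI exI[of _ G] exI[of _ "\<lambda>X Y f. f"]) simp_all
qed

context central_hopf
begin

lemma to_center_object:
  assumes "X \<in> Obj YD" shows "to_center X \<in> Obj (center AC)"
proof -
  obtain M \<sigma> r \<delta> where X: "X = ((M, \<sigma>), r, \<delta>)" by (metis surj_pair)
  interpret yd_hopf C A \<kappa> m u \<Delta> \<epsilon> S T R M \<sigma> r \<delta> by unfold_locales (use assms in \<open>simp add: X\<close>)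
  show ?thesis
    using gamma_half_braiding moncat.center_simps(1)[OF AC_moncat] by (simp add: X to_center_def gamma_def)
qed

theorem yetter_drinfeld_center_isomorphism:
  "braided_strict_monoidal_isomorphism YD (center AC) to_center (\<lambda>X Y f. f)"
proof -
  note cs = moncat.center_simps[OF AC_moncat]
  interpret Z: braided_monoidal_category "center AC" using moncat.center_braided[OF AC_moncat] .
  have GF: "from_center (to_center X) = X" if "X \<in> Obj YD" for X
  proof -
    obtain M \<sigma> r \<delta> where X: "X = ((M, \<sigma>), r, \<delta>)" by (metis surj_pair)
    have "yd M \<sigma> r \<delta>" using that by (simp add: X)
    from from_to_center[OF ydD(1,2,4)[OF this] yd_counit[OF this]] show ?thesis unfolding X .
  qed
  have "yd_braid (TensorUnit C) (\<lambda>X\<in>Obj C. \<one> X) u N t = \<one> N" if N: "module N t" for N t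
  proof -
    have o: "N \<in> Obj C" using N by simp
    have t: "t \<in> Hom C (A \<odot> N) N" using module_cell[OF N] by (simp add: cell_iff)
    have "\<one> (A \<odot> N) \<cdot> (u \<otimes> \<one> N) = u \<otimes> \<one> N"
      using tensor_hom[OF unit_obj A o o _ ident_hom[OF o], of u] structure_hom(2)
        comp_ident_left[of N "A \<odot> N" "u \<otimes> \<one> N"] o
      by (simp add: tensor_obj tensor_obj_unit_left)
    then show ?thesis
      using N tensor_arr_unit_right[OF _ _ t] by (simp add: yd_braid_def o tensor_ident tensor_obj module_def)
  qed
  then have unit: "to_center (TensorUnit YD) = TensorUnit (center AC)"
    by (auto simp add: to_center_def cs intro!: restrict_ext)
  have "from_center (TensorUnit (center AC)) = TensorUnit YD"
  proof -
    have "(\<epsilon> \<otimes> \<one> (TensorUnit C)) \<cdot> u = \<one> (TensorUnit C)"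
      using bialgebra_eqs(10) tensor_arr_unit_right[OF A unit_obj, of \<epsilon>] structure_hom(4) by simp
    moreover have "cell ([TensorUnit C], u, [A, TensorUnit C])"
      using structure_cell(2) unit_obj by (simp add: cell_iff tensor_obj_unit_right)
    ultimately show ?thesis
      using from_to_center[OF unit_obj unit_half_braiding, of u \<epsilon>] unit by simp
  qed
  then have unit_YD: "TensorUnit YD \<in> Obj YD"
    using from_center(1)[OF Z.unit_obj] by simp
  show ?thesis
  proof (rule braided_isomorphism_transport[where G = from_center])
    show "braided_monoidal_category (center AC)" using moncat.center_braided[OF AC_moncat] .
    show "TensorUnit YD \<in> Obj YD" by (rule unit_YD)
    show "to_center (TensorUnit YD) = TensorUnit (center AC)" by (rule unit)
    show "Comp YD = Comp (center AC)" "TensorArr YD = TensorArr (center AC)" by (simp_all add: cs)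
    show "from_center Y \<in> Obj YD" "to_center (from_center Y) = Y" if "Y \<in> Obj (center AC)" for Y
      using that by (rule from_center)+
    fix X assume X: "X \<in> Obj YD"
    show "to_center X \<in> Obj (center AC)" using X by (rule to_center_object)
    show "from_center (to_center X) = X" using X by (rule GF)
    show "\<one>\<^bsub>YD\<^esub> X = \<one>\<^bsub>center AC\<^esub> (to_center X)"
      by (cases X) (auto simp: to_center_def cs split: prod.splits)
    fix Y assume Y: "Y \<in> Obj YD"
    show "Hom YD X Y = Hom (center AC) (to_center X) (to_center Y)" using X Y by (rule hom_to_center)
    show "to_center (X \<odot>\<^bsub>YD\<^esub> Y) = to_center X \<odot>\<^bsub>center AC\<^esub> to_center Y" using X Y by (rule tensor_to_center(1))
    then show "X \<odot>\<^bsub>YD\<^esub> Y \<in> Obj YD"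
      using from_center(1)[of "to_center (X \<odot>\<^bsub>YD\<^esub> Y)"] tensor_to_center(2)[OF X Y]
        Z.tensor_obj[OF to_center_object[OF X] to_center_object[OF Y]] by simp
    obtain M \<sigma> r \<delta> M' \<sigma>' r' \<delta>' where eq: "X = ((M, \<sigma>), r, \<delta>)" "Y = ((M', \<sigma>'), r', \<delta>')" by (metis surj_pair)
    show "\<tau>\<^bsub>YD\<^esub> X Y = \<tau>\<^bsub>center AC\<^esub> (to_center X) (to_center Y)"
      using Y ydD(3) by (simp add: eq to_center_def cs)
  qed
qed

end

theorem proposition2p13:
  fixes C :: "('o, 'a) moncat" (structure)
    and H :: "('o \<times> ('o \<Rightarrow> 'a), 'a) bialg"
  assumes "strict_monoidal_category C"
    and "hopf_algebra (center C) H"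
  shows "braided_strict_monoidal_isomorphism
    (yetter_drinfeld (center C) H)
    (center (module_category C H))
    (\<lambda>((M, \<sigma>), r, \<delta>).
       ((M, r),
        \<lambda>(N, t) \<in> Obj (module_category C H).
          (t \<otimes> \<one> M) \<cdot> (\<one> (fst (Carrier H)) \<otimes> \<sigma> N) \<cdot> (\<delta> \<otimes> \<one> N)))
    (\<lambda>X Y f. f)"
proof -
  obtain A \<kappa> m u \<Delta> \<epsilon> where H: "H = \<lparr>Carrier = (A, \<kappa>), Mult = m, Unt = u, Comult = \<Delta>, Counit = \<epsilon>\<rparr>"
    by (metis bialg.cases surj_pair)
  interpret moncat C using assms(1) by (simp add: moncat_def)
  interpret B: central_bialgebra C A \<kappa> m u \<Delta> \<epsilon>
    by unfold_locales (use assms(2) in \<open>simp add: hopf_algebra_def H\<close>)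
  obtain S where S: "is_iso (center C) (A, \<kappa>) (A, \<kappa>) S" "m \<cdot> (S \<otimes> \<one> A) \<cdot> \<Delta> = u \<cdot> \<epsilon>" "m \<cdot> (\<one> A \<otimes> S) \<cdot> \<Delta> = u \<cdot> \<epsilon>"
    using assms(2) by (auto simp add: hopf_algebra_def H Let_def)
  obtain T where T: "T \<in> Hom (center C) (A, \<kappa>) (A, \<kappa>)" "T \<cdot> S = \<one> A" "S \<cdot> T = \<one> A"
    using S(1) by (auto simp add: is_iso_def)
  obtain R where R: "R \<in> Hom C (A \<odot> A) (A \<odot> A)" "R \<cdot> \<kappa> A = \<one> (A \<odot> A)" "\<kappa> A \<cdot> R = \<one> (A \<odot> A)"
    using hb_iso[OF B.hbA B.A] by (auto simp: is_iso_def)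
  interpret central_hopf C A \<kappa> m u \<Delta> \<epsilon> S T R
    by unfold_locales (use S T R in \<open>auto simp: is_iso_def\<close>)
  show ?thesis
    using yetter_drinfeld_center_isomorphism unfolding H B.to_center_def B.yd_braid_def by simp
qed

end
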